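(* Let $M(\phi,\xi,\eta,g_M)$ be a Sasakian manifold, $(N,g_N)$ a Riemannian manifold, and $F:M(\phi,\xi,\eta,g_M)\to(N,g_N)$ an anti-invariant Riemannian submersion such that $(\ker F_* )^\perp=\phi\ker F_*\oplus\{\xi\}$. Then $F$ is harmonic if and only if $\operatorname{Trace}\phi\mathcal{T}_V=0$ for all $V\in\Gamma(\ker F_* )$.
   Context: A Sasakian manifold $M(\phi,\xi,\eta,g_M)$ is a smooth manifold with a $(1,1)$-tensor field $\phi$, a vector field $\xi$ (the characteristic vector field), a 1-form $\eta$ and a Riemannian metric $g_M$ such that $\phi^2=-I+\eta\otimes\xi$, $\phi\xi=0$, $\eta\circ\phi=0$, $\eta(\xi)=1$, $g_M(\phi X,\phi Y)=g_M(X,Y)-\eta(X)\eta(Y)$, $\eta(X)=g_M(X,\xi)$, and $(\nabla_X\phi)Y=g_M(X,Y)\xi-\eta(Y)X$, where $\nabla$ is the Levi-Civita connection of $g_M$ (so that $\nabla_X\xi=-\phi X$). A Riemannian submersion $F:(M,g_M)\to(N,g_N)$ is a smooth surjective map of maximal rank whose differential $F_*$ preserves lengths of horizontal vectors. Vertical means tangent to $\ker F_*$; horizontal means tangent to $(\ker F_* )^\perp$; $\mathcal V,\mathcal H$ are the corresponding orthogonal projections. $F$ is anti-invariant if $\phi(\ker F_* )\subseteq(\ker F_* )^\perp$. $\{\xi\}$ denotes the line distribution spanned by $\xi$, and $\oplus$ is an orthogonal direct sum. O'Neill's tensor $\mathcal T$ is $\mathcal{T}_EG=\mathcal{H}\nabla_{\mathcal{V}E}\mathcal{V}G+\mathcal{V}\nabla_{\mathcal{V}E}\mathcal{H}G$.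 For vertical $V$, $\operatorname{Trace}\phi\mathcal T_V=\sum_{i=1}^k g_M(\phi\mathcal T_Ve_i,e_i)$, where $e_1,\dots,e_k$ is a local orthonormal frame of $\ker F_*$. The second fundamental form of $F$ is $(\nabla F_* )(X,Y)=\nabla^F_XF_*(Y)-F_*(\nabla_XY)$ with $\nabla^F$ the pullback connection; $F$ is harmonic if the trace of $\nabla F_*$ over an orthonormal frame of $TM$ vanishes. *)

theory Defs
  imports "HOL-Analysis.Analysis"
begin

section \<open>Smooth manifolds\<close>

text \<open>
  Infinite differentiability on an open subset of a normed space: all iterated directional
  derivatives exist and are continuous. The value of the function outside the set is irrelevant.
\<close>

primrec Ck_on :: "nat \<Rightarrow> 'a::real_normed_vector set \<Rightarrow> ('a \<Rightarrow> 'b::real_normed_vector) \<Rightarrow> bool" where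
  "Ck_on 0 S f \<longleftrightarrow> continuous_on S f"
| "Ck_on (Suc n) S f \<longleftrightarrow>
     (\<forall>x\<in>S. f differentiable (at x)) \<and> (\<forall>v. Ck_on n S (\<lambda>x. frechet_derivative f (at x) v))"

definition smooth_on :: "'a::real_normed_vector set \<Rightarrow> ('a \<Rightarrow> 'b::real_normed_vector) \<Rightarrow> bool" where
  "smooth_on S f \<longleftrightarrow> (\<forall>n. Ck_on n S f)"

text \<open>
  A chart is a pair of a domain and a coordinate map; only the values of the map on the domain
  matter. The underlying set of a manifold is a whole topological type.
\<close>

type_synonym ('a, 'e) chart = "'a set \<times> ('a \<Rightarrow> 'e)"

abbreviation cdom :: "('a, 'e) chart \<Rightarrow> 'a set" where "cdom c \<equiv> fst c"
abbreviation cmap :: "('a, 'e) chart \<Rightarrow> 'a \<Rightarrow> 'e" where "cmap c \<equiv> snd c"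

definition cinv :: "('a, 'e) chart \<Rightarrow> 'e \<Rightarrow> 'a" where
  "cinv c = inv_into (cdom c) (cmap c)"

definition is_chart :: "('a::topological_space, 'e::euclidean_space) chart \<Rightarrow> bool" where
  "is_chart c \<longleftrightarrow> open (cdom c) \<and> open (cmap c ` cdom c) \<and>
     homeomorphism (cdom c) (cmap c ` cdom c) (cmap c) (cinv c)"

text \<open>
  The atlas need not be maximal; it determines the smooth structure. Hausdorff and second countable
  are imposed by the sort of the point type.
\<close>

definition smooth_manifold ::
  "('a::{t2_space, second_countable_topology}, 'e::euclidean_space) chart set \<Rightarrow> bool" where
  "smooth_manifold A \<longleftrightarrow>
     (\<forall>c\<in>A. is_chart c) \<and> (\<Union>c\<in>A. cdom c) = UNIV \<and>
     (\<forall>c\<in>A. \<forall>d\<in>A. smooth_on (cmap c ` (cdom c \<inter> cdom d)) (cmap d \<circ> cinv c))"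

text \<open>
  One chart \<open>chart_at A p\<close> around each point \<open>p\<close> is selected once and for all, and the tangent
  space at \<open>p\<close> is identified with the model space \<open>'e\<close> by taking components in that chart. So a
  vector field is a function \<open>X :: 'a \<Rightarrow> 'e\<close> where \<open>X p\<close> are the components of a tangent vector with
  respect to \<open>chart_at A p\<close>. As the selected chart jumps with \<open>p\<close>, smoothness is never that of
  \<open>X\<close> as a function into \<open>'e\<close>: components must first be transformed to a fixed chart \<open>c\<close>, which is
  what \<open>tcoord A c p\<close> does.
\<close>

definition chart_at :: "('a, 'e) chart set \<Rightarrow> 'a \<Rightarrow> ('a, 'e) chart" where
  "chart_at A p = (SOME c. c \<in> A \<and> p \<in> cdom c)"

definition tcoord ::
  "('a, 'e::euclidean_space) chart set \<Rightarrow> ('a, 'e) chart \<Rightarrow> 'a \<Rightarrow> 'e \<Rightarrow> 'e" where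
  "tcoord A c p v =
     frechet_derivative (cmap c \<circ> cinv (chart_at A p)) (at (cmap (chart_at A p) p)) v"

definition smooth_fun_on ::
  "('a::topological_space, 'e::euclidean_space) chart set \<Rightarrow> 'a set \<Rightarrow> ('a \<Rightarrow> real) \<Rightarrow> bool" where
  "smooth_fun_on A U f \<longleftrightarrow> open U \<and> (\<forall>c\<in>A. smooth_on (cmap c ` (cdom c \<inter> U)) (f \<circ> cinv c))"

definition dfun ::
  "('a, 'e::euclidean_space) chart set \<Rightarrow> ('a \<Rightarrow> real) \<Rightarrow> 'a \<Rightarrow> 'e \<Rightarrow> real" where
  "dfun A f p v = frechet_derivative (f \<circ> cinv (chart_at A p)) (at (cmap (chart_at A p) p)) v"

definition smooth_map ::
  "('a::topological_space, 'e::euclidean_space) chart set \<Rightarrow>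
   ('b::topological_space, 'f::euclidean_space) chart set \<Rightarrow> ('a \<Rightarrow> 'b) \<Rightarrow> bool" where
  "smooth_map A B F \<longleftrightarrow> continuous_on UNIV F \<and>
     (\<forall>c\<in>A. \<forall>d\<in>B. smooth_on (cmap c ` (cdom c \<inter> F -` cdom d)) (cmap d \<circ> F \<circ> cinv c))"

definition tangent_map ::
  "('a, 'e::euclidean_space) chart set \<Rightarrow> ('b, 'f::euclidean_space) chart set \<Rightarrow>
   ('a \<Rightarrow> 'b) \<Rightarrow> 'a \<Rightarrow> 'e \<Rightarrow> 'f" where
  "tangent_map A B F p v =
     frechet_derivative (cmap (chart_at B (F p)) \<circ> F \<circ> cinv (chart_at A p))
       (at (cmap (chart_at A p) p)) v"

text \<open>
  Smooth vector fields along a map \<open>F\<close> (sections of the pullback of the tangent bundle of the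
  target, so \<open>W p\<close> is tangent at \<open>F p\<close>), defined on an open set \<open>U\<close>. Vector fields are the case
  where \<open>F\<close> is the identity.
\<close>

definition field_along_on ::
  "('a::topological_space, 'e::euclidean_space) chart set \<Rightarrow>
   ('b::topological_space, 'f::euclidean_space) chart set \<Rightarrow>
   ('a \<Rightarrow> 'b) \<Rightarrow> 'a set \<Rightarrow> ('a \<Rightarrow> 'f) \<Rightarrow> bool" where
  "field_along_on A B F U W \<longleftrightarrow> open U \<and>
     (\<forall>c\<in>A. \<forall>d\<in>B. smooth_on (cmap c ` (cdom c \<inter> U \<inter> F -` cdom d))
        (\<lambda>x. tcoord B d (F (cinv c x)) (W (cinv c x))))"

abbreviation vector_field_on ::
  "('a::topological_space, 'e::euclidean_space) chart set \<Rightarrow> 'a set \<Rightarrow> ('a \<Rightarrow> 'e) \<Rightarrow> bool" where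
  "vector_field_on A U X \<equiv> field_along_on A A (\<lambda>p. p) U X"

definition lie_bracket ::
  "('a, 'e::euclidean_space) chart set \<Rightarrow> ('a \<Rightarrow> 'e) \<Rightarrow> ('a \<Rightarrow> 'e) \<Rightarrow> 'a \<Rightarrow> 'e" where
  "lie_bracket A X Y p =
     (let c = chart_at A p;
          rep = (\<lambda>Z x. tcoord A c (cinv c x) (Z (cinv c x)))
      in frechet_derivative (rep Y) (at (cmap c p)) (X p)
         - frechet_derivative (rep X) (at (cmap c p)) (Y p))"

definition one_form ::
  "('a::topological_space, 'e::euclidean_space) chart set \<Rightarrow> ('a \<Rightarrow> 'e \<Rightarrow> real) \<Rightarrow> bool" where
  "one_form A \<omega> \<longleftrightarrow> (\<forall>p. linear (\<omega> p)) \<and>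
     (\<forall>U X. vector_field_on A U X \<longrightarrow> smooth_fun_on A U (\<lambda>p. \<omega> p (X p)))"

definition endo_field ::
  "('a::topological_space, 'e::euclidean_space) chart set \<Rightarrow> ('a \<Rightarrow> 'e \<Rightarrow> 'e) \<Rightarrow> bool" where
  "endo_field A \<phi> \<longleftrightarrow> (\<forall>p. linear (\<phi> p)) \<and>
     (\<forall>U X. vector_field_on A U X \<longrightarrow> vector_field_on A U (\<lambda>p. \<phi> p (X p)))"


section \<open>Riemannian metrics and connections\<close>

definition riemannian_metric ::
  "('a::topological_space, 'e::euclidean_space) chart set \<Rightarrow> ('a \<Rightarrow> 'e \<Rightarrow> 'e \<Rightarrow> real) \<Rightarrow> bool" where
  "riemannian_metric A g \<longleftrightarrow>
     (\<forall>p. bilinear (g p) \<and> (\<forall>v w. g p v w = g p w v) \<and> (\<forall>v. v \<noteq> 0 \<longrightarrow> g p v v > 0)) \<and>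
     (\<forall>U X Y. vector_field_on A U X \<and> vector_field_on A U Y \<longrightarrow>
        smooth_fun_on A U (\<lambda>p. g p (X p) (Y p)))"

text \<open>
  A connection on the pullback of the tangent bundle of the target along \<open>F\<close>: \<open>D W p v\<close> is the
  covariant derivative at \<open>p\<close> of the field \<open>W\<close> along \<open>F\<close> in the direction of the tangent vector
  \<open>v\<close>. It acts on fields defined on arbitrary open sets \<open>U\<close> (each field is represented by a total
  function, and \<open>D W p\<close> is only specified where \<open>W\<close> is smooth near \<open>p\<close>); locality, that is
  compatibility with restriction to smaller open sets, is a consequence of the Leibniz rule.
\<close>

definition connection_along ::
  "('a::topological_space, 'e::euclidean_space) chart set \<Rightarrow>
   ('b::topological_space, 'f::euclidean_space) chart set \<Rightarrow>
   ('a \<Rightarrow> 'b) \<Rightarrow> (('a \<Rightarrow> 'f) \<Rightarrow> 'a \<Rightarrow> 'e \<Rightarrow> 'f) \<Rightarrow> bool" where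
  "connection_along A B F D \<longleftrightarrow>
     (\<forall>U W. field_along_on A B F U W \<longrightarrow> (\<forall>p\<in>U. linear (D W p))) \<and>
     (\<forall>U W Z. field_along_on A B F U W \<and> field_along_on A B F U Z \<longrightarrow>
        (\<forall>p\<in>U. \<forall>v. D (\<lambda>q. W q + Z q) p v = D W p v + D Z p v)) \<and>
     (\<forall>U f W. smooth_fun_on A U f \<and> field_along_on A B F U W \<longrightarrow>
        (\<forall>p\<in>U. \<forall>v. D (\<lambda>q. f q *\<^sub>R W q) p v = dfun A f p v *\<^sub>R W p + f p *\<^sub>R D W p v)) \<and>
     (\<forall>U X W. vector_field_on A U X \<and> field_along_on A B F U W \<longrightarrow>
        field_along_on A B F U (\<lambda>p. D W p (X p)))"

abbreviation affine_connection ::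
  "('a::topological_space, 'e::euclidean_space) chart set \<Rightarrow>
   (('a \<Rightarrow> 'e) \<Rightarrow> 'a \<Rightarrow> 'e \<Rightarrow> 'e) \<Rightarrow> bool" where
  "affine_connection A D \<equiv> connection_along A A (\<lambda>p. p) D"

definition levi_civita ::
  "('a::topological_space, 'e::euclidean_space) chart set \<Rightarrow> ('a \<Rightarrow> 'e \<Rightarrow> 'e \<Rightarrow> real) \<Rightarrow>
   (('a \<Rightarrow> 'e) \<Rightarrow> 'a \<Rightarrow> 'e \<Rightarrow> 'e) \<Rightarrow> bool" where
  "levi_civita A g D \<longleftrightarrow> affine_connection A D \<and>
     (\<forall>U X Y. vector_field_on A U X \<and> vector_field_on A U Y \<longrightarrow>
        (\<forall>p\<in>U. D Y p (X p) - D X p (Y p) = lie_bracket A X Y p)) \<and>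
     (\<forall>U Y Z. vector_field_on A U Y \<and> vector_field_on A U Z \<longrightarrow>
        (\<forall>p\<in>U. \<forall>v. dfun A (\<lambda>q. g q (Y q) (Z q)) p v = g p (D Y p v) (Z p) + g p (Y p) (D Z p v)))"

text \<open>
  The pullback along \<open>F\<close> of an affine connection \<open>D\<^sub>N\<close> of the target is the connection determined by
  its values on fields of the form \<open>Y \<circ> F\<close>.
\<close>

definition pullback_connection ::
  "('a::topological_space, 'e::euclidean_space) chart set \<Rightarrow>
   ('b::topological_space, 'f::euclidean_space) chart set \<Rightarrow> ('a \<Rightarrow> 'b) \<Rightarrow>
   (('b \<Rightarrow> 'f) \<Rightarrow> 'b \<Rightarrow> 'f \<Rightarrow> 'f) \<Rightarrow> (('a \<Rightarrow> 'f) \<Rightarrow> 'a \<Rightarrow> 'e \<Rightarrow> 'f) \<Rightarrow> bool" where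
  "pullback_connection A B F D\<^sub>N D\<^sub>F \<longleftrightarrow> connection_along A B F D\<^sub>F \<and>
     (\<forall>U Y. vector_field_on B U Y \<longrightarrow>
        (\<forall>p \<in> F -` U. \<forall>v. D\<^sub>F (Y \<circ> F) p v = D\<^sub>N Y (F p) (tangent_map A B F p v)))"

text \<open>Smooth orthonormal frames, over an open set \<open>U\<close>, of a distribution \<open>S\<close>.\<close>

definition orthonormal_frame_on ::
  "('a::topological_space, 'e::euclidean_space) chart set \<Rightarrow> ('a \<Rightarrow> 'e \<Rightarrow> 'e \<Rightarrow> real) \<Rightarrow>
   ('a \<Rightarrow> 'e set) \<Rightarrow> 'a set \<Rightarrow> nat \<Rightarrow> (nat \<Rightarrow> 'a \<Rightarrow> 'e) \<Rightarrow> bool" where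
  "orthonormal_frame_on A g S U k e \<longleftrightarrow> open U \<and>
     (\<forall>i<k. vector_field_on A U (e i)) \<and>
     (\<forall>p\<in>U. (\<forall>i<k. \<forall>j<k. g p (e i p) (e j p) = (if i = j then 1 else 0)) \<and>
             span ((\<lambda>i. e i p) ` {..<k}) = S p)"


section \<open>Sasakian manifolds\<close>

text \<open>The last condition is \<open>(\<nabla>\<^sub>v \<phi>) Y = g v Y \<xi> - \<eta> Y v\<close>, with \<open>(\<nabla>\<^sub>v \<phi>) Y = \<nabla>\<^sub>v (\<phi> Y) - \<phi> (\<nabla>\<^sub>v Y)\<close>.\<close>

definition sasakian_manifold ::
  "('a::{t2_space, second_countable_topology}, 'e::euclidean_space) chart set \<Rightarrow>
   ('a \<Rightarrow> 'e \<Rightarrow> 'e) \<Rightarrow> ('a \<Rightarrow> 'e) \<Rightarrow> ('a \<Rightarrow> 'e \<Rightarrow> real) \<Rightarrow> ('a \<Rightarrow> 'e \<Rightarrow> 'e \<Rightarrow> real) \<Rightarrow>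
   (('a \<Rightarrow> 'e) \<Rightarrow> 'a \<Rightarrow> 'e \<Rightarrow> 'e) \<Rightarrow> bool" where
  "sasakian_manifold A \<phi> \<xi> \<eta> g D \<longleftrightarrow>
     smooth_manifold A \<and> endo_field A \<phi> \<and> vector_field_on A UNIV \<xi> \<and> one_form A \<eta> \<and>
     riemannian_metric A g \<and> levi_civita A g D \<and>
     (\<forall>p v. \<phi> p (\<phi> p v) = - v + \<eta> p v *\<^sub>R \<xi> p) \<and>
     (\<forall>p. \<phi> p (\<xi> p) = 0) \<and>
     (\<forall>p v. \<eta> p (\<phi> p v) = 0) \<and>
     (\<forall>p. \<eta> p (\<xi> p) = 1) \<and>
     (\<forall>p v w. g p (\<phi> p v) (\<phi> p w) = g p v w - \<eta> p v * \<eta> p w) \<and>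
     (\<forall>p v. \<eta> p v = g p v (\<xi> p)) \<and>
     (\<forall>U Y. vector_field_on A U Y \<longrightarrow>
        (\<forall>p\<in>U. \<forall>v. D (\<lambda>q. \<phi> q (Y q)) p v - \<phi> p (D Y p v) = g p v (Y p) *\<^sub>R \<xi> p - \<eta> p (Y p) *\<^sub>R v))"


section \<open>Riemannian submersions\<close>

definition vertical ::
  "('a, 'e::euclidean_space) chart set \<Rightarrow> ('b, 'f::euclidean_space) chart set \<Rightarrow> ('a \<Rightarrow> 'b) \<Rightarrow>
   'a \<Rightarrow> 'e set" where
  "vertical A B F p = {v. tangent_map A B F p v = 0}"

definition horizontal ::
  "('a, 'e::euclidean_space) chart set \<Rightarrow> ('a \<Rightarrow> 'e \<Rightarrow> 'e \<Rightarrow> real) \<Rightarrow>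
   ('b, 'f::euclidean_space) chart set \<Rightarrow> ('a \<Rightarrow> 'b) \<Rightarrow> 'a \<Rightarrow> 'e set" where
  "horizontal A g B F p = {w. \<forall>v \<in> vertical A B F p. g p w v = 0}"

definition riemannian_submersion ::
  "('a::topological_space, 'e::euclidean_space) chart set \<Rightarrow> ('a \<Rightarrow> 'e \<Rightarrow> 'e \<Rightarrow> real) \<Rightarrow>
   ('b::topological_space, 'f::euclidean_space) chart set \<Rightarrow> ('b \<Rightarrow> 'f \<Rightarrow> 'f \<Rightarrow> real) \<Rightarrow>
   ('a \<Rightarrow> 'b) \<Rightarrow> bool" where
  "riemannian_submersion A g\<^sub>M B g\<^sub>N F \<longleftrightarrow>
     smooth_map A B F \<and> surj F \<and> (\<forall>p. surj (tangent_map A B F p)) \<and>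
     (\<forall>p. \<forall>v \<in> horizontal A g\<^sub>M B F p.
        sqrt (g\<^sub>N (F p) (tangent_map A B F p v) (tangent_map A B F p v)) = sqrt (g\<^sub>M p v v))"

definition anti_invariant ::
  "('a, 'e::euclidean_space) chart set \<Rightarrow> ('a \<Rightarrow> 'e \<Rightarrow> 'e \<Rightarrow> real) \<Rightarrow>
   ('b, 'f::euclidean_space) chart set \<Rightarrow> ('a \<Rightarrow> 'b) \<Rightarrow> ('a \<Rightarrow> 'e \<Rightarrow> 'e) \<Rightarrow> bool" where
  "anti_invariant A g B F \<phi> \<longleftrightarrow> (\<forall>p. \<phi> p ` vertical A B F p \<subseteq> horizontal A g B F p)"

text \<open>
  \<open>R = S \<oplus> T\<close> as an orthogonal direct sum of subspaces with respect to the inner product \<open>h\<close>;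
  orthogonality makes the sum direct.
\<close>

definition orthogonal_direct_sum ::
  "('e::real_vector \<Rightarrow> 'e \<Rightarrow> real) \<Rightarrow> 'e set \<Rightarrow> 'e set \<Rightarrow> 'e set \<Rightarrow> bool" where
  "orthogonal_direct_sum h R S T \<longleftrightarrow>
     (\<forall>s\<in>S. \<forall>t\<in>T. h s t = 0) \<and> R = {s + t | s t. s \<in> S \<and> t \<in> T}"

definition orth_proj ::
  "('e::real_vector \<Rightarrow> 'e \<Rightarrow> real) \<Rightarrow> 'e set \<Rightarrow> 'e \<Rightarrow> 'e" where
  "orth_proj h S v = (THE u. u \<in> S \<and> (\<forall>s\<in>S. h (v - u) s = 0))"

abbreviation ver_proj ::
  "('a, 'e::euclidean_space) chart set \<Rightarrow> ('a \<Rightarrow> 'e \<Rightarrow> 'e \<Rightarrow> real) \<Rightarrow>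
   ('b, 'f::euclidean_space) chart set \<Rightarrow> ('a \<Rightarrow> 'b) \<Rightarrow> 'a \<Rightarrow> 'e \<Rightarrow> 'e" where
  "ver_proj A g B F p \<equiv> orth_proj (g p) (vertical A B F p)"

abbreviation hor_proj ::
  "('a, 'e::euclidean_space) chart set \<Rightarrow> ('a \<Rightarrow> 'e \<Rightarrow> 'e \<Rightarrow> real) \<Rightarrow>
   ('b, 'f::euclidean_space) chart set \<Rightarrow> ('a \<Rightarrow> 'b) \<Rightarrow> 'a \<Rightarrow> 'e \<Rightarrow> 'e" where
  "hor_proj A g B F p \<equiv> orth_proj (g p) (horizontal A g B F p)"

definition oneill_T ::
  "('a, 'e::euclidean_space) chart set \<Rightarrow> ('a \<Rightarrow> 'e \<Rightarrow> 'e \<Rightarrow> real) \<Rightarrow>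
   (('a \<Rightarrow> 'e) \<Rightarrow> 'a \<Rightarrow> 'e \<Rightarrow> 'e) \<Rightarrow> ('b, 'f::euclidean_space) chart set \<Rightarrow> ('a \<Rightarrow> 'b) \<Rightarrow>
   ('a \<Rightarrow> 'e) \<Rightarrow> ('a \<Rightarrow> 'e) \<Rightarrow> 'a \<Rightarrow> 'e" where
  "oneill_T A g D B F E G p =
     hor_proj A g B F p (D (\<lambda>q. ver_proj A g B F q (G q)) p (ver_proj A g B F p (E p))) +
     ver_proj A g B F p (D (\<lambda>q. hor_proj A g B F q (G q)) p (ver_proj A g B F p (E p)))"

text \<open>
  The trace of the fibrewise linear map \<open>\<phi> T\<^sub>V\<close> of the vertical distribution is the function on the
  manifold given near each point by \<open>\<Sum>\<^sub>i g (\<phi> T\<^sub>V e\<^sub>i) e\<^sub>i\<close> for any local orthonormal frame of the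
  vertical distribution there. It does not depend on the frame.
\<close>

definition trace_phi_T_zero ::
  "('a::topological_space, 'e::euclidean_space) chart set \<Rightarrow> ('a \<Rightarrow> 'e \<Rightarrow> 'e \<Rightarrow> real) \<Rightarrow>
   (('a \<Rightarrow> 'e) \<Rightarrow> 'a \<Rightarrow> 'e \<Rightarrow> 'e) \<Rightarrow> ('b::topological_space, 'f::euclidean_space) chart set \<Rightarrow>
   ('a \<Rightarrow> 'b) \<Rightarrow> ('a \<Rightarrow> 'e \<Rightarrow> 'e) \<Rightarrow> ('a \<Rightarrow> 'e) \<Rightarrow> bool" where
  "trace_phi_T_zero A g D B F \<phi> V \<longleftrightarrow>
     (\<forall>U k e. orthonormal_frame_on A g (vertical A B F) U k e \<longrightarrow>
        (\<forall>p\<in>U. (\<Sum>i<k. g p (\<phi> p (oneill_T A g D B F V (e i) p)) (e i p)) = 0))"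

definition vertical_field ::
  "('a::topological_space, 'e::euclidean_space) chart set \<Rightarrow>
   ('b::topological_space, 'f::euclidean_space) chart set \<Rightarrow> ('a \<Rightarrow> 'b) \<Rightarrow> ('a \<Rightarrow> 'e) \<Rightarrow> bool" where
  "vertical_field A B F V \<longleftrightarrow> vector_field_on A UNIV V \<and> (\<forall>p. V p \<in> vertical A B F p)"

definition second_fund_form ::
  "('a, 'e::euclidean_space) chart set \<Rightarrow> (('a \<Rightarrow> 'e) \<Rightarrow> 'a \<Rightarrow> 'e \<Rightarrow> 'e) \<Rightarrow>
   ('b, 'f::euclidean_space) chart set \<Rightarrow> ('a \<Rightarrow> 'b) \<Rightarrow> (('a \<Rightarrow> 'f) \<Rightarrow> 'a \<Rightarrow> 'e \<Rightarrow> 'f) \<Rightarrow>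
   ('a \<Rightarrow> 'e) \<Rightarrow> ('a \<Rightarrow> 'e) \<Rightarrow> 'a \<Rightarrow> 'f" where
  "second_fund_form A D\<^sub>M B F D\<^sub>F X Y p =
     D\<^sub>F (\<lambda>q. tangent_map A B F q (Y q)) p (X p) - tangent_map A B F p (D\<^sub>M Y p (X p))"

text \<open>\<open>D\<^sub>M\<close> is to be the Levi-Civita connection of \<open>g\<^sub>M\<close>, and \<open>D\<^sub>F\<close> the pullback along \<open>F\<close> of that of the target.\<close>

definition harmonic ::
  "('a::topological_space, 'e::euclidean_space) chart set \<Rightarrow> ('a \<Rightarrow> 'e \<Rightarrow> 'e \<Rightarrow> real) \<Rightarrow>
   (('a \<Rightarrow> 'e) \<Rightarrow> 'a \<Rightarrow> 'e \<Rightarrow> 'e) \<Rightarrow> ('b::topological_space, 'f::euclidean_space) chart set \<Rightarrow>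
   ('a \<Rightarrow> 'b) \<Rightarrow> (('a \<Rightarrow> 'f) \<Rightarrow> 'a \<Rightarrow> 'e \<Rightarrow> 'f) \<Rightarrow> bool" where
  "harmonic A g D\<^sub>M B F D\<^sub>F \<longleftrightarrow>
     (\<forall>U k e. orthonormal_frame_on A g (\<lambda>_. UNIV) U k e \<longrightarrow>
        (\<forall>p\<in>U. (\<Sum>i<k. second_fund_form A D\<^sub>M B F D\<^sub>F (e i) (e i) p) = 0))"

end

theory Submission
  imports Defs
begin

text \<open>
  The adapted frame of \<open>TM\<close> over a vertical orthonormal frame \<open>e\<^sub>i\<close> is \<open>e\<^sub>i, \<phi> e\<^sub>i, \<xi>\<close>. The second
  fundamental form of \<open>F\<close> is tensorial and symmetric, and it vanishes on horizontal vectors because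
  \<open>F\<^sub>*\<close> is isometric there, so its trace is \<open>- F\<^sub>* H\<close> with \<open>H = \<Sum>\<^sub>i \<nabla>\<^bsub>e\<^sub>i\<^esub> e\<^sub>i\<close>. The Sasakian identity and
  the integrability of \<open>ker F\<^sub>*\<close> make \<open>g (\<nabla>\<^sub>U V) (\<phi> W)\<close> symmetric in its three vertical arguments, whence
  \<open>Trace \<phi> T\<^sub>V = - g H (\<phi> V)\<close>, while \<open>g H \<xi> = 0\<close>. As \<open>\<phi> (ker F\<^sub>*)\<close> and \<open>\<xi>\<close> span the horizontal space,
  \<open>F\<^sub>* H = 0\<close> if and only if all these traces vanish.
\<close>

section \<open>Calculus of smooth functions\<close>

text \<open>The encoding shapes most of the work. A connection acts on total functions and is
  specified only where its argument is smooth, so locality has to be drawn from the Leibniz rule by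
  means of bump functions. The pullback connection is prescribed only on fields
  \<open>Y \<circ> F\<close>; its metric compatibility and the symmetry of the second fundamental
  form are carried from coordinate fields to all fields by expansions with smooth coefficients. Both
  sides of the equivalence quantify over all frames, so local vertical frames must be shown to
  exist: surjectivity of the differential allows coordinate fields to be corrected to vertical ones,
  and Gram-Schmidt makes them orthonormal. Applying \<open>\<phi>\<close> and adding
  \<open>\<xi>\<close> then gives a horizontal frame over the same open set. The trace formula comes
  from g (\<nabla>_V e_i) (\<phi> e_i): total symmetry lets V trade places with one e_i, which
  leaves \<nabla>_{e_i} e_i paired with \<phi> V.\<close>

lemma has_frechet_derivative:
  "f differentiable F \<Longrightarrow> (f has_derivative frechet_derivative f F) F"
  by (simp add: frechet_derivative_works)

text \<open>\<open>frechet_derivative\<close> chooses among all derivatives, so equal sets of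
  candidates give the same choice, even where no derivative exists.\<close>

lemma frechet_derivative_cong_open:
  assumes "open S" "x \<in> S" "\<And>y. y \<in> S \<Longrightarrow> f y = g y"
  shows "frechet_derivative f (at x) = frechet_derivative g (at x)"
proof -
  have "(f has_derivative f') (at x) \<longleftrightarrow> (g has_derivative f') (at x)" for f'
    using assms has_derivative_transform_within_open[of f f' x UNIV S g]
      has_derivative_transform_within_open[of g f' x UNIV S f] by auto
  then show ?thesis by (simp add: frechet_derivative_def)
qed

lemma differentiable_cong_open:
  assumes "open S" "x \<in> S" "\<And>y. y \<in> S \<Longrightarrow> f y = g y" "f differentiable (at x)"
  shows "g differentiable (at x)"
  using assms has_derivative_transform_within_open[of f _ x UNIV S g]
  unfolding differentiable_def by (metis (no_types))

text \<open>Openness of \<open>S\<close> lets derivatives, taken in the full space, see only the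
  values on \<open>S\<close>; coordinate expressions in charts are meaningful only there.\<close>

lemma Ck_on_cong:
  assumes "open S" "\<And>x. x \<in> S \<Longrightarrow> f x = g x" "Ck_on n S f"
  shows "Ck_on n S g"
  using assms
proof (induction n arbitrary: f g)
  case 0
  then show ?case using continuous_on_eq by auto
next
  case (Suc n)
  have "frechet_derivative f (at x) v = frechet_derivative g (at x) v" if "x \<in> S" for x v
    using frechet_derivative_cong_open[OF Suc.prems(1) that Suc.prems(2)] by simp
  then have "Ck_on n S (\<lambda>x. frechet_derivative g (at x) v)" for v
    using Suc.IH[OF Suc.prems(1), of "\<lambda>x. frechet_derivative f (at x) v"] Suc.prems(3) by simp
  moreover have "g differentiable (at x)" if "x \<in> S" for x
    using differentiable_cong_open[OF Suc.prems(1) that Suc.prems(2)] Suc.prems(3) that by auto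
  ultimately show ?case by auto
qed

lemma Ck_on_subset: "Ck_on n S f \<Longrightarrow> T \<subseteq> S \<Longrightarrow> Ck_on n T f"
  by (induction n arbitrary: f) (auto intro: continuous_on_subset)

lemma Ck_on_Suc_imp: "Ck_on (Suc n) S f \<Longrightarrow> Ck_on n S f"
proof (induction n arbitrary: f)
  case 0
  then show ?case
    by (auto intro!: continuous_at_imp_continuous_on differentiable_imp_continuous_within)
next
  case (Suc n)
  then show ?case by (metis Ck_on.simps(2))
qed

lemma Ck_on_local:
  assumes "\<And>x. x \<in> S \<Longrightarrow> \<exists>T. open T \<and> x \<in> T \<and> Ck_on n T f"
  shows "Ck_on n S f"
  using assms
proof (induction n arbitrary: f)
  case 0
  then have "isCont f x" if "x \<in> S" for x
    using that by (metis Ck_on.simps(1) continuous_on_eq_continuous_at)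
  then show ?case by (simp add: continuous_at_imp_continuous_on)
next
  case (Suc n)
  have "f differentiable (at x)" if "x \<in> S" for x
    using Suc.prems[OF that] by auto
  moreover have "Ck_on n S (\<lambda>x. frechet_derivative f (at x) v)" for v
    by (rule Suc.IH) (use Suc.prems in fastforce)
  ultimately show ?case by simp
qed

lemma Ck_on_const: "Ck_on n S (\<lambda>x. c)"
  by (induction n arbitrary: c) auto

lemma Ck_on_bounded_linear:
  assumes "bounded_linear L" "open S" "Ck_on n S f"
  shows "Ck_on n S (\<lambda>x. L (f x))"
  using assms(3)
proof (induction n arbitrary: f)
  case 0
  then show ?case using bounded_linear.continuous_on[OF assms(1)] by simp
next
  case (Suc n)
  have d: "((\<lambda>x. L (f x)) has_derivative (\<lambda>v. L (frechet_derivative f (at x) v))) (at x)"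
    if "x \<in> S" for x
    using Suc.prems that
    by (intro bounded_linear.has_derivative[OF assms(1)] has_frechet_derivative) auto
  have "Ck_on n S (\<lambda>x. frechet_derivative (\<lambda>x. L (f x)) (at x) v)" for v
    by (rule Ck_on_cong[OF assms(2) _ Suc.IH[of "\<lambda>x. frechet_derivative f (at x) v"]])
      (use Suc.prems frechet_derivative_at[OF d] in \<open>auto simp: fun_eq_iff\<close>)
  then show ?case using d by (auto simp: differentiable_def)
qed

lemma Ck_on_id: "Ck_on n S (\<lambda>x. x)"
  by (cases n) (auto intro: Ck_on_const)

lemma Ck_on_add:
  assumes "open S" "Ck_on n S f" "Ck_on n S g"
  shows "Ck_on n S (\<lambda>x. f x + g x)"
  using assms(2,3)
proof (induction n arbitrary: f g)
  case 0
  then show ?case by (auto intro: continuous_intros)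
next
  case (Suc n)
  have d: "((\<lambda>x. f x + g x) has_derivative
      (\<lambda>v. frechet_derivative f (at x) v + frechet_derivative g (at x) v)) (at x)"
    if "x \<in> S" for x
    using Suc.prems that by (intro has_derivative_add has_frechet_derivative) auto
  have "Ck_on n S (\<lambda>x. frechet_derivative (\<lambda>x. f x + g x) (at x) v)" for v
    by (rule Ck_on_cong[OF assms(1) _ Suc.IH[of "\<lambda>x. frechet_derivative f (at x) v"
            "\<lambda>x. frechet_derivative g (at x) v"]])
      (use Suc.prems frechet_derivative_at[OF d] in \<open>auto simp: fun_eq_iff\<close>)
  then show ?case using d by (auto simp: differentiable_def)
qed

lemma Ck_on_bilinear:
  assumes "bounded_bilinear b" "open S" "Ck_on n S f" "Ck_on n S g"
  shows "Ck_on n S (\<lambda>x. b (f x) (g x))"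
  using assms(3,4)
proof (induction n arbitrary: f g)
  case 0
  then show ?case using bounded_bilinear.continuous_on[OF assms(1)] by auto
next
  case (Suc n)
  have d: "((\<lambda>x. b (f x) (g x)) has_derivative
      (\<lambda>v. b (f x) (frechet_derivative g (at x) v) + b (frechet_derivative f (at x) v) (g x))) (at x)"
    if "x \<in> S" for x
    using Suc.prems that
    by (intro bounded_bilinear.FDERIV[OF assms(1)] has_frechet_derivative) auto
  \<comment> \<open>The product rule mixes derivatives with undifferentiated factors, so the latter
    are lowered to order \<open>n\<close>.\<close>
  have "Ck_on n S f" "Ck_on n S g" using Suc.prems Ck_on_Suc_imp by blast+
  then have "Ck_on n S (\<lambda>x. b (f x) (frechet_derivative g (at x) v) + b (frechet_derivative f (at x) v) (g x))" for v
    using Suc.prems by (intro Ck_on_add assms(2) Suc.IH) auto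
  then have "Ck_on n S (\<lambda>x. frechet_derivative (\<lambda>x. b (f x) (g x)) (at x) v)" for v
    by (rule Ck_on_cong[OF assms(2), rotated])
      (use frechet_derivative_at[OF d] in \<open>auto simp: fun_eq_iff\<close>)
  then show ?case using d by (auto simp: differentiable_def)
qed

lemma Ck_on_sum:
  assumes "open S" "\<And>i. i \<in> I \<Longrightarrow> Ck_on n S (f i)"
  shows "Ck_on n S (\<lambda>x. \<Sum>i\<in>I. f i x)"
  using assms(2)
  by (induction I rule: infinite_finite_induct) (auto intro: Ck_on_const Ck_on_add assms(1))

lemma linear_eq_sum_Basis:
  fixes L :: "'e::euclidean_space \<Rightarrow> 'b::real_vector"
  assumes "linear L"
  shows "L v = (\<Sum>b\<in>Basis. (v \<bullet> b) *\<^sub>R L b)"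
  by (subst euclidean_representation[of v, symmetric])
    (simp add: linear_sum[OF assms] linear_cmul[OF assms])

text \<open>The chain rule differentiates \<open>g\<close> in a direction that moves with
  \<open>x\<close>, while \<open>Ck_on\<close> speaks of fixed directions. The basis expansion turns
  this into finitely many scalars times \<open>frechet_derivative g (at (f x)) b\<close>, to which
  the induction hypothesis applies.\<close>

lemma Ck_on_compose:
  fixes f :: "'a::real_normed_vector \<Rightarrow> 'e::euclidean_space"
    and g :: "'e \<Rightarrow> 'b::real_normed_vector"
  assumes "open S" "open T" "f ` S \<subseteq> T" "Ck_on n S f" "Ck_on n T g"
  shows "Ck_on n S (\<lambda>x. g (f x))"
  using assms(4,5)
proof (induction n arbitrary: g)
  case 0
  then show ?case using continuous_on_compose2[OF _ _ assms(3)] by auto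
next
  case (Suc n)
  have df: "f differentiable (at x)" if "x \<in> S" for x using Suc.prems that by auto
  have dg: "g differentiable (at (f x))" if "x \<in> S" for x using Suc.prems that assms(3) by auto
  have d: "frechet_derivative (\<lambda>x. g (f x)) (at x) v =
      (\<Sum>b\<in>Basis. (frechet_derivative f (at x) v \<bullet> b) *\<^sub>R frechet_derivative g (at (f x)) b)"
    if "x \<in> S" for x v
    using frechet_derivative_compose[OF df[OF that] dg[OF that], unfolded o_def]
      linear_eq_sum_Basis[OF linear_frechet_derivative[OF dg[OF that]], of "frechet_derivative f (at x) v"]
    by metis
  have f: "Ck_on n S f" using Suc.prems Ck_on_Suc_imp by blast
  have "Ck_on n S (\<lambda>x. frechet_derivative g (at (f x)) b)" for b
    by (rule Suc.IH[OF f, of "\<lambda>y. frechet_derivative g (at y) b"]) (use Suc.prems in auto)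
  moreover have "Ck_on n S (\<lambda>x. frechet_derivative f (at x) v \<bullet> b)" for b v
    using Suc.prems by (intro Ck_on_bounded_linear[OF bounded_linear_inner_left] assms(1)) auto
  ultimately have "Ck_on n S (\<lambda>x. \<Sum>b\<in>Basis. (frechet_derivative f (at x) v \<bullet> b) *\<^sub>R frechet_derivative g (at (f x)) b)" for v
    by (intro Ck_on_sum Ck_on_bilinear[OF bounded_bilinear_scaleR] assms(1)) auto
  then have "Ck_on n S (\<lambda>x. frechet_derivative (\<lambda>x. g (f x)) (at x) v)" for v
    by (rule Ck_on_cong[OF assms(1), rotated]) (simp add: d)
  moreover have "(\<lambda>x. g (f x)) differentiable (at x)" if "x \<in> S" for x
    using differentiable_chain_at[OF df[OF that] dg[OF that]] by (simp add: o_def)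
  ultimately show ?case by simp
qed

lemma smooth_onD_differentiable: "smooth_on S f \<Longrightarrow> x \<in> S \<Longrightarrow> f differentiable (at x)"
  unfolding smooth_on_def by (metis Ck_on.simps(2))

lemma smooth_on_imp_continuous_on: "smooth_on S f \<Longrightarrow> continuous_on S f"
  unfolding smooth_on_def by (metis Ck_on.simps(1))

lemma smooth_on_cong: "open S \<Longrightarrow> (\<And>x. x \<in> S \<Longrightarrow> f x = g x) \<Longrightarrow> smooth_on S f \<Longrightarrow> smooth_on S g"
  unfolding smooth_on_def using Ck_on_cong by blast

lemma smooth_on_subset: "smooth_on S f \<Longrightarrow> T \<subseteq> S \<Longrightarrow> smooth_on T f"
  unfolding smooth_on_def using Ck_on_subset by blast

lemma smooth_on_local:
  "(\<And>x. x \<in> S \<Longrightarrow> \<exists>T. open T \<and> x \<in> T \<and> smooth_on T f) \<Longrightarrow> smooth_on S f"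
  unfolding smooth_on_def using Ck_on_local by metis

lemma smooth_on_const: "smooth_on S (\<lambda>x. c)"
  by (simp add: smooth_on_def Ck_on_const)

lemma smooth_on_id: "smooth_on S (\<lambda>x. x)"
  by (simp add: smooth_on_def Ck_on_id)

lemma smooth_on_add:
  "open S \<Longrightarrow> smooth_on S f \<Longrightarrow> smooth_on S g \<Longrightarrow> smooth_on S (\<lambda>x. f x + g x)"
  by (simp add: smooth_on_def Ck_on_add)

lemma smooth_on_bilinear:
  "bounded_bilinear b \<Longrightarrow> open S \<Longrightarrow> smooth_on S f \<Longrightarrow> smooth_on S g \<Longrightarrow> smooth_on S (\<lambda>x. b (f x) (g x))"
  by (simp add: smooth_on_def Ck_on_bilinear)

lemmas smooth_on_scaleR = smooth_on_bilinear[OF bounded_bilinear_scaleR]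
lemmas smooth_on_inner = smooth_on_bilinear[OF bounded_bilinear_inner]
lemmas smooth_on_mult = smooth_on_bilinear[OF bounded_bilinear_mult]

lemma smooth_on_sum:
  "open S \<Longrightarrow> (\<And>i. i \<in> I \<Longrightarrow> smooth_on S (f i)) \<Longrightarrow> smooth_on S (\<lambda>x. \<Sum>i\<in>I. f i x)"
  by (simp add: smooth_on_def Ck_on_sum)

lemma smooth_on_compose:
  fixes f :: "'a::real_normed_vector \<Rightarrow> 'e::euclidean_space"
    and g :: "'e \<Rightarrow> 'b::real_normed_vector"
  shows "open S \<Longrightarrow> open T \<Longrightarrow> f ` S \<subseteq> T \<Longrightarrow> smooth_on S f \<Longrightarrow> smooth_on T g \<Longrightarrow> smooth_on S (\<lambda>x. g (f x))"
  unfolding smooth_on_def using Ck_on_compose[of S T f _ g] by blast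

lemma smooth_on_derivative: "smooth_on S f \<Longrightarrow> smooth_on S (\<lambda>x. frechet_derivative f (at x) v)"
  unfolding smooth_on_def by (metis Ck_on.simps(2))

text \<open>Differentials of maps are applied to vectors that vary with the point; again the basis
  expansion reduces this to fixed directions.\<close>

lemma smooth_on_derivative_apply:
  fixes f :: "'e::euclidean_space \<Rightarrow> 'b::real_normed_vector"
  assumes "open S" "open T" "h ` S \<subseteq> T" "smooth_on T f" "smooth_on S h" "smooth_on S w"
  shows "smooth_on S (\<lambda>x. frechet_derivative f (at (h x)) (w x))"
proof (rule smooth_on_cong[OF assms(1)])
  show "smooth_on S (\<lambda>x. \<Sum>b\<in>Basis. (w x \<bullet> b) *\<^sub>R frechet_derivative f (at (h x)) b)"
    using assms
    by (intro smooth_on_sum smooth_on_scaleR smooth_on_inner smooth_on_const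
        smooth_on_compose[of S T h "\<lambda>y. frechet_derivative f (at y) b" for b] smooth_on_derivative) auto
  show "(\<Sum>b\<in>Basis. (w x \<bullet> b) *\<^sub>R frechet_derivative f (at (h x)) b) =
      frechet_derivative f (at (h x)) (w x)" if "x \<in> S" for x
    using assms that linear_eq_sum_Basis[OF linear_frechet_derivative[of f "at (h x)"], of "w x"]
      smooth_onD_differentiable[OF assms(4), of "h x"] by auto
qed

section \<open>Powers, flat functions and bump functions\<close>

lemma smooth_on_powr: "smooth_on {0<..} (\<lambda>x::real. x powr a)"
proof -
  \<comment> \<open>Differentiation changes both the factor and the exponent, so both vary in the
    induction.\<close>
  have "Ck_on n {0<..} (\<lambda>x::real. c * x powr a)" for n c
  proof (induction n arbitrary: a c)
    case 0
    show ?case by (auto intro!: continuous_intros)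
  next
    case (Suc n)
    have d: "((\<lambda>x. c * x powr a) has_derivative (\<lambda>v. v * c * a * x powr (a - 1))) (at x)"
      if "x > 0" for x :: real
      using that by (auto intro!: derivative_eq_intros simp: powr_diff field_simps)
    have "Ck_on n {0<..} (\<lambda>x. frechet_derivative (\<lambda>x. c * x powr a) (at x) v)" for v
      by (rule Ck_on_cong[OF _ _ Suc.IH[of "v * c * a" "a - 1"]])
        (auto simp: frechet_derivative_at[OF d, symmetric])
    then show ?case using d by (auto simp: differentiable_def)
  qed
  from this[of _ 1] show ?thesis by (simp add: smooth_on_def)
qed

text \<open>The family \<open>flat k\<close> is closed under differentiation up to linear combinations.\<close>

definition flat :: "nat \<Rightarrow> real \<Rightarrow> real" where
  "flat k t = (if t > 0 then exp (- (1 / t)) / t ^ k else 0)"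

text \<open>The exponential beats every power of \<open>1 / t\<close>; a quadratic bound is enough
  to make the difference quotient at 0 tend to 0.\<close>

lemma flat_le_square:
  obtains C where "C \<ge> 0" "\<And>t. t > 0 \<Longrightarrow> flat k t \<le> C * t\<^sup>2"
proof
  \<comment> \<open>Two powers beyond \<open>t ^ k\<close> are left over as the square.\<close>
  define n where "n = k + 2"
  have "n > 0" by (simp add: n_def)
  show "real n ^ n \<ge> 0" by simp
  fix t :: real
  assume t: "t > 0"
  \<comment> \<open>Chosen so that \<open>exp (1 / t) = exp y ^ n\<close>, to which
    \<open>y \<le> exp y\<close> applies.\<close>
  define y where "y = 1 / (t * real n)"
  have y: "y > 0" "1 / t = real n * y" using t \<open>n > 0\<close> by (simp_all add: y_def)
  have "y \<le> exp y" using exp_ge_add_one_self[of y] by linarith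
  then have "y ^ n \<le> exp (1 / t)"
    using y by (simp only: y(2) exp_of_nat_mult) (intro power_mono, auto)
  then have "exp (- (1 / t)) \<le> 1 / y ^ n"
    using y(1) by (simp add: exp_minus field_simps)
  also have "\<dots> = real n ^ n * (t\<^sup>2 * t ^ k)"
    by (simp add: y_def n_def power_divide power_mult_distrib power_add power2_eq_square)
  finally show "flat k t \<le> real n ^ n * t\<^sup>2"
    using t by (simp add: flat_def field_simps)
qed

lemma flat_has_derivative:
  "(flat k has_real_derivative (flat (k + 2) t - real k * flat (k + 1) t)) (at t)"
proof (cases "t = 0")
  case [simp]: True
  obtain C where C: "C \<ge> 0" "\<And>t. t > 0 \<Longrightarrow> flat k t \<le> C * t\<^sup>2" using flat_le_square[of k] by blast
  have bound: "norm ((flat k h - flat k 0) / (h - 0)) \<le> C * \<bar>h\<bar>" for h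
  proof (cases "h > 0")
    case True
    moreover have "flat k h \<ge> 0" by (simp add: flat_def)
    ultimately show ?thesis using C(2)[of h]
      by (simp add: flat_def[of k 0] field_simps power2_eq_square)
  next
    case False
    then show ?thesis using C(1) by (simp add: flat_def mult_nonneg_nonpos)
  qed
  have "(flat k has_real_derivative 0) (at 0)"
    unfolding has_field_derivative_iff
  proof (rule Lim_null_comparison[OF always_eventually[OF allI[OF bound]]])
    show "((\<lambda>h. C * \<bar>h\<bar>) \<longlongrightarrow> (0::real)) (at 0)"
      by (auto intro!: tendsto_eq_intros)
  qed
  then show ?thesis by (simp add: flat_def)
next
  case False
  show ?thesis
  proof (cases "t > 0")
    case True
    have "((\<lambda>t. exp (- (1 / t)) / t ^ k) has_real_derivative
        (flat (k + 2) t - real k * flat (k + 1) t)) (at t)"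
    proof -
      have "real k * t ^ (k - 1) = real k * t ^ k / t" using True by (cases k) auto
      then have "(exp (- (1 / t)) * (1 / t\<^sup>2) * t ^ k - exp (- (1 / t)) * (real k * t ^ (k - 1))) / (t ^ k * t ^ k) =
          flat (k + 2) t - real k * flat (k + 1) t"
        using True by (auto simp: flat_def field_simps power2_eq_square)
      moreover have "((\<lambda>t. exp (- (1 / t)) / t ^ k) has_real_derivative
          (exp (- (1 / t)) * (1 / t\<^sup>2) * t ^ k - exp (- (1 / t)) * (real k * t ^ (k - 1))) / (t ^ k * t ^ k)) (at t)"
        using True by (auto intro!: derivative_eq_intros simp: power2_eq_square)
      ultimately show ?thesis by simp
    qed
    then show ?thesis
      by (rule DERIV_cong_ev[THEN iffD1, rotated -1])
        (use True eventually_nhds[of "\<lambda>x. x > 0" t] in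
          \<open>auto simp: flat_def elim!: eventually_mono intro!: exI[of _ "{0<..}"]\<close>)
  next
    case tneg: False
    have "((\<lambda>t. 0) has_real_derivative (flat (k + 2) t - real k * flat (k + 1) t)) (at t)"
      using tneg by (simp add: flat_def)
    then show ?thesis
    proof (rule has_field_derivative_transform_within_open[where S = "{..<0}"])
      show "t \<in> {..<0}" using tneg False by auto
    qed (auto simp: flat_def)
  qed
qed

lemma smooth_on_flat: "smooth_on UNIV (flat k)"
proof -
  have "Ck_on n UNIV (flat k)" for n
  proof (induction n arbitrary: k)
    case 0
    then show ?case
      using flat_has_derivative DERIV_isCont by (metis Ck_on.simps(1) continuous_at_imp_continuous_on)
  next
    case (Suc n)
    have d: "(flat k has_derivative (\<lambda>v. v * flat (k + 2) t + (- real k * v) * flat (k + 1) t)) (at t)" for t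
      using flat_has_derivative[of k t]
      by (rule has_derivative_eq_rhs[OF has_field_derivative_imp_has_derivative]) (auto simp: algebra_simps)
    have "Ck_on n UNIV (\<lambda>t. v * flat (k + 2) t + (- real k * v) * flat (k + 1) t)" for v
      by (intro Ck_on_add Ck_on_bilinear[OF bounded_bilinear_mult] Ck_on_const Suc.IH) auto
    then have "Ck_on n UNIV (\<lambda>t. frechet_derivative (flat k) (at t) v)" for v
      by (simp add: frechet_derivative_at[OF d, symmetric])
    then show ?case using d by (auto simp: differentiable_def)
  qed
  then show ?thesis by (simp add: smooth_on_def)
qed

text \<open>\<open>flat 0\<close> kills nonpositive arguments; the squared distance is used because
  it is smooth also at the centre.\<close>

lemma smooth_bump:
  fixes a :: "'e::euclidean_space"
  assumes "r > 0"
  obtains \<psi> :: "'e \<Rightarrow> real" where "smooth_on UNIV \<psi>" "\<psi> a = 1" "\<And>x. x \<notin> ball a r \<Longrightarrow> \<psi> x = 0"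
proof
  let ?c = "flat 0 (r\<^sup>2)"
  let ?\<psi> = "\<lambda>x. inverse ?c *\<^sub>R flat 0 (r\<^sup>2 + (-1) *\<^sub>R ((x - a) \<bullet> (x - a)))"
  have "smooth_on UNIV (\<lambda>x. x + - a)"
    by (intro smooth_on_add smooth_on_const smooth_on_id) auto
  then have "smooth_on UNIV (\<lambda>x. x - a)" by simp
  then have "smooth_on UNIV (\<lambda>x. r\<^sup>2 + (-1) *\<^sub>R ((x - a) \<bullet> (x - a)))"
    by (intro smooth_on_add smooth_on_const smooth_on_scaleR smooth_on_inner) auto
  from smooth_on_compose[OF _ _ _ this smooth_on_flat[of 0]] show "smooth_on UNIV ?\<psi>"
    by (intro smooth_on_scaleR smooth_on_const) auto
  show "?\<psi> a = 1" using assms by (simp add: flat_def)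
  show "?\<psi> x = 0" if "x \<notin> ball a r" for x
  proof -
    have "r\<^sup>2 \<le> (norm (x - a))\<^sup>2"
      using that assms by (intro power_mono) (auto simp: dist_norm norm_minus_commute)
    then show ?thesis by (simp add: flat_def power2_norm_eq_inner)
  qed
qed

section \<open>Symmetry of second derivatives\<close>

text \<open>The mean value theorem is used along \<open>u\<close> and then along \<open>v\<close>.
  The difference itself is symmetric in \<open>u\<close> and \<open>v\<close>, which is the source
  of the symmetry of second derivatives.\<close>

lemma mixed_difference_mean_value:
  fixes f :: "'e::euclidean_space \<Rightarrow> real"
  assumes "smooth_on S f" "open S" "s > 0"
    and seg: "\<And>a b. 0 \<le> a \<Longrightarrow> a \<le> s \<Longrightarrow> 0 \<le> b \<Longrightarrow> b \<le> s \<Longrightarrow> x + a *\<^sub>R u + b *\<^sub>R v \<in> S"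
  obtains a b where "0 < a" "a < s" "0 < b" "b < s"
    "f (x + s *\<^sub>R u + s *\<^sub>R v) - f (x + s *\<^sub>R u) - f (x + s *\<^sub>R v) + f x =
      s * s * frechet_derivative (\<lambda>y. frechet_derivative f (at y) u) (at (x + a *\<^sub>R u + b *\<^sub>R v)) v"
proof -
  let ?Du = "\<lambda>y. frechet_derivative f (at y) u"
  have line: "((\<lambda>t. h (y + t *\<^sub>R w)) has_real_derivative frechet_derivative h (at (y + t *\<^sub>R w)) w) (at t)"
    if "smooth_on S h" "y + t *\<^sub>R w \<in> S" for h :: "'e \<Rightarrow> real" and y w t
  proof -
    have h: "(h has_derivative frechet_derivative h (at (y + t *\<^sub>R w))) (at (y + t *\<^sub>R w))"
      using smooth_onD_differentiable[OF that] frechet_derivative_works by blast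
    have "((\<lambda>t. y + t *\<^sub>R w) has_derivative (\<lambda>t. t *\<^sub>R w)) (at t)"
      by (auto intro!: derivative_eq_intros)
    from diff_chain_at[OF this h] show ?thesis
      unfolding has_field_derivative_def o_def
      by (rule has_derivative_eq_rhs)
        (simp add: fun_eq_iff linear_cmul[OF has_derivative_linear[OF h]] mult.commute)
  qed
  let ?\<phi> = "\<lambda>t. f ((x + s *\<^sub>R v) + t *\<^sub>R u) - f (x + t *\<^sub>R u)"
  have "(?\<phi> has_real_derivative ?Du ((x + s *\<^sub>R v) + t *\<^sub>R u) - ?Du (x + t *\<^sub>R u)) (at t)"
    if "0 \<le> t" "t \<le> s" for t
    using that assms seg[of t s] seg[of t 0]
    by (intro DERIV_diff line) (auto simp: algebra_simps)
  from MVT2[OF assms(3) this] obtain a where a: "0 < a" "a < s"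
    "?\<phi> s - ?\<phi> 0 = s * (?Du ((x + s *\<^sub>R v) + a *\<^sub>R u) - ?Du (x + a *\<^sub>R u))" by auto
  have "((\<lambda>t. ?Du ((x + a *\<^sub>R u) + t *\<^sub>R v)) has_real_derivative
      frechet_derivative ?Du (at ((x + a *\<^sub>R u) + t *\<^sub>R v)) v) (at t)"
    if "0 \<le> t" "t \<le> s" for t
    using that a seg[of a t] by (intro line smooth_on_derivative assms) auto
  from MVT2[OF assms(3) this] obtain b where b: "0 < b" "b < s"
    "?Du ((x + a *\<^sub>R u) + s *\<^sub>R v) - ?Du ((x + a *\<^sub>R u)) =
      s * frechet_derivative ?Du (at ((x + a *\<^sub>R u) + b *\<^sub>R v)) v" by auto
  have "f (x + s *\<^sub>R u + s *\<^sub>R v) - f (x + s *\<^sub>R u) - f (x + s *\<^sub>R v) + f x = ?\<phi> s - ?\<phi> 0"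
    by (simp add: algebra_simps)
  also have "\<dots> = s * (?Du ((x + a *\<^sub>R u) + s *\<^sub>R v) - ?Du (x + a *\<^sub>R u))"
    unfolding a by (simp add: algebra_simps)
  finally show thesis using that[OF a(1,2) b(1,2)] b(3) by (simp add: mult.assoc)
qed

text \<open>Up to the factor \<open>s * s\<close>, one and the same mixed difference is the value of
  either iterated derivative at a point close to \<open>x\<close>, and both are continuous at
  \<open>x\<close>.\<close>

lemma smooth_on_second_derivative_symmetric_real:
  fixes f :: "'e::euclidean_space \<Rightarrow> real"
  assumes "smooth_on S f" "open S" "x \<in> S"
  shows "frechet_derivative (\<lambda>y. frechet_derivative f (at y) u) (at x) v =
    frechet_derivative (\<lambda>y. frechet_derivative f (at y) v) (at x) u"
proof -
  define H where "H u v y = frechet_derivative (\<lambda>y. frechet_derivative f (at y) u) (at y) v" for u v y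
  have cont: "isCont (H u v) x" for u v
    using smooth_on_imp_continuous_on[OF smooth_on_derivative[OF smooth_on_derivative[OF assms(1)]]]
      assms continuous_on_eq_continuous_at unfolding H_def by blast
  obtain r where r: "r > 0" "ball x r \<subseteq> S" using assms by (meson open_contains_ball)
  have "\<bar>H u v x - H v u x\<bar> < e" if e: "e > 0" for e
  proof -
    obtain d1 where d1: "d1 > 0" "\<And>y. dist y x < d1 \<Longrightarrow> dist (H u v y) (H u v x) < e / 2"
      using cont[of u v] e unfolding continuous_at_eps_delta by (meson half_gt_zero)
    obtain d2 where d2: "d2 > 0" "\<And>y. dist y x < d2 \<Longrightarrow> dist (H v u y) (H v u x) < e / 2"
      using cont[of v u] e unfolding continuous_at_eps_delta by (meson half_gt_zero)
    define d where "d = min r (min d1 d2)"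
    \<comment> \<open>The added 1 avoids division by zero when both vectors vanish; the factor 2
      makes the distance bound strict.\<close>
    define s where "s = d / (2 * (norm u + norm v + 1))"
    have "d > 0" using r d1 d2 by (simp add: d_def)
    have N: "norm u + norm v + 1 > 0" by (simp add: add_nonneg_pos)
    then have s: "s > 0" using \<open>d > 0\<close> by (simp add: s_def)
    have close: "dist (x + a *\<^sub>R u + b *\<^sub>R v) x < d" if "0 \<le> a" "a \<le> s" "0 \<le> b" "b \<le> s" for a b
    proof -
      have "norm (a *\<^sub>R u + b *\<^sub>R v) \<le> s * norm u + s * norm v"
        using that by (intro order_trans[OF norm_triangle_ineq] add_mono) (auto intro: mult_right_mono)
      also have "\<dots> \<le> s * (norm u + norm v + 1)" using s by (simp add: algebra_simps)
      also have "\<dots> = d / 2" using N by (simp add: s_def field_simps)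
      also have "\<dots> < d" using \<open>d > 0\<close> by simp
      finally show ?thesis by (simp add: dist_norm)
    qed
    have seg: "x + a *\<^sub>R u + b *\<^sub>R v \<in> S" "x + b *\<^sub>R v + a *\<^sub>R u \<in> S"
      if "0 \<le> a" "a \<le> s" "0 \<le> b" "b \<le> s" for a b
      using close[OF that] r by (auto simp: d_def dist_commute add.assoc add.commute add.left_commute)
    obtain a b where ab: "0 < a" "a < s" "0 < b" "b < s"
      "f (x + s *\<^sub>R u + s *\<^sub>R v) - f (x + s *\<^sub>R u) - f (x + s *\<^sub>R v) + f x =
        s * s * H u v (x + a *\<^sub>R u + b *\<^sub>R v)"
      using mixed_difference_mean_value[OF assms(1,2) s, of x u v] seg unfolding H_def by blast
    obtain a' b' where ab': "0 < a'" "a' < s" "0 < b'" "b' < s"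
      "f (x + s *\<^sub>R v + s *\<^sub>R u) - f (x + s *\<^sub>R v) - f (x + s *\<^sub>R u) + f x =
        s * s * H v u (x + a' *\<^sub>R v + b' *\<^sub>R u)"
      using mixed_difference_mean_value[OF assms(1,2) s, of x v u] seg unfolding H_def by blast
    define y y' where "y = x + a *\<^sub>R u + b *\<^sub>R v" and "y' = x + b' *\<^sub>R u + a' *\<^sub>R v"
    have y': "y' = x + a' *\<^sub>R v + b' *\<^sub>R u" by (simp add: y'_def)
    have "s * s * H u v y = s * s * H v u y'"
      unfolding y_def y' ab(5)[symmetric] ab'(5)[symmetric]
      by (simp add: add.assoc add.commute add.left_commute)
    then have "H u v y = H v u y'" using s by simp
    moreover have "\<bar>H u v y - H u v x\<bar> < e / 2"
      using close[of a b] ab d1(2)[of y] by (auto simp: d_def y_def dist_real_def)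
    moreover have "\<bar>H v u y' - H v u x\<bar> < e / 2"
      using close[of b' a'] ab' d2(2)[of y'] by (auto simp: d_def y'_def dist_real_def)
    ultimately show ?thesis unfolding abs_less_iff by linarith
  qed
  then have "\<bar>H u v x - H v u x\<bar> \<le> 0" by (meson not_le less_irrefl)
  then show ?thesis by (simp add: H_def)
qed

section \<open>Charts and smooth fields\<close>

lemma is_chartD:
  assumes "is_chart c"
  shows "open (cdom c)" "open (cmap c ` cdom c)" "continuous_on (cdom c) (cmap c)"
    "continuous_on (cmap c ` cdom c) (cinv c)"
  using assms by (auto simp: is_chart_def homeomorphism_def)

lemma cinv_cmap: "is_chart c \<Longrightarrow> p \<in> cdom c \<Longrightarrow> cinv c (cmap c p) = p"
  by (simp add: is_chart_def homeomorphism_def)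

lemma open_chart_image:
  assumes "is_chart c" "open U"
  shows "open (cmap c ` (cdom c \<inter> U))"
proof -
  have "cmap c ` (cdom c \<inter> U) = cmap c ` cdom c \<inter> cinv c -` U"
    using cinv_cmap[OF assms(1)] by (auto simp: image_iff)
  then show ?thesis
    using continuous_open_preimage[OF is_chartD(4,2)[OF assms(1)] assms(2)] by simp
qed

lemma smooth_manifold_chart: "smooth_manifold A \<Longrightarrow> c \<in> A \<Longrightarrow> is_chart c"
  by (simp add: smooth_manifold_def)

lemma chart_at:
  assumes "smooth_manifold A"
  shows "chart_at A p \<in> A" "p \<in> cdom (chart_at A p)"
proof -
  have "\<exists>c. c \<in> A \<and> p \<in> cdom c" using assms unfolding smooth_manifold_def by blast
  from someI_ex[OF this] show "chart_at A p \<in> A" "p \<in> cdom (chart_at A p)"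
    by (simp_all add: chart_at_def)
qed

lemma smooth_map_ident: "smooth_manifold A \<Longrightarrow> smooth_map A A (\<lambda>p. p)"
  by (auto simp: smooth_map_def smooth_manifold_def comp_def)

lemma smooth_map_open_vimage: "smooth_map A B F \<Longrightarrow> open U \<Longrightarrow> open (F -` U)"
  unfolding smooth_map_def using continuous_on_open_vimage[OF open_UNIV, of F] by simp

lemma smooth_fun_onD_open: "smooth_fun_on A U f \<Longrightarrow> open U"
  by (simp add: smooth_fun_on_def)

lemma field_along_onD_open: "field_along_on A B F U W \<Longrightarrow> open U"
  by (simp add: field_along_on_def)

section \<open>Maps, transitions and tangent components in charts\<close>

locale manifold_map =
  fixes A :: "('a::{t2_space, second_countable_topology}, 'e::euclidean_space) chart set"
    and B :: "('b::{t2_space, second_countable_topology}, 'f::euclidean_space) chart set"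
    and F :: "'a \<Rightarrow> 'b"
  assumes mA: "smooth_manifold A" and mB: "smooth_manifold B" and mF: "smooth_map A B F"
begin

definition rep :: "('a, 'e) chart \<Rightarrow> ('b, 'f) chart \<Rightarrow> 'e \<Rightarrow> 'f" where
  "rep c d = (\<lambda>x. cmap d (F (cinv c x)))"

definition rdom :: "('a, 'e) chart \<Rightarrow> ('b, 'f) chart \<Rightarrow> 'e set" where
  "rdom c d = cmap c ` (cdom c \<inter> F -` cdom d)"

lemma chA: "c \<in> A \<Longrightarrow> is_chart c" and chB: "d \<in> B \<Longrightarrow> is_chart d"
  using mA mB by (auto intro: smooth_manifold_chart)

lemmas chart_at_A = chart_at[OF mA]
lemmas chart_at_B = chart_at[OF mB]

lemma open_vimage_F: "open U \<Longrightarrow> open (F -` U)"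
  using smooth_map_open_vimage[OF mF] .

lemma open_rdom: "c \<in> A \<Longrightarrow> d \<in> B \<Longrightarrow> open (rdom c d)"
  unfolding rdom_def
  by (intro open_chart_image chA open_vimage_F is_chartD(1)[OF chB])

lemma rdomI: "p \<in> cdom c \<Longrightarrow> F p \<in> cdom d \<Longrightarrow> cmap c p \<in> rdom c d"
  by (auto simp: rdom_def)

lemma smooth_on_rep: "c \<in> A \<Longrightarrow> d \<in> B \<Longrightarrow> smooth_on (rdom c d) (rep c d)"
  using mF unfolding smooth_map_def rdom_def rep_def comp_def by blast

lemma rep_has_derivative:
  assumes "c \<in> A" "d \<in> B" "p \<in> cdom c" "F p \<in> cdom d"
  shows "(rep c d has_derivative frechet_derivative (rep c d) (at (cmap c p))) (at (cmap c p))"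
  by (rule has_frechet_derivative[OF smooth_onD_differentiable[OF smooth_on_rep[OF assms(1,2)] rdomI[OF assms(3,4)]]])

lemma tangent_map_eq:
  "tangent_map A B F p v =
    frechet_derivative (rep (chart_at A p) (chart_at B (F p))) (at (cmap (chart_at A p) p)) v"
  by (simp add: tangent_map_def rep_def comp_def)

end

locale manifold =
  fixes A :: "('a::{t2_space, second_countable_topology}, 'e::euclidean_space) chart set"
  assumes mA: "smooth_manifold A"

text \<open>Vector fields are fields along the identity, and chart transitions are its coordinate
  forms, so the results on maps serve for both.\<close>

sublocale manifold \<subseteq> triv: manifold_map A A "\<lambda>p. p"
  by unfold_locales (use mA smooth_map_ident in auto)

context manifold begin

abbreviation trans :: "('a, 'e) chart \<Rightarrow> ('a, 'e) chart \<Rightarrow> 'e \<Rightarrow> 'e" where "trans \<equiv> triv.rep"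

lemma tcoord_eq:
  "tcoord A c p v = frechet_derivative (trans (chart_at A p) c) (at (cmap (chart_at A p) p)) v"
  by (simp add: tcoord_def triv.rep_def comp_def)

lemma trans_cmap: "c \<in> A \<Longrightarrow> p \<in> cdom c \<Longrightarrow> trans c d (cmap c p) = cmap d p"
  by (simp add: triv.rep_def cinv_cmap[OF triv.chA])

lemma trans_self_derivative:
  assumes "c \<in> A" "p \<in> cdom c"
  shows "frechet_derivative (trans c c) (at (cmap c p)) v = v"
proof -
  have "frechet_derivative (trans c c) (at (cmap c p)) = frechet_derivative (\<lambda>x. x) (at (cmap c p))"
    by (rule frechet_derivative_cong_open[OF is_chartD(2)[OF triv.chA[OF assms(1)]]])
      (use assms in \<open>auto simp: trans_cmap\<close>)
  then show ?thesis by simp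
qed

lemma tcoord_chart_at: "tcoord A (chart_at A p) p v = v"
  by (simp add: tcoord_eq trans_self_derivative chart_at[OF mA])

lemma linear_tcoord: "d \<in> A \<Longrightarrow> p \<in> cdom d \<Longrightarrow> linear (tcoord A d p)"
  unfolding tcoord_eq
  by (rule has_derivative_linear[OF triv.rep_has_derivative]) (simp_all add: chart_at[OF mA])

text \<open>The chain rule on a chart overlap, that is, the cocycle law of the tangent bundle. With
  the selected chart at \<open>p\<close> as one of the three it yields every change of
  components.\<close>

lemma trans_derivative_comp:
  assumes "c \<in> A" "d \<in> A" "d' \<in> A" "p \<in> cdom c" "p \<in> cdom d" "p \<in> cdom d'"
  shows "frechet_derivative (trans d d') (at (cmap d p)) (frechet_derivative (trans c d) (at (cmap c p)) v) =
    frechet_derivative (trans c d') (at (cmap c p)) v"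
proof -
  have "(trans d d' has_derivative frechet_derivative (trans d d') (at (cmap d p))) (at (trans c d (cmap c p)))"
    using triv.rep_has_derivative[OF assms(2,3,5,6)] assms by (simp add: trans_cmap)
  from diff_chain_at[OF triv.rep_has_derivative[OF assms(1,2,4,5)] this]
  have "((\<lambda>x. trans d d' (trans c d x)) has_derivative (\<lambda>v. frechet_derivative (trans d d') (at (cmap d p)) (frechet_derivative (trans c d) (at (cmap c p)) v))) (at (cmap c p))"
    by (simp add: o_def)
  then have "(trans c d' has_derivative (\<lambda>v. frechet_derivative (trans d d') (at (cmap d p)) (frechet_derivative (trans c d) (at (cmap c p)) v))) (at (cmap c p))"
    by (rule has_derivative_transform_within_open[OF _ triv.open_rdom[OF assms(1,2)] triv.rdomI[OF assms(4,5)]])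
      (auto simp: triv.rdom_def trans_cmap assms)
  from frechet_derivative_at[OF this] show ?thesis by metis
qed

lemma tcoord_change:
  assumes "c \<in> A" "d \<in> A" "p \<in> cdom c" "p \<in> cdom d"
  shows "frechet_derivative (trans c d) (at (cmap c p)) (tcoord A c p v) = tcoord A d p v"
  using trans_derivative_comp[OF chart_at(1)[OF mA] assms(1,2) chart_at(2)[OF mA] assms(3,4)]
  by (simp add: tcoord_eq)

text \<open>The coordinate vector field of the chart \<open>c\<close> in direction \<open>b\<close>,
  with its components re-expressed in the chart selected at each point.\<close>

definition coord_field :: "('a, 'e) chart \<Rightarrow> 'e \<Rightarrow> 'a \<Rightarrow> 'e" where
  "coord_field c b p = frechet_derivative (trans c (chart_at A p)) (at (cmap c p)) b"

lemma tcoord_coord_field: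
  assumes "c \<in> A" "d \<in> A" "p \<in> cdom c" "p \<in> cdom d"
  shows "tcoord A d p (coord_field c b p) = frechet_derivative (trans c d) (at (cmap c p)) b"
  unfolding tcoord_eq coord_field_def
  by (rule trans_derivative_comp[OF assms(1) chart_at(1)[OF mA] assms(2,3) chart_at(2)[OF mA] assms(4)])

lemma tcoord_coord_field_self: "c \<in> A \<Longrightarrow> p \<in> cdom c \<Longrightarrow> tcoord A c p (coord_field c b p) = b"
  by (simp add: tcoord_coord_field trans_self_derivative)

lemma linear_coord_field: "c \<in> A \<Longrightarrow> p \<in> cdom c \<Longrightarrow> linear (\<lambda>b. coord_field c b p)"
  unfolding coord_field_def
  by (rule has_derivative_linear[OF triv.rep_has_derivative]) (auto simp: chart_at[OF mA])

lemma coord_field_tcoord: "c \<in> A \<Longrightarrow> p \<in> cdom c \<Longrightarrow> coord_field c (tcoord A c p v) p = v"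
  unfolding coord_field_def by (simp add: tcoord_change chart_at[OF mA] tcoord_chart_at)

lemma tcoord_inject: "c \<in> A \<Longrightarrow> p \<in> cdom c \<Longrightarrow> tcoord A c p v = tcoord A c p w \<longleftrightarrow> v = w"
  by (metis coord_field_tcoord)

lemma coord_field_expansion:
  assumes "c \<in> A" "p \<in> cdom c"
  shows "v = (\<Sum>b\<in>Basis. (tcoord A c p v \<bullet> b) *\<^sub>R coord_field c b p)"
  using linear_eq_sum_Basis[OF linear_coord_field[OF assms], of "tcoord A c p v"]
  by (simp add: coord_field_tcoord[OF assms])

end

sublocale manifold_map \<subseteq> dom: manifold A by unfold_locales (rule mA)
sublocale manifold_map \<subseteq> cod: manifold B by unfold_locales (rule mB)

context manifold_map begin

lemma rep_cmap: "c \<in> A \<Longrightarrow> p \<in> cdom c \<Longrightarrow> rep c d (cmap c p) = cmap d (F p)"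
  by (simp add: rep_def cinv_cmap[OF chA])

lemma rep_trans_derivative:
  assumes "c0 \<in> A" "c \<in> A" "d \<in> B" "p \<in> cdom c0" "p \<in> cdom c" "F p \<in> cdom d"
  shows "frechet_derivative (rep c d) (at (cmap c p)) (frechet_derivative (dom.trans c0 c) (at (cmap c0 p)) v) =
    frechet_derivative (rep c0 d) (at (cmap c0 p)) v"
proof -
  have "(rep c d has_derivative frechet_derivative (rep c d) (at (cmap c p))) (at (dom.trans c0 c (cmap c0 p)))"
    using rep_has_derivative[OF assms(2,3,5,6)] assms by (simp add: dom.trans_cmap)
  from diff_chain_at[OF dom.triv.rep_has_derivative[OF assms(1,2,4,5)] this]
  have "((\<lambda>x. rep c d (dom.trans c0 c x)) has_derivative (\<lambda>v. frechet_derivative (rep c d) (at (cmap c p)) (frechet_derivative (dom.trans c0 c) (at (cmap c0 p)) v))) (at (cmap c0 p))"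
    by (simp add: o_def)
  then have "(rep c0 d has_derivative (\<lambda>v. frechet_derivative (rep c d) (at (cmap c p)) (frechet_derivative (dom.trans c0 c) (at (cmap c0 p)) v))) (at (cmap c0 p))"
    by (rule has_derivative_transform_within_open[OF _ dom.triv.open_rdom[OF assms(1,2)] dom.triv.rdomI[OF assms(4,5)]])
      (auto simp: dom.triv.rdom_def dom.trans_cmap rep_cmap assms)
  from frechet_derivative_at[OF this] show ?thesis by metis
qed

lemma trans_rep_derivative:
  assumes "c \<in> A" "d0 \<in> B" "d \<in> B" "p \<in> cdom c" "F p \<in> cdom d0" "F p \<in> cdom d"
  shows "frechet_derivative (cod.trans d0 d) (at (cmap d0 (F p))) (frechet_derivative (rep c d0) (at (cmap c p)) v) =
    frechet_derivative (rep c d) (at (cmap c p)) v"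
proof -
  have "(cod.trans d0 d has_derivative frechet_derivative (cod.trans d0 d) (at (cmap d0 (F p)))) (at (rep c d0 (cmap c p)))"
    using cod.triv.rep_has_derivative[OF assms(2,3,5,6)] assms by (simp add: rep_cmap)
  from diff_chain_at[OF rep_has_derivative[OF assms(1,2,4,5)] this]
  have "((\<lambda>x. cod.trans d0 d (rep c d0 x)) has_derivative (\<lambda>v. frechet_derivative (cod.trans d0 d) (at (cmap d0 (F p))) (frechet_derivative (rep c d0) (at (cmap c p)) v))) (at (cmap c p))"
    by (simp add: o_def)
  then have "(rep c d has_derivative (\<lambda>v. frechet_derivative (cod.trans d0 d) (at (cmap d0 (F p))) (frechet_derivative (rep c d0) (at (cmap c p)) v))) (at (cmap c p))"
    by (rule has_derivative_transform_within_open[OF _ open_rdom[OF assms(1,2)] rdomI[OF assms(4,5)]])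
      (auto simp: rdom_def cod.trans_cmap rep_cmap assms)
  from frechet_derivative_at[OF this] show ?thesis by metis
qed

text \<open>\<open>tangent_map\<close> is defined by the selected charts, which jump with the point.
  In any fixed pair of charts it becomes the Jacobian, the form in which smoothness can be
  checked.\<close>

lemma tcoord_tangent_map:
  assumes "c \<in> A" "d \<in> B" "p \<in> cdom c" "F p \<in> cdom d"
  shows "tcoord B d (F p) (tangent_map A B F p v) =
    frechet_derivative (rep c d) (at (cmap c p)) (tcoord A c p v)"
  unfolding tangent_map_eq cod.tcoord_eq dom.tcoord_eq
  using assms
  by (simp add: trans_rep_derivative rep_trans_derivative chart_at_A chart_at_B)

lemma linear_tangent_map: "linear (tangent_map A B F p)"
  unfolding tangent_map_eq
  by (rule has_derivative_linear[OF rep_has_derivative]) (simp_all add: chart_at_A chart_at_B)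

end

section \<open>Smooth functions on a manifold and their differentials\<close>

context manifold begin

lemma smooth_fun_on_cong:
  assumes "smooth_fun_on A U f" "\<And>q. q \<in> U \<Longrightarrow> f q = h q"
  shows "smooth_fun_on A U h"
  unfolding smooth_fun_on_def
proof safe
  show U: "open U" using assms(1) by (simp add: smooth_fun_on_def)
  fix c assume c: "c \<in> A"
  show "smooth_on (cmap c ` (cdom c \<inter> U)) (h \<circ> cinv c)"
    by (rule smooth_on_cong[of _ "f \<circ> cinv c"])
      (use assms c in \<open>auto simp: smooth_fun_on_def cinv_cmap[OF triv.chA] intro: open_chart_image[OF triv.chA]\<close>)
qed

lemma smooth_fun_on_subset:
  "smooth_fun_on A U f \<Longrightarrow> open V \<Longrightarrow> V \<subseteq> U \<Longrightarrow> smooth_fun_on A V f"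
  by (auto simp: smooth_fun_on_def intro: smooth_on_subset[OF _ image_mono[OF Int_mono]])

lemma smooth_fun_on_const: "open U \<Longrightarrow> smooth_fun_on A U (\<lambda>q. k)"
  by (simp add: smooth_fun_on_def comp_def smooth_on_const)

lemma smooth_fun_on_add:
  "smooth_fun_on A U f \<Longrightarrow> smooth_fun_on A U h \<Longrightarrow> smooth_fun_on A U (\<lambda>q. f q + h q)"
  unfolding smooth_fun_on_def comp_def
  by (auto intro!: smooth_on_add open_chart_image triv.chA)

lemma smooth_fun_on_mult:
  "smooth_fun_on A U f \<Longrightarrow> smooth_fun_on A U h \<Longrightarrow> smooth_fun_on A U (\<lambda>q. f q * h q)"
  unfolding smooth_fun_on_def comp_def
  by (auto intro!: smooth_on_mult open_chart_image triv.chA)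

lemma smooth_fun_on_sum:
  "open U \<Longrightarrow> (\<And>i. i \<in> I \<Longrightarrow> smooth_fun_on A U (f i)) \<Longrightarrow> smooth_fun_on A U (\<lambda>q. \<Sum>i\<in>I. f i q)"
  by (induction I rule: infinite_finite_induct) (auto intro: smooth_fun_on_const smooth_fun_on_add)

lemma smooth_fun_on_powr:
  assumes "smooth_fun_on A U f" "\<And>q. q \<in> U \<Longrightarrow> f q > 0"
  shows "smooth_fun_on A U (\<lambda>q. f q powr a)"
  unfolding smooth_fun_on_def comp_def
proof safe
  show "open U" using assms(1) by (simp add: smooth_fun_on_def)
  fix c assume c: "c \<in> A"
  show "smooth_on (cmap c ` (cdom c \<inter> U)) (\<lambda>x. f (cinv c x) powr a)"
    by (rule smooth_on_compose[OF _ _ _ _ smooth_on_powr])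
      (use assms c in \<open>auto simp: smooth_fun_on_def comp_def cinv_cmap[OF triv.chA] intro: open_chart_image[OF triv.chA]\<close>)
qed

lemma smooth_fun_on_imp_continuous_on:
  assumes "smooth_fun_on A U f"
  shows "continuous_on U f"
proof (rule continuous_at_imp_continuous_on, rule ballI)
  fix p assume p: "p \<in> U"
  define c where "c = chart_at A p"
  have c: "c \<in> A" "p \<in> cdom c" by (simp_all add: c_def chart_at[OF mA])
  note cs = is_chartD[OF triv.chA[OF c(1)]]
  have "continuous_on (cmap c ` (cdom c \<inter> U)) (f \<circ> cinv c)"
    by (rule smooth_on_imp_continuous_on) (use assms c in \<open>auto simp: smooth_fun_on_def\<close>)
  from continuous_on_compose2[OF this continuous_on_subset[OF cs(3)], of "cdom c \<inter> U"]
  have "continuous_on (cdom c \<inter> U) (\<lambda>q. (f \<circ> cinv c) (cmap c q))" by simp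
  then have "continuous_on (cdom c \<inter> U) f"
    by (rule continuous_on_eq) (simp add: cinv_cmap[OF triv.chA[OF c(1)]])
  moreover have "open (cdom c \<inter> U)" using cs assms by (auto simp: smooth_fun_on_def)
  ultimately show "isCont f p" using p c continuous_on_eq_continuous_at by blast
qed

lemma smooth_fun_on_differentiable:
  assumes "smooth_fun_on A U f" "p \<in> U" "c \<in> A" "p \<in> cdom c"
  shows "(f \<circ> cinv c) differentiable (at (cmap c p))"
  using assms by (auto simp: smooth_fun_on_def intro!: smooth_onD_differentiable)

lemma dfun_has_derivative:
  assumes "smooth_fun_on A U f" "p \<in> U"
  shows "((f \<circ> cinv (chart_at A p)) has_derivative dfun A f p) (at (cmap (chart_at A p) p))"
  unfolding dfun_def
  by (rule has_frechet_derivative[OF smooth_fun_on_differentiable[OF assms chart_at[OF mA]]])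

lemma dfun_eqI:
  assumes "((f \<circ> cinv (chart_at A p)) has_derivative L) (at (cmap (chart_at A p) p))"
  shows "dfun A f p v = L v"
  using frechet_derivative_at[OF assms] by (simp add: dfun_def)

lemma dfun_const: "dfun A (\<lambda>q. k) p v = 0"
  by (rule dfun_eqI[where L = "\<lambda>v. 0"]) (simp add: comp_def)

lemma dfun_add:
  assumes "smooth_fun_on A U f" "smooth_fun_on A U h" "p \<in> U"
  shows "dfun A (\<lambda>q. f q + h q) p v = dfun A f p v + dfun A h p v"
  using has_derivative_add[OF dfun_has_derivative[OF assms(1,3)] dfun_has_derivative[OF assms(2,3)]]
  by (intro dfun_eqI) (simp add: comp_def)

lemma dfun_mult:
  assumes "smooth_fun_on A U f" "smooth_fun_on A U h" "p \<in> U"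
  shows "dfun A (\<lambda>q. f q * h q) p v = f p * dfun A h p v + dfun A f p v * h p"
  using has_derivative_mult[OF dfun_has_derivative[OF assms(1,3)] dfun_has_derivative[OF assms(2,3)]]
  by (intro dfun_eqI) (simp add: comp_def cinv_cmap chart_at[OF mA] triv.chA)

lemma dfun_cong:
  assumes "open U" "p \<in> U" "\<And>q. q \<in> U \<Longrightarrow> f q = h q"
  shows "dfun A f p v = dfun A h p v"
proof -
  let ?c = "chart_at A p"
  have "frechet_derivative (f \<circ> cinv ?c) (at (cmap ?c p)) = frechet_derivative (h \<circ> cinv ?c) (at (cmap ?c p))"
    by (rule frechet_derivative_cong_open[OF open_chart_image[OF triv.chA[OF chart_at(1)[OF mA]] assms(1)]])
      (use assms in \<open>auto simp: cinv_cmap chart_at[OF mA] triv.chA\<close>)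
  then show ?thesis by (simp add: dfun_def)
qed

lemma dfun_tcoord:
  assumes "smooth_fun_on A U f" "p \<in> U" "c \<in> A" "p \<in> cdom c"
  shows "dfun A f p v = frechet_derivative (f \<circ> cinv c) (at (cmap c p)) (tcoord A c p v)"
proof -
  let ?c = "chart_at A p"
  have "(f \<circ> cinv c has_derivative frechet_derivative (f \<circ> cinv c) (at (cmap c p)))
      (at (trans ?c c (cmap ?c p)))"
    using has_frechet_derivative[OF smooth_fun_on_differentiable[OF assms]]
    by (simp add: trans_cmap chart_at[OF mA])
  from diff_chain_at[OF triv.rep_has_derivative[OF chart_at(1)[OF mA] assms(3) chart_at(2)[OF mA] assms(4)] this]
  have "((\<lambda>x. f (cinv c (trans ?c c x))) has_derivative
      (\<lambda>v. frechet_derivative (f \<circ> cinv c) (at (cmap c p)) (tcoord A c p v))) (at (cmap ?c p))"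
    by (simp add: o_def tcoord_eq)
  then have "((f \<circ> cinv ?c) has_derivative
      (\<lambda>v. frechet_derivative (f \<circ> cinv c) (at (cmap c p)) (tcoord A c p v))) (at (cmap ?c p))"
    by (rule has_derivative_transform_within_open[OF _ triv.open_rdom[OF chart_at(1)[OF mA] assms(3)]
          triv.rdomI[OF chart_at(2)[OF mA] assms(4)]])
      (auto simp: triv.rdom_def trans_cmap chart_at[OF mA] cinv_cmap triv.chA assms(3))
  then show ?thesis by (rule dfun_eqI)
qed

text \<open>A Euclidean bump is transported by a chart. The closed ball has a compact preimage
  \<open>K\<close>, closed because the space is Hausdorff; off \<open>K\<close> the function is zero
  on an open set, which makes the extension by zero smooth.\<close>

lemma bump_function:
  assumes "open U" "p \<in> U"
  obtains f K where "smooth_fun_on A UNIV f" "f p = 1" "closed K" "K \<subseteq> U" "\<And>q. q \<notin> K \<Longrightarrow> f q = 0"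
proof -
  define c where "c = chart_at A p"
  have c: "c \<in> A" "p \<in> cdom c" by (simp_all add: c_def chart_at[OF mA])
  note ch = triv.chA[OF c(1)]
  obtain r where r: "r > 0" "cball (cmap c p) r \<subseteq> cmap c ` (cdom c \<inter> U)"
    using open_chart_image[OF ch assms(1)] c assms(2) unfolding open_contains_cball by blast
  obtain \<psi> :: "'e \<Rightarrow> real" where \<psi>: "smooth_on UNIV \<psi>" "\<psi> (cmap c p) = 1"
      "\<And>x. x \<notin> ball (cmap c p) r \<Longrightarrow> \<psi> x = 0"
    using smooth_bump[OF r(1)] by blast
  define f where "f q = (if q \<in> cdom c then \<psi> (cmap c q) else 0)" for q
  define K where "K = cinv c ` cball (cmap c p) r"
  have K: "K \<subseteq> cdom c \<inter> U" using r(2) cinv_cmap[OF ch] by (auto simp: K_def subset_iff image_iff)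
  have "compact K" unfolding K_def
    by (intro compact_continuous_image continuous_on_subset[OF is_chartD(4)[OF ch]] compact_cball)
      (use r(2) in auto)
  then have "closed K" by (rule compact_imp_closed)
  have zero: "f q = 0" if "q \<notin> K" for q
  proof (cases "q \<in> cdom c")
    case True
    then have "cmap c q \<notin> cball (cmap c p) r"
      using that cinv_cmap[OF ch, of q] unfolding K_def by (metis image_eqI)
    then show ?thesis by (simp add: f_def \<psi>(3))
  qed (simp add: f_def)
  have "smooth_fun_on A UNIV f"
    unfolding smooth_fun_on_def
  proof safe
    fix d assume d: "d \<in> A"
    show "smooth_on (cmap d ` (cdom d \<inter> UNIV)) (f \<circ> cinv d)"
    proof (rule smooth_on_local)
      fix x assume "x \<in> cmap d ` (cdom d \<inter> UNIV)"
      then obtain q where q: "x = cmap d q" "q \<in> cdom d" by auto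
      show "\<exists>T. open T \<and> x \<in> T \<and> smooth_on T (f \<circ> cinv d)"
      proof (cases "q \<in> cdom c")
        case True
        have "smooth_on (triv.rdom d c) (\<lambda>x. \<psi> (trans d c x))"
          by (rule smooth_on_compose[OF _ _ _ _ \<psi>(1)]) (auto intro: triv.open_rdom triv.smooth_on_rep d c)
        then have "smooth_on (triv.rdom d c) (f \<circ> cinv d)"
          by (rule smooth_on_cong[OF triv.open_rdom[OF d c(1)], rotated])
            (auto simp: d c triv.rdom_def trans_cmap f_def cinv_cmap[OF triv.chA])
        then show ?thesis using True q triv.open_rdom[OF d c(1)] triv.rdomI by blast
      next
        case False
        then have "q \<notin> K" using K by blast
        have o: "open (cmap d ` (cdom d \<inter> - K))"
          by (rule open_chart_image[OF triv.chA[OF d]]) (use \<open>closed K\<close> in auto)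
        have "smooth_on (cmap d ` (cdom d \<inter> - K)) (f \<circ> cinv d)"
          by (rule smooth_on_cong[OF o _ smooth_on_const[of _ 0]])
            (auto simp: zero cinv_cmap[OF triv.chA[OF d]])
        then show ?thesis using o q \<open>q \<notin> K\<close> by blast
      qed
    qed
  qed simp
  moreover have "f p = 1" using \<psi>(2) c(2) by (simp add: f_def)
  ultimately show thesis using that \<open>closed K\<close> K zero by blast
qed

end

section \<open>Smooth fields along a map\<close>

context manifold_map begin

abbreviation "field_along \<equiv> field_along_on A B F"

lemma open_field_region:
  "open U \<Longrightarrow> c \<in> A \<Longrightarrow> d \<in> B \<Longrightarrow> open (cmap c ` (cdom c \<inter> U \<inter> F -` cdom d))"
  unfolding Int_assoc by (intro open_chart_image chA open_Int open_vimage_F is_chartD(1) chB)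

lemma field_along_cong:
  assumes "field_along U W" "\<And>q. q \<in> U \<Longrightarrow> W q = Z q"
  shows "field_along U Z"
  unfolding field_along_on_def
proof safe
  show U: "open U" using assms(1) by (simp add: field_along_on_def)
  fix c d assume cd: "c \<in> A" "d \<in> B"
  show "smooth_on (cmap c ` (cdom c \<inter> U \<inter> F -` cdom d)) (\<lambda>x. tcoord B d (F (cinv c x)) (Z (cinv c x)))"
    by (rule smooth_on_cong[OF open_field_region[OF U cd], of "\<lambda>x. tcoord B d (F (cinv c x)) (W (cinv c x))"])
      (use assms cd in \<open>auto simp: field_along_on_def cinv_cmap[OF chA]\<close>)
qed

lemma field_along_subset:
  "field_along U W \<Longrightarrow> open V \<Longrightarrow> V \<subseteq> U \<Longrightarrow> field_along V W"
  by (auto simp: field_along_on_def intro: smooth_on_subset[OF _ image_mono[OF Int_mono[OF Int_mono]]])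

lemma field_along_local:
  assumes "open U" "\<And>p. p \<in> U \<Longrightarrow> \<exists>V. p \<in> V \<and> field_along V W"
  shows "field_along U W"
  unfolding field_along_on_def
proof safe
  fix c d assume cd: "c \<in> A" "d \<in> B"
  show "smooth_on (cmap c ` (cdom c \<inter> U \<inter> F -` cdom d)) (\<lambda>x. tcoord B d (F (cinv c x)) (W (cinv c x)))"
  proof (rule smooth_on_local)
    fix x assume "x \<in> cmap c ` (cdom c \<inter> U \<inter> F -` cdom d)"
    then obtain q where q: "x = cmap c q" "q \<in> cdom c" "q \<in> U" "F q \<in> cdom d" by auto
    obtain V where V: "q \<in> V" "field_along V W" using assms(2) q(3) by blast
    then show "\<exists>T. open T \<and> x \<in> T \<and> smooth_on T (\<lambda>x. tcoord B d (F (cinv c x)) (W (cinv c x)))"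
      using q cd open_field_region[of V c d]
      by (intro exI[of _ "cmap c ` (cdom c \<inter> V \<inter> F -` cdom d)"]) (auto simp: field_along_on_def)
  qed
qed (rule assms)

lemma field_along_zero: "open U \<Longrightarrow> field_along U (\<lambda>q. 0)"
  unfolding field_along_on_def
proof safe
  fix c d assume U: "open U" and cd: "c \<in> A" "d \<in> B"
  show "smooth_on (cmap c ` (cdom c \<inter> U \<inter> F -` cdom d)) (\<lambda>x. tcoord B d (F (cinv c x)) 0)"
    by (rule smooth_on_cong[OF open_field_region[OF U cd] _ smooth_on_const[of _ 0]])
      (use cd in \<open>auto simp: cinv_cmap[OF chA] linear_0[OF cod.linear_tcoord]\<close>)
qed

lemma field_along_add:
  assumes "field_along U W" "field_along U Z"
  shows "field_along U (\<lambda>q. W q + Z q)"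
  unfolding field_along_on_def
proof safe
  show U: "open U" using assms(1) by (simp add: field_along_on_def)
  fix c d assume cd: "c \<in> A" "d \<in> B"
  have "smooth_on (cmap c ` (cdom c \<inter> U \<inter> F -` cdom d))
     (\<lambda>x. tcoord B d (F (cinv c x)) (W (cinv c x)) + tcoord B d (F (cinv c x)) (Z (cinv c x)))"
    using assms cd by (intro smooth_on_add open_field_region U) (auto simp: field_along_on_def)
  then show "smooth_on (cmap c ` (cdom c \<inter> U \<inter> F -` cdom d))
     (\<lambda>x. tcoord B d (F (cinv c x)) (W (cinv c x) + Z (cinv c x)))"
    by (rule smooth_on_cong[OF open_field_region[OF U cd], rotated])
      (use cd in \<open>auto simp: cinv_cmap[OF chA] linear_add[OF cod.linear_tcoord]\<close>)
qed

lemma field_along_scaleR: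
  assumes "smooth_fun_on A U f" "field_along U W"
  shows "field_along U (\<lambda>q. f q *\<^sub>R W q)"
  unfolding field_along_on_def
proof safe
  show U: "open U" using assms(1) by (simp add: smooth_fun_on_def)
  fix c d assume cd: "c \<in> A" "d \<in> B"
  have "smooth_on (cmap c ` (cdom c \<inter> U)) (f \<circ> cinv c)"
    using assms cd by (simp add: smooth_fun_on_def)
  then have "smooth_on (cmap c ` (cdom c \<inter> U \<inter> F -` cdom d)) (f \<circ> cinv c)"
    by (rule smooth_on_subset) auto
  then have "smooth_on (cmap c ` (cdom c \<inter> U \<inter> F -` cdom d))
     (\<lambda>x. (f \<circ> cinv c) x *\<^sub>R tcoord B d (F (cinv c x)) (W (cinv c x)))"
    using assms cd by (intro smooth_on_scaleR open_field_region U) (auto simp: field_along_on_def comp_def)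
  then show "smooth_on (cmap c ` (cdom c \<inter> U \<inter> F -` cdom d))
     (\<lambda>x. tcoord B d (F (cinv c x)) (f (cinv c x) *\<^sub>R W (cinv c x)))"
    by (rule smooth_on_cong[OF open_field_region[OF U cd], rotated])
      (use cd in \<open>auto simp: cinv_cmap[OF chA] linear_cmul[OF cod.linear_tcoord]\<close>)
qed

lemma field_along_sum:
  "open U \<Longrightarrow> (\<And>i. i \<in> I \<Longrightarrow> field_along U (W i)) \<Longrightarrow> field_along U (\<lambda>q. \<Sum>i\<in>I. W i q)"
  by (induction I rule: infinite_finite_induct) (auto intro: field_along_zero field_along_add)

text \<open>These fields have the form \<open>Y \<circ> F\<close>, on which the pullback connection
  is prescribed, and they form a local frame of the pullback bundle.\<close>

lemma field_along_coord_field: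
  assumes d: "d \<in> B"
  shows "field_along (F -` cdom d) (\<lambda>q. cod.coord_field d b (F q))"
  unfolding field_along_on_def
proof (intro conjI ballI)
  show U: "open (F -` cdom d)" by (intro open_vimage_F is_chartD(1)[OF chB[OF d]])
  fix c d' assume cd: "c \<in> A" "d' \<in> B"
  let ?S = "cmap c ` (cdom c \<inter> F -` cdom d \<inter> F -` cdom d')"
  have "smooth_on ?S (\<lambda>x. frechet_derivative (cod.trans d d') (at (rep c d x)) b)"
  proof (rule smooth_on_compose[where T = "cod.triv.rdom d d'" and f = "rep c d" and
        g = "\<lambda>y. frechet_derivative (cod.trans d d') (at y) b"])
    show "smooth_on (cod.triv.rdom d d') (\<lambda>y. frechet_derivative (cod.trans d d') (at y) b)"
      by (intro smooth_on_derivative cod.triv.smooth_on_rep d cd)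
    show "smooth_on ?S (rep c d)"
      by (rule smooth_on_subset[OF smooth_on_rep[OF cd(1) d]]) (auto simp: rdom_def)
    show "rep c d ` ?S \<subseteq> cod.triv.rdom d d'"
      by (auto simp: rep_cmap cd intro!: cod.triv.rdomI)
  qed (simp_all add: cod.triv.open_rdom d cd open_field_region U)
  then show "smooth_on ?S (\<lambda>x. tcoord B d' (F (cinv c x)) (cod.coord_field d b (F (cinv c x))))"
    by (rule smooth_on_cong[OF open_field_region[OF U cd], rotated])
      (auto simp: cinv_cmap[OF chA] cd d rep_cmap cod.tcoord_coord_field)
qed

lemma smooth_fun_on_tcoord:
  assumes "field_along U W" "d \<in> B"
  shows "smooth_fun_on A (U \<inter> F -` cdom d) (\<lambda>q. tcoord B d (F q) (W q) \<bullet> b)"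
  unfolding smooth_fun_on_def comp_def
proof safe
  have U: "open U" using assms(1) by (simp add: field_along_on_def)
  then show "open (U \<inter> F -` cdom d)" by (intro open_Int open_vimage_F is_chartD(1) chB assms)
  fix c assume c: "c \<in> A"
  show "smooth_on (cmap c ` (cdom c \<inter> (U \<inter> F -` cdom d))) (\<lambda>x. tcoord B d (F (cinv c x)) (W (cinv c x)) \<bullet> b)"
    using assms c open_field_region[OF U c assms(2)] unfolding Int_assoc[symmetric]
    by (intro smooth_on_inner smooth_on_const) (auto simp: field_along_on_def)
qed

lemma smooth_fun_on_inner_tcoord:
  assumes "field_along U W" "field_along U Z" "d \<in> B"
  shows "smooth_fun_on A (U \<inter> F -` cdom d) (\<lambda>q. tcoord B d (F q) (W q) \<bullet> tcoord B d (F q) (Z q))"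
proof -
  have "open (U \<inter> F -` cdom d)"
    using smooth_fun_on_tcoord[OF assms(1,3)] smooth_fun_onD_open by blast
  then have "smooth_fun_on A (U \<inter> F -` cdom d)
      (\<lambda>q. \<Sum>b\<in>Basis. (tcoord B d (F q) (W q) \<bullet> b) * (tcoord B d (F q) (Z q) \<bullet> b))"
    by (intro dom.smooth_fun_on_sum dom.smooth_fun_on_mult smooth_fun_on_tcoord assms)
  then show ?thesis by (simp add: euclidean_inner[symmetric])
qed

lemma field_along_tangent_map:
  assumes "vector_field_on A U X"
  shows "field_along U (\<lambda>q. tangent_map A B F q (X q))"
  unfolding field_along_on_def
proof safe
  show U: "open U" using assms by (simp add: field_along_on_def)
  fix c d assume cd: "c \<in> A" "d \<in> B"
  let ?S = "cmap c ` (cdom c \<inter> U \<inter> F -` cdom d)"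
  have X: "smooth_on (cmap c ` (cdom c \<inter> U \<inter> (\<lambda>p. p) -` cdom c)) (\<lambda>x. tcoord A c (cinv c x) (X (cinv c x)))"
    using assms cd by (simp add: field_along_on_def)
  have "smooth_on ?S (\<lambda>x. frechet_derivative (rep c d) (at x) (tcoord A c (cinv c x) (X (cinv c x))))"
    by (rule smooth_on_derivative_apply[of ?S "rdom c d" "\<lambda>x. x"])
      (auto simp: rdom_def cd open_field_region[OF U] open_rdom[unfolded rdom_def] smooth_on_id
        intro!: smooth_on_rep[unfolded rdom_def] smooth_on_subset[OF X])
  then show "smooth_on ?S (\<lambda>x. tcoord B d (F (cinv c x)) (tangent_map A B F (cinv c x) (X (cinv c x))))"
    by (rule smooth_on_cong[OF open_field_region[OF U cd], rotated])
      (auto simp: cinv_cmap[OF chA] cd tcoord_tangent_map[of c d])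
qed

lemma smooth_fun_on_compose:
  assumes "smooth_fun_on B V f"
  shows "smooth_fun_on A (F -` V) (\<lambda>q. f (F q))"
  unfolding smooth_fun_on_def comp_def
proof safe
  have V: "open V" using assms by (simp add: smooth_fun_on_def)
  then show "open (F -` V)" by (rule open_vimage_F)
  fix c assume c: "c \<in> A"
  show "smooth_on (cmap c ` (cdom c \<inter> F -` V)) (\<lambda>x. f (F (cinv c x)))"
  proof (rule smooth_on_local)
    fix x assume "x \<in> cmap c ` (cdom c \<inter> F -` V)"
    then obtain q where q: "x = cmap c q" "q \<in> cdom c" "F q \<in> V" by auto
    define d where "d = chart_at B (F q)"
    have d: "d \<in> B" "F q \<in> cdom d" by (simp_all add: d_def chart_at_B)
    let ?T = "cmap c ` (cdom c \<inter> F -` V \<inter> F -` cdom d)"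
    have T: "open ?T" by (intro open_field_region open_vimage_F V c d)
    have "smooth_on ?T (\<lambda>x. (f \<circ> cinv d) (rep c d x))"
    proof (rule smooth_on_compose[of ?T "cmap d ` (cdom d \<inter> V)"])
      show "smooth_on (cmap d ` (cdom d \<inter> V)) (f \<circ> cinv d)"
        using assms d by (simp add: smooth_fun_on_def)
      show "smooth_on ?T (rep c d)"
        by (rule smooth_on_subset[OF smooth_on_rep[OF c d(1)]]) (auto simp: rdom_def)
    qed (use c d in \<open>auto simp: rep_cmap T V intro: open_chart_image[OF chB]\<close>)
    then have "smooth_on ?T (\<lambda>x. f (F (cinv c x)))"
      by (rule smooth_on_cong[OF T, rotated])
        (auto simp: rep_cmap c d cinv_cmap[OF chB] cinv_cmap[OF chA])
    then show "\<exists>T. open T \<and> x \<in> T \<and> smooth_on T (\<lambda>x. f (F (cinv c x)))"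
      using T q d by blast
  qed
qed

lemma dfun_compose:
  assumes "smooth_fun_on B V f" "F p \<in> V"
  shows "dfun A (\<lambda>q. f (F q)) p v = dfun B f (F p) (tangent_map A B F p v)"
proof -
  let ?c = "chart_at A p" and ?d = "chart_at B (F p)"
  have "(f \<circ> cinv ?d has_derivative dfun B f (F p)) (at (rep ?c ?d (cmap ?c p)))"
    using cod.dfun_has_derivative[OF assms] by (simp add: rep_cmap chart_at_A)
  from diff_chain_at[OF rep_has_derivative[OF chart_at_A(1) chart_at_B(1) chart_at_A(2) chart_at_B(2)] this]
  have "((\<lambda>x. f (cinv ?d (rep ?c ?d x))) has_derivative (\<lambda>v. dfun B f (F p) (tangent_map A B F p v))) (at (cmap ?c p))"
    by (simp add: o_def tangent_map_eq)
  then have "(((\<lambda>q. f (F q)) \<circ> cinv ?c) has_derivative (\<lambda>v. dfun B f (F p) (tangent_map A B F p v))) (at (cmap ?c p))"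
    by (rule has_derivative_transform_within_open[OF _ open_rdom[OF chart_at_A(1) chart_at_B(1)]
          rdomI[OF chart_at_A(2) chart_at_B(2)]])
      (auto simp: rdom_def rep_cmap chart_at_A chart_at_B cinv_cmap chA chB)
  then show ?thesis by (rule dom.dfun_eqI)
qed

text \<open>Cut-off by a bump function. That each value of \<open>Z\<close> is a multiple of the
  value of \<open>W\<close> keeps \<open>Z\<close> inside every distribution of subspaces that
  contains \<open>W\<close>, in particular the vertical one.\<close>

lemma field_along_extend:
  assumes "field_along U W" "p \<in> U"
  obtains Z where "field_along UNIV Z" "Z p = W p" "\<And>q. \<exists>k. Z q = k *\<^sub>R W q" "\<And>q. q \<notin> U \<Longrightarrow> Z q = 0"
proof -
  obtain f K where f: "smooth_fun_on A UNIV f" "f p = 1" "closed K" "K \<subseteq> U" "\<And>q. q \<notin> K \<Longrightarrow> f q = 0"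
    using dom.bump_function[OF field_along_onD_open[OF assms(1)] assms(2)] by blast
  have "field_along UNIV (\<lambda>q. f q *\<^sub>R W q)"
  proof (rule field_along_local)
    fix q
    show "\<exists>V. q \<in> V \<and> field_along V (\<lambda>q. f q *\<^sub>R W q)"
    proof (cases "q \<in> U")
      case True
      then show ?thesis
        using field_along_scaleR[OF dom.smooth_fun_on_subset[OF f(1)] assms(1)] assms(1)
        by (auto simp: field_along_on_def)
    next
      case False
      have "field_along (- K) (\<lambda>q. f q *\<^sub>R W q)"
        by (rule field_along_cong[OF field_along_zero]) (use f in auto)
      then show ?thesis using False f(4) by blast
    qed
  qed simp
  then show thesis
    using that[of "\<lambda>q. f q *\<^sub>R W q"] f by auto
qed

end

section \<open>Connections along a map and their locality\<close>

locale connection = manifold_map A B F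
  for A :: "('a::{t2_space, second_countable_topology}, 'e::euclidean_space) chart set"
    and B :: "('b::{t2_space, second_countable_topology}, 'f::euclidean_space) chart set"
    and F :: "'a \<Rightarrow> 'b" +
  fixes D :: "('a \<Rightarrow> 'f) \<Rightarrow> 'a \<Rightarrow> 'e \<Rightarrow> 'f"
  assumes conn: "connection_along A B F D"
begin

lemma D_linear: "field_along U W \<Longrightarrow> p \<in> U \<Longrightarrow> linear (D W p)"
  using conn[unfolded connection_along_def, THEN conjunct1] by blast

lemma D_add:
  "field_along U W \<Longrightarrow> field_along U Z \<Longrightarrow> p \<in> U \<Longrightarrow> D (\<lambda>q. W q + Z q) p v = D W p v + D Z p v"
  using conn[unfolded connection_along_def, THEN conjunct2, THEN conjunct1] by blast

lemma D_scaleR: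
  "smooth_fun_on A U f \<Longrightarrow> field_along U W \<Longrightarrow> p \<in> U \<Longrightarrow>
    D (\<lambda>q. f q *\<^sub>R W q) p v = dfun A f p v *\<^sub>R W p + f p *\<^sub>R D W p v"
  using conn[unfolded connection_along_def, THEN conjunct2, THEN conjunct2, THEN conjunct1] by blast

text \<open>Multiplication by a bump function makes the two fields equal as total functions. In the
  Leibniz rule the bump has value 1 at \<open>p\<close>, and the terms with its differential agree
  because \<open>W p = Z p\<close>.\<close>

lemma D_local:
  assumes "field_along U W" "field_along U Z" "p \<in> U" "\<And>q. q \<in> U \<Longrightarrow> W q = Z q"
  shows "D W p v = D Z p v"
proof -
  have U: "open U" using field_along_onD_open[OF assms(1)] .
  obtain f K where f: "smooth_fun_on A UNIV f" "f p = 1" "closed K" "K \<subseteq> U" "\<And>q. q \<notin> K \<Longrightarrow> f q = 0"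
    using dom.bump_function[OF U assms(3)] by blast
  have fU: "smooth_fun_on A U f" using dom.smooth_fun_on_subset[OF f(1) U] by simp
  have "(\<lambda>q. f q *\<^sub>R W q) = (\<lambda>q. f q *\<^sub>R Z q)"
    using f assms(4) by (auto simp: fun_eq_iff)
  then have "D (\<lambda>q. f q *\<^sub>R W q) p v = D (\<lambda>q. f q *\<^sub>R Z q) p v" by simp
  then show ?thesis
    using D_scaleR[OF fU assms(1,3)] D_scaleR[OF fU assms(2,3)] assms(3,4) f(2) by simp
qed

text \<open>Additivity applied to 0 + 0 treats the zero function; locality extends this to functions
  that vanish near the point.\<close>

lemma D_zero:
  assumes "open U" "p \<in> U" "\<And>q. q \<in> U \<Longrightarrow> W q = 0"
  shows "D W p v = 0"
proof -
  have "D (\<lambda>q. 0) p v = 0"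
    using D_add[OF field_along_zero[OF assms(1)] field_along_zero[OF assms(1)] assms(2)] by simp
  moreover have "D W p v = D (\<lambda>q. 0) p v"
    by (rule D_local[OF field_along_cong[OF field_along_zero[OF assms(1)]] field_along_zero[OF assms(1)] assms(2)])
      (auto simp: assms(3))
  ultimately show ?thesis by simp
qed

lemma D_sum:
  assumes "open U" "p \<in> U" "\<And>i. i \<in> I \<Longrightarrow> field_along U (W i)"
  shows "D (\<lambda>q. \<Sum>i\<in>I. W i q) p v = (\<Sum>i\<in>I. D (W i) p v)"
  using assms(3)
proof (induction I rule: infinite_finite_induct)
  case (insert i I)
  then show ?case
    using D_add[OF insert.prems field_along_sum[OF assms(1), of I W] assms(2)] by simp
qed (use D_zero[OF assms(1,2)] in auto)

end

section \<open>The second fundamental form of a map\<close>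

locale riemannian_manifold = manifold A
  for A :: "('a::{t2_space, second_countable_topology}, 'e::euclidean_space) chart set" +
  fixes g :: "'a \<Rightarrow> 'e \<Rightarrow> 'e \<Rightarrow> real"
  assumes metric: "riemannian_metric A g"
begin

lemma bilinear_g: "bilinear (g p)"
  and g_sym: "g p v w = g p w v"
  and g_pos: "v \<noteq> 0 \<Longrightarrow> g p v v > 0"
  and smooth_fun_on_g:
    "vector_field_on A U X \<Longrightarrow> vector_field_on A U Y \<Longrightarrow> smooth_fun_on A U (\<lambda>p. g p (X p) (Y p))"
  using metric by (auto simp: riemannian_metric_def)

lemmas g_linear_simps =
  bilinear_ladd[OF bilinear_g] bilinear_radd[OF bilinear_g]
  bilinear_lmul[OF bilinear_g] bilinear_rmul[OF bilinear_g]
  bilinear_lsub[OF bilinear_g] bilinear_rsub[OF bilinear_g]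
  bilinear_lneg[OF bilinear_g] bilinear_rneg[OF bilinear_g]
  bilinear_lzero[OF bilinear_g] bilinear_rzero[OF bilinear_g]

lemma g_sum_left: "g p (\<Sum>i\<in>I. v i) w = (\<Sum>i\<in>I. g p (v i) w)"
  using linear_sum[of "\<lambda>v. g p v w"] bilinear_g[of p] by (simp add: bilinear_def)

lemma g_sum_right: "g p w (\<Sum>i\<in>I. v i) = (\<Sum>i\<in>I. g p w (v i))"
  using linear_sum[of "\<lambda>v. g p w v"] bilinear_g[of p] by (simp add: bilinear_def)

lemma g_eq_0_iff: "g p v v = 0 \<longleftrightarrow> v = 0"
  using g_pos[of v p] by (cases "v = 0") (auto simp: g_linear_simps)

end

locale riemannian_map = manifold_map A B F +
  M: riemannian_manifold A gM + N: riemannian_manifold B gN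
  for A :: "('a::{t2_space, second_countable_topology}, 'e::euclidean_space) chart set"
    and gM :: "'a \<Rightarrow> 'e \<Rightarrow> 'e \<Rightarrow> real"
    and B :: "('b::{t2_space, second_countable_topology}, 'f::euclidean_space) chart set"
    and gN :: "'b \<Rightarrow> 'f \<Rightarrow> 'f \<Rightarrow> real"
    and F :: "'a \<Rightarrow> 'b" +
  fixes DM :: "('a \<Rightarrow> 'e) \<Rightarrow> 'a \<Rightarrow> 'e \<Rightarrow> 'e" and DN :: "('b \<Rightarrow> 'f) \<Rightarrow> 'b \<Rightarrow> 'f \<Rightarrow> 'f"
    and DF :: "('a \<Rightarrow> 'f) \<Rightarrow> 'a \<Rightarrow> 'e \<Rightarrow> 'f"
  assumes lcM: "levi_civita A gM DM" and lcN: "levi_civita B gN DN"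
    and pb: "pullback_connection A B F DN DF"

sublocale riemannian_map \<subseteq> DF: connection A B F DF
  by unfold_locales (use pb in \<open>simp add: pullback_connection_def\<close>)
sublocale riemannian_map \<subseteq> DM: connection A A "\<lambda>p. p" DM
  by unfold_locales (use lcM in \<open>simp add: levi_civita_def\<close>)
sublocale riemannian_map \<subseteq> DN: connection B B "\<lambda>p. p" DN
  by unfold_locales (use lcN in \<open>simp add: levi_civita_def\<close>)

context manifold begin

text \<open>In their own chart these fields have constant components. A torsion-free connection is
  therefore symmetric on them.\<close>

lemma lie_bracket_coord_field:
  "lie_bracket A (coord_field (chart_at A p) a) (coord_field (chart_at A p) b) p = 0"
proof -
  let ?c = "chart_at A p"
  have c: "?c \<in> A" "p \<in> cdom ?c" by (simp_all add: chart_at[OF mA])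
  have "frechet_derivative (\<lambda>x. tcoord A ?c (cinv ?c x) (coord_field ?c b (cinv ?c x))) (at (cmap ?c p)) =
      frechet_derivative (\<lambda>x. b) (at (cmap ?c p))" for b
    by (rule frechet_derivative_cong_open[OF is_chartD(2)[OF triv.chA[OF c(1)]]])
      (use c in \<open>auto simp: cinv_cmap[OF triv.chA[OF c(1)]] tcoord_coord_field_self\<close>)
  then show ?thesis by (simp add: lie_bracket_def)
qed

lemma vector_field_coord_field: "c \<in> A \<Longrightarrow> vector_field_on A (cdom c) (coord_field c b)"
  using triv.field_along_coord_field[of c b] by simp

end

context manifold_map begin

lemma field_along_expansion:
  assumes "field_along U W" "d \<in> B" "q \<in> U \<inter> F -` cdom d"
  shows "W q = (\<Sum>b\<in>Basis. (tcoord B d (F q) (W q) \<bullet> b) *\<^sub>R cod.coord_field d b (F q))"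
  using assms by (intro cod.coord_field_expansion) auto

end

section \<open>Metric compatibility of the pullback connection\<close>

context riemannian_map begin

lemma DF_compose:
  "vector_field_on B U Y \<Longrightarrow> F p \<in> U \<Longrightarrow> DF (\<lambda>q. Y (F q)) p v = DN Y (F p) (tangent_map A B F p v)"
  using pb unfolding pullback_connection_def comp_def by blast

lemma torsion_free_M: "vector_field_on A U X \<Longrightarrow> vector_field_on A U Y \<Longrightarrow> p \<in> U \<Longrightarrow>
    DM Y p (X p) - DM X p (Y p) = lie_bracket A X Y p"
  and metric_M: "vector_field_on A U X \<Longrightarrow> vector_field_on A U Y \<Longrightarrow> p \<in> U \<Longrightarrow>
    dfun A (\<lambda>q. gM q (X q) (Y q)) p v = gM p (DM X p v) (Y p) + gM p (X p) (DM Y p v)"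
  using lcM unfolding levi_civita_def by blast+

lemma torsion_free_N: "vector_field_on B U X \<Longrightarrow> vector_field_on B U Y \<Longrightarrow> p \<in> U \<Longrightarrow>
    DN Y p (X p) - DN X p (Y p) = lie_bracket B X Y p"
  and metric_N: "vector_field_on B U X \<Longrightarrow> vector_field_on B U Y \<Longrightarrow> p \<in> U \<Longrightarrow>
    dfun B (\<lambda>q. gN q (X q) (Y q)) p w = gN p (DN X p w) (Y p) + gN p (X p) (DN Y p w)"
  using lcN unfolding levi_civita_def by blast+

text \<open>The metric product rule for one pair of fields, bundled with the smoothness that makes
  the notion closed under combinations with smooth coefficients.\<close>

definition compatible :: "'a set \<Rightarrow> ('a \<Rightarrow> 'f) \<Rightarrow> ('a \<Rightarrow> 'f) \<Rightarrow> bool" where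
  "compatible U W Z \<longleftrightarrow> field_along U W \<and> field_along U Z \<and>
     smooth_fun_on A U (\<lambda>q. gN (F q) (W q) (Z q)) \<and>
     (\<forall>p\<in>U. \<forall>v. dfun A (\<lambda>q. gN (F q) (W q) (Z q)) p v =
        gN (F p) (DF W p v) (Z p) + gN (F p) (W p) (DF Z p v))"

lemma compatible_sym: "compatible U W Z \<Longrightarrow> compatible U Z W"
  unfolding compatible_def by (simp add: N.g_sym add.commute)

lemma compatible_add:
  assumes "compatible U W Z" "compatible U W' Z"
  shows "compatible U (\<lambda>q. W q + W' q) Z"
  using assms unfolding compatible_def
  by (auto simp: N.g_linear_simps DF.D_add dom.dfun_add intro: field_along_add dom.smooth_fun_on_add)

lemma compatible_scaleR:
  assumes "smooth_fun_on A U f" "compatible U W Z"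
  shows "compatible U (\<lambda>q. f q *\<^sub>R W q) Z"
  using assms unfolding compatible_def
  by (auto simp: N.g_linear_simps DF.D_scaleR dom.dfun_mult algebra_simps
      intro: field_along_scaleR dom.smooth_fun_on_mult)

lemma compatible_sum:
  assumes "field_along U Z" "\<And>i. i \<in> I \<Longrightarrow> compatible U (W i) Z"
  shows "compatible U (\<lambda>q. \<Sum>i\<in>I. W i q) Z"
proof -
  have U: "open U" using field_along_onD_open[OF assms(1)] .
  have "compatible U (\<lambda>q. 0) Z"
    unfolding compatible_def
    by (auto simp: N.g_linear_simps assms(1) field_along_zero[OF U] DF.D_zero[OF U] dom.dfun_const
        intro: dom.smooth_fun_on_const[OF U])
  then show ?thesis using assms(2)
    by (induction I rule: infinite_finite_induct) (auto intro: compatible_add)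
qed

lemma compatible_cong:
  assumes "compatible U W Z" "\<And>q. q \<in> U \<Longrightarrow> W q = W' q"
  shows "compatible U W' Z"
proof -
  note c = assms(1)[unfolded compatible_def]
  have W': "field_along U W'" using field_along_cong assms c by blast
  have U: "open U" using field_along_onD_open W' .
  have "DF W' p v = DF W p v" if "p \<in> U" for p v
    using DF.D_local[OF _ W' that, of W] c assms(2) by auto
  moreover have "dfun A (\<lambda>q. gN (F q) (W' q) (Z q)) p v = dfun A (\<lambda>q. gN (F q) (W q) (Z q)) p v"
    if "p \<in> U" for p v
    by (rule dom.dfun_cong[OF U that]) (simp add: assms(2))
  moreover have "smooth_fun_on A U (\<lambda>q. gN (F q) (W' q) (Z q))"
    by (rule dom.smooth_fun_on_cong[OF conjunct1[OF conjunct2[OF conjunct2[OF c]]]]) (simp add: assms(2))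
  ultimately show ?thesis using c W' assms(2) by (auto simp: compatible_def)
qed

text \<open>The base case: on fields pulled back from the target the rule is metric compatibility of
  \<open>DN\<close> together with the chain rule.\<close>

lemma compatible_coord_field:
  assumes "d \<in> B"
  shows "compatible (F -` cdom d) (\<lambda>q. cod.coord_field d a (F q)) (\<lambda>q. cod.coord_field d b (F q))"
proof -
  let ?E = "cod.coord_field d"
  have E: "vector_field_on B (cdom d) (?E b)" for b by (rule cod.vector_field_coord_field[OF assms])
  note s = N.smooth_fun_on_g[OF E E, of a b]
  show ?thesis
    unfolding compatible_def
    using field_along_coord_field[OF assms] smooth_fun_on_compose[OF s]
    by (auto simp: dfun_compose[OF s] metric_N[OF E E] DF_compose[OF E])
qed

text \<open>Both fields are expanded in the coordinate frame of the target. The closure lemmas act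
  on the first argument, so the second one is treated by symmetry, against a fixed frame
  field.\<close>

lemma compatible_local:
  assumes "field_along U W" "field_along U Z" "d \<in> B"
  shows "compatible (U \<inter> F -` cdom d) W Z"
proof -
  let ?V = "U \<inter> F -` cdom d" and ?E = "\<lambda>b q. cod.coord_field d b (F q)"
  have V: "open ?V" using smooth_fun_on_tcoord[OF assms(1,3)] smooth_fun_onD_open by blast
  have sub: "compatible ?V X Y" if "compatible (F -` cdom d) X Y" for X Y
    using that V unfolding compatible_def
    by (auto intro: field_along_subset dom.smooth_fun_on_subset)
  have E: "field_along ?V (?E b)" for b
    using field_along_subset[OF field_along_coord_field[OF assms(3)] V] by simp
  have Z: "field_along ?V Z" using field_along_subset[OF assms(2) V] by simp
  have EZ: "compatible ?V (?E b) Z" for b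
  proof -
    have "compatible ?V (\<lambda>q. \<Sum>i\<in>Basis. (tcoord B d (F q) (Z q) \<bullet> i) *\<^sub>R ?E i q) (?E b)"
      by (intro compatible_sum compatible_scaleR smooth_fun_on_tcoord assms E sub compatible_coord_field)
    then have "compatible ?V Z (?E b)"
      by (rule compatible_cong) (use field_along_expansion[OF assms(2,3)] in auto)
    then show ?thesis by (rule compatible_sym)
  qed
  have "compatible ?V (\<lambda>q. \<Sum>i\<in>Basis. (tcoord B d (F q) (W q) \<bullet> i) *\<^sub>R ?E i q) Z"
    by (intro compatible_sum compatible_scaleR smooth_fun_on_tcoord assms Z EZ)
  then show ?thesis
    by (rule compatible_cong) (use field_along_expansion[OF assms(1,3)] in auto)
qed

lemma metric_F:
  assumes "field_along U W" "field_along U Z" "p \<in> U"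
  shows "dfun A (\<lambda>q. gN (F q) (W q) (Z q)) p v = gN (F p) (DF W p v) (Z p) + gN (F p) (W p) (DF Z p v)"
  using compatible_local[OF assms(1,2) chart_at_B(1)[of "F p"]] assms(3) chart_at_B(2)
  by (simp add: compatible_def)

section \<open>Tensoriality and symmetry of the second fundamental form\<close>

text \<open>The second fundamental form with its first field replaced by a tangent vector, since it
  depends only on the value of that field at the point.\<close>

definition sff :: "('a \<Rightarrow> 'e) \<Rightarrow> 'a \<Rightarrow> 'e \<Rightarrow> 'f" where
  "sff Y p v = DF (\<lambda>q. tangent_map A B F q (Y q)) p v - tangent_map A B F p (DM Y p v)"

lemma second_fund_form_eq: "second_fund_form A DM B F DF X Y p = sff Y p (X p)"
  by (simp add: second_fund_form_def sff_def)

lemma linear_sff: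
  assumes "vector_field_on A U Y" "p \<in> U"
  shows "linear (sff Y p)"
  unfolding sff_def
  using linear_compose[OF DM.D_linear[OF assms] linear_tangent_map[of p]]
    DF.D_linear[OF field_along_tangent_map[OF assms(1)] assms(2)]
  by (intro linear_compose_sub) (simp_all add: o_def)

text \<open>The Leibniz terms with the differentials of the \<open>f i\<close> are the same in both
  parts of the difference and cancel, so \<open>sff\<close> is linear over smooth functions in its
  field.\<close>

lemma sff_expand:
  assumes Y: "vector_field_on A U Y" and E: "\<And>i. i \<in> I \<Longrightarrow> vector_field_on A U (E i)"
    and f: "\<And>i. i \<in> I \<Longrightarrow> smooth_fun_on A U (f i)"
    and eq: "\<And>q. q \<in> U \<Longrightarrow> Y q = (\<Sum>i\<in>I. f i q *\<^sub>R E i q)" and p: "p \<in> U"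
  shows "sff Y p v = (\<Sum>i\<in>I. f i p *\<^sub>R sff (E i) p v)"
proof -
  let ?T = "tangent_map A B F"
  have U: "open U" using field_along_onD_open[OF Y] .
  have fE: "vector_field_on A U (\<lambda>q. f i q *\<^sub>R E i q)" if "i \<in> I" for i
    using dom.triv.field_along_scaleR[OF f E] that by blast
  have TE: "field_along U (\<lambda>q. ?T q (E i q))" if "i \<in> I" for i
    using field_along_tangent_map[OF E[OF that]] .
  have fTE: "field_along U (\<lambda>q. f i q *\<^sub>R ?T q (E i q))" if "i \<in> I" for i
    using field_along_scaleR[OF f TE] that by blast
  have "DM Y p v = DM (\<lambda>q. \<Sum>i\<in>I. f i q *\<^sub>R E i q) p v"
    by (rule DM.D_local[OF Y dom.triv.field_along_sum[OF U fE] p]) (auto simp: eq)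
  also have "\<dots> = (\<Sum>i\<in>I. DM (\<lambda>q. f i q *\<^sub>R E i q) p v)" by (rule DM.D_sum[OF U p fE])
  also have "\<dots> = (\<Sum>i\<in>I. dfun A (f i) p v *\<^sub>R E i p + f i p *\<^sub>R DM (E i) p v)"
    by (intro sum.cong refl DM.D_scaleR[OF f E p])
  finally have M: "?T p (DM Y p v) = (\<Sum>i\<in>I. dfun A (f i) p v *\<^sub>R ?T p (E i p) + f i p *\<^sub>R ?T p (DM (E i) p v))"
    by (simp add: linear_sum[OF linear_tangent_map] linear_add[OF linear_tangent_map] linear_cmul[OF linear_tangent_map])
  have "DF (\<lambda>q. ?T q (Y q)) p v = DF (\<lambda>q. \<Sum>i\<in>I. f i q *\<^sub>R ?T q (E i q)) p v"
    by (rule DF.D_local[OF field_along_tangent_map[OF Y] field_along_sum[OF U fTE] p])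
      (auto simp: eq linear_sum[OF linear_tangent_map] linear_cmul[OF linear_tangent_map])
  also have "\<dots> = (\<Sum>i\<in>I. DF (\<lambda>q. f i q *\<^sub>R ?T q (E i q)) p v)" by (rule DF.D_sum[OF U p fTE])
  also have "\<dots> = (\<Sum>i\<in>I. dfun A (f i) p v *\<^sub>R ?T p (E i p) + f i p *\<^sub>R DF (\<lambda>q. ?T q (E i q)) p v)"
    by (intro sum.cong refl DF.D_scaleR[OF f TE p])
  finally show ?thesis
    unfolding sff_def M by (simp add: sum_subtractf[symmetric] algebra_simps)
qed

text \<open>In coordinates the expression consists of second partial derivatives of \<open>F\<close>
  and Christoffel terms of the target. The former are symmetric by calculus, the latter because
  \<open>DN\<close> is torsion-free.\<close>

lemma DF_coord_field_symmetric:
  defines "c \<equiv> \<lambda>p. chart_at A p"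
  shows "DF (\<lambda>q. tangent_map A B F q (dom.coord_field (c p) a q)) p (dom.coord_field (c p) b p) =
    DF (\<lambda>q. tangent_map A B F q (dom.coord_field (c p) b q)) p (dom.coord_field (c p) a p)"
proof -
  let ?c = "c p" and ?d = "chart_at B (F p)"
  let ?X = "dom.coord_field ?c" and ?E = "cod.coord_field ?d" and ?T = "tangent_map A B F"
  have c: "?c \<in> A" "p \<in> cdom ?c" and d: "?d \<in> B" "F p \<in> cdom ?d"
    by (simp_all add: c_def chart_at_A chart_at_B)
  define U where "U = cdom ?c \<inter> F -` cdom ?d"
  have p: "p \<in> U" using c d by (simp add: U_def)
  \<comment> \<open>A component of the image of a coordinate field, that is, a first partial
    derivative of \<open>F\<close> in coordinates.\<close>
  define w where "w a i q = tcoord B ?d (F q) (?T q (?X a q)) \<bullet> i" for a i q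
  have TX: "field_along (cdom ?c) (\<lambda>q. ?T q (?X a q))" for a
    by (rule field_along_tangent_map[OF dom.vector_field_coord_field[OF c(1)]])
  have w: "smooth_fun_on A U (w a i)" for a i
    unfolding w_def U_def by (rule smooth_fun_on_tcoord[OF TX d(1)])
  have U: "open U" using w smooth_fun_onD_open by blast
  have TXU: "field_along U (\<lambda>q. ?T q (?X a q))" for a
    using field_along_subset[OF TX U] by (simp add: U_def)
  have E: "field_along U (\<lambda>q. ?E i (F q))" for i
    using field_along_subset[OF field_along_coord_field[OF d(1)] U] by (simp add: U_def)
  have wE: "field_along U (\<lambda>q. w a i q *\<^sub>R ?E i (F q))" for a i
    using field_along_scaleR[OF w E] .
  have exp: "?T q (?X a q) = (\<Sum>i\<in>Basis. w a i q *\<^sub>R ?E i (F q))" if "q \<in> U" for a q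
    using field_along_expansion[OF TX d(1)] that unfolding w_def U_def by simp
  have EN: "vector_field_on B (cdom ?d) (?E i)" for i by (rule cod.vector_field_coord_field[OF d(1)])
  have DN_sym: "DN (?E i) (F p) (?E j (F p)) = DN (?E j) (F p) (?E i (F p))" for i j
    using torsion_free_N[OF EN EN d(2), of j i] cod.lie_bracket_coord_field[of "F p"] by simp
  have D: "DF (\<lambda>q. ?T q (?X a q)) p (?X b p) = (\<Sum>i\<in>Basis. dfun A (w a i) p (?X b p) *\<^sub>R ?E i (F p)) +
      (\<Sum>i\<in>Basis. \<Sum>j\<in>Basis. (w a i p * w b j p) *\<^sub>R DN (?E i) (F p) (?E j (F p)))" for a b
  proof -
    have DE: "DF (\<lambda>q. ?E i (F q)) p (?X b p) = (\<Sum>j\<in>Basis. w b j p *\<^sub>R DN (?E i) (F p) (?E j (F p)))" for i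
    proof -
      have lin: "linear (DN (?E i) (F p))" by (rule DN.D_linear[OF EN d(2)])
      show ?thesis
        by (simp add: DF_compose[OF EN d(2)] exp[OF p] linear_sum[OF lin] linear_cmul[OF lin])
    qed
    have "DF (\<lambda>q. ?T q (?X a q)) p (?X b p) = DF (\<lambda>q. \<Sum>i\<in>Basis. w a i q *\<^sub>R ?E i (F q)) p (?X b p)"
      by (rule DF.D_local[OF TXU field_along_sum[OF U wE] p exp])
    also have "\<dots> = (\<Sum>i\<in>Basis. dfun A (w a i) p (?X b p) *\<^sub>R ?E i (F p) + w a i p *\<^sub>R DF (\<lambda>q. ?E i (F q)) p (?X b p))"
      using DF.D_sum[OF U p wE] DF.D_scaleR[OF w E p] by simp
    finally show ?thesis by (simp add: DE sum.distrib scaleR_sum_right)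
  qed
  have second: "dfun A (w a i) p (?X b p) = dfun A (w b i) p (?X a p)" for a b i
  proof -
    let ?f = "\<lambda>x. rep ?c ?d x \<bullet> i"
    have S: "smooth_on (rdom ?c ?d) ?f"
      by (intro smooth_on_inner smooth_on_rep smooth_on_const open_rdom c d)
    have df: "frechet_derivative ?f (at x) a = frechet_derivative (rep ?c ?d) (at x) a \<bullet> i"
      if "x \<in> rdom ?c ?d" for x a
    proof -
      have "(?f has_derivative (\<lambda>v. frechet_derivative (rep ?c ?d) (at x) v \<bullet> i)) (at x)"
        using has_frechet_derivative[OF smooth_onD_differentiable[OF smooth_on_rep[OF c(1) d(1)] that]]
        by (auto intro!: derivative_eq_intros)
      then show ?thesis by (metis frechet_derivative_at)
    qed
    have "dfun A (w a i) p (?X b p) = frechet_derivative (\<lambda>x. frechet_derivative ?f (at x) a) (at (cmap ?c p)) b" for a b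
    proof -
      have "dfun A (w a i) p (?X b p) = frechet_derivative (w a i \<circ> cinv ?c) (at (cmap ?c p)) b"
        using dom.dfun_tcoord[OF w p c] by (simp add: dom.tcoord_coord_field_self[OF c])
      also have "frechet_derivative (w a i \<circ> cinv ?c) (at (cmap ?c p)) =
          frechet_derivative (\<lambda>x. frechet_derivative ?f (at x) a) (at (cmap ?c p))"
      proof (rule frechet_derivative_cong_open[OF open_rdom[OF c(1) d(1)] rdomI[OF c(2) d(2)]])
        fix x assume x: "x \<in> rdom ?c ?d"
        then obtain q where q: "x = cmap ?c q" "q \<in> cdom ?c" "F q \<in> cdom ?d" by (auto simp: rdom_def)
        show "(w a i \<circ> cinv ?c) x = frechet_derivative ?f (at x) a"
          unfolding df[OF x] using q
          by (simp add: cinv_cmap[OF chA[OF c(1)]] w_def tcoord_tangent_map[OF c(1) d(1)]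
              dom.tcoord_coord_field_self[OF c(1)])
      qed
      finally show ?thesis .
    qed
    then show ?thesis
      using smooth_on_second_derivative_symmetric_real[OF S open_rdom[OF c(1) d(1)] rdomI[OF c(2) d(2)]] by simp
  qed
  have "(\<Sum>i\<in>Basis. \<Sum>j\<in>Basis. (w a i p * w b j p) *\<^sub>R DN (?E i) (F p) (?E j (F p))) =
      (\<Sum>i\<in>Basis. \<Sum>j\<in>Basis. (w b i p * w a j p) *\<^sub>R DN (?E i) (F p) (?E j (F p)))"
    by (subst sum.swap) (simp add: DN_sym mult.commute)
  then show ?thesis unfolding D second by simp
qed

text \<open>By tensoriality coordinate fields suffice. Their bracket vanishes, so torsion-freeness
  of \<open>DM\<close> settles one part of \<open>sff\<close>, and
  \<open>DF_coord_field_symmetric\<close> the other.\<close>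

lemma sff_symmetric:
  assumes "vector_field_on A U X" "vector_field_on A U Y" "p \<in> U"
  shows "sff Y p (X p) = sff X p (Y p)"
proof -
  let ?c = "chart_at A p"
  let ?E = "dom.coord_field ?c"
  have c: "?c \<in> A" "p \<in> cdom ?c" by (simp_all add: chart_at_A)
  have E: "vector_field_on A (cdom ?c) (?E i)" for i by (rule dom.vector_field_coord_field[OF c(1)])
  have sym: "sff (?E i) p (?E j p) = sff (?E j) p (?E i p)" for i j
    using torsion_free_M[OF E E c(2), of j i] dom.lie_bracket_coord_field[of p] DF_coord_field_symmetric
    by (simp add: sff_def)
  let ?V = "U \<inter> (\<lambda>p. p) -` cdom ?c"
  have V: "open ?V"
    using dom.triv.smooth_fun_on_tcoord[OF assms(1) c(1)] smooth_fun_onD_open by blast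
  have p: "p \<in> ?V" using assms(3) c(2) by simp
  have EV: "vector_field_on A ?V (?E i)" for i
    using dom.triv.field_along_subset[OF E V] by simp
  have "sff Y p (X p) = (\<Sum>i\<in>Basis. \<Sum>j\<in>Basis.
      ((tcoord A ?c p (Y p) \<bullet> i) * (tcoord A ?c p (X p) \<bullet> j)) *\<^sub>R sff (?E i) p (?E j p))"
    if XY: "vector_field_on A U X" "vector_field_on A U Y" for X Y
  proof -
    have EX: "sff (?E i) p (X p) = (\<Sum>j\<in>Basis. (tcoord A ?c p (X p) \<bullet> j) *\<^sub>R sff (?E i) p (?E j p))" for i
    proof -
      note lin = linear_sff[OF EV p, of i]
      show ?thesis
        by (subst dom.coord_field_expansion[OF c, of "X p"])
          (simp add: linear_sum[OF lin] linear_cmul[OF lin])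
    qed
    have "sff Y p (X p) = (\<Sum>i\<in>Basis. (tcoord A ?c p (Y p) \<bullet> i) *\<^sub>R sff (?E i) p (X p))"
      by (rule sff_expand[OF dom.triv.field_along_subset[OF XY(2) V] EV
            dom.triv.smooth_fun_on_tcoord[OF XY(2) c(1)] _ p])
        (use dom.triv.field_along_expansion[OF XY(2) c(1)] in auto)
    then show ?thesis by (simp add: EX scaleR_sum_right)
  qed
  note expand = this
  have "sff Y p (X p) = (\<Sum>i\<in>Basis. \<Sum>j\<in>Basis.
      ((tcoord A ?c p (Y p) \<bullet> i) * (tcoord A ?c p (X p) \<bullet> j)) *\<^sub>R sff (?E i) p (?E j p))"
    by (rule expand[OF assms(1,2)])
  also have "\<dots> = (\<Sum>i\<in>Basis. \<Sum>j\<in>Basis.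
      ((tcoord A ?c p (X p) \<bullet> i) * (tcoord A ?c p (Y p) \<bullet> j)) *\<^sub>R sff (?E i) p (?E j p))"
    by (subst sum.swap) (simp add: sym mult.commute)
  also have "\<dots> = sff X p (Y p)" by (rule expand[OF assms(2,1), symmetric])
  finally show ?thesis .
qed

end

section \<open>Orthonormal frames\<close>

text \<open>Stated for an arbitrary \<open>h\<close>, as it is applied to a metric at a point, to
  the Euclidean product and to a degenerate pulled-back product.\<close>

definition orthonormal :: "('e \<Rightarrow> 'e \<Rightarrow> real) \<Rightarrow> nat \<Rightarrow> (nat \<Rightarrow> 'e) \<Rightarrow> bool" where
  "orthonormal h k u \<longleftrightarrow> (\<forall>i<k. \<forall>j<k. h (u i) (u j) = (if i = j then 1 else 0))"

lemma orthonormalD: "orthonormal h k u \<Longrightarrow> i < k \<Longrightarrow> j < k \<Longrightarrow> h (u i) (u j) = (if i = j then 1 else 0)"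
  by (simp add: orthonormal_def)

lemma bilinear_sum_left: "bilinear h \<Longrightarrow> h (\<Sum>i\<in>I. v i) w = (\<Sum>i\<in>I. h (v i) w)"
  using linear_sum[of "\<lambda>v. h v w"] by (simp add: bilinear_def)

lemma bilinear_sum_right: "bilinear h \<Longrightarrow> h w (\<Sum>i\<in>I. v i) = (\<Sum>i\<in>I. h w (v i))"
  using linear_sum[of "\<lambda>v. h w v"] by (simp add: bilinear_def)

text \<open>Both sides are linear in \<open>v\<close> and agree on the vectors \<open>u j\<close>,
  hence on their span.\<close>

lemma orthonormal_expansion:
  fixes h :: "'e::real_vector \<Rightarrow> 'e \<Rightarrow> real"
  assumes h: "bilinear h" and u: "orthonormal h k u" and v: "v \<in> span (u ` {..<k})"
  shows "v = (\<Sum>i<k. h v (u i) *\<^sub>R u i)"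
proof -
  define f where "f v = (\<Sum>i<k. h v (u i) *\<^sub>R u i)" for v
  have f: "linear f"
    by (rule linearI)
      (simp_all add: f_def bilinear_ladd[OF h] bilinear_lmul[OF h] scaleR_add_left sum.distrib scaleR_sum_right)
  have "subspace {v. f v = v}"
    by (auto simp: subspace_def linear_0[OF f] linear_add[OF f] linear_cmul[OF f])
  moreover have "u ` {..<k} \<subseteq> {v. f v = v}"
  proof safe
    fix j assume j: "j < k"
    have "f (u j) = (\<Sum>i<k. if i = j then u i else 0)"
      unfolding f_def using j by (intro sum.cong) (auto simp: orthonormalD[OF u])
    then show "f (u j) = u j" using j by simp
  qed
  ultimately have "span (u ` {..<k}) \<subseteq> {v. f v = v}" by (rule span_minimal[rotated])
  then show ?thesis using v by (auto simp: f_def)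
qed

lemma orthonormal_independent:
  fixes h :: "'e::real_vector \<Rightarrow> 'e \<Rightarrow> real"
  assumes h: "bilinear h" and u: "orthonormal h k u"
  shows "independent (u ` {..<k})" "card (u ` {..<k}) = k"
proof -
  have inj: "inj_on u {..<k}"
    by (rule inj_onI) (metis lessThan_iff orthonormalD[OF u] zero_neq_one)
  then show "card (u ` {..<k}) = k" by (simp add: card_image)
  show "independent (u ` {..<k})"
  proof
    assume "dependent (u ` {..<k})"
    then obtain j where j: "j < k" "u j \<in> span (u ` {..<k} - {u j})" unfolding dependent_def by auto
    have "span (u ` {..<k} - {u j}) \<subseteq> {v. h v (u j) = 0}"
    proof (rule span_minimal)
      show "u ` {..<k} - {u j} \<subseteq> {v. h v (u j) = 0}" using j(1) by (auto simp: orthonormalD[OF u])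
      show "subspace {v. h v (u j) = 0}"
        by (simp add: subspace_def bilinear_ladd[OF h] bilinear_lmul[OF h] bilinear_lzero[OF h])
    qed
    then show False using j orthonormalD[OF u j(1) j(1)] by auto
  qed
qed

lemma orthonormal_span_eq:
  fixes h :: "'e::euclidean_space \<Rightarrow> 'e \<Rightarrow> real"
  assumes h: "bilinear h" and u: "orthonormal h k u" and S: "subspace S" "dim S = k" "u ` {..<k} \<subseteq> S"
  shows "span (u ` {..<k}) = S"
proof
  show "span (u ` {..<k}) \<subseteq> S" using S by (simp add: span_minimal)
  show "S \<subseteq> span (u ` {..<k})"
    using card_eq_dim[OF S(3)] orthonormal_independent[OF h u] S(2) by auto
qed

text \<open>After expanding \<open>f i\<close> in the \<open>u a\<close>, the sum over
  \<open>i\<close> is taken first; the expansion of \<open>u a\<close> in the \<open>f i\<close>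
  shows that it equals \<open>h (u a) (u b)\<close>.\<close>

lemma trace_orthonormal:
  fixes h :: "'e::real_vector \<Rightarrow> 'e \<Rightarrow> real" and S :: "'e \<Rightarrow> 'e \<Rightarrow> 'f::real_vector"
  assumes h: "bilinear h" and sym: "\<And>v w. h v w = h w v" and S: "bilinear S"
    and u: "orthonormal h k u" "span (u ` {..<k}) = UNIV"
    and f: "orthonormal h l f" "span (f ` {..<l}) = UNIV"
  shows "(\<Sum>i<l. S (f i) (f i)) = (\<Sum>a<k. S (u a) (u a))"
proof -
  have "S (f i) (f i) = (\<Sum>a<k. \<Sum>b<k. (h (f i) (u a) * h (f i) (u b)) *\<^sub>R S (u a) (u b))" for i
  proof -
    have e: "f i = (\<Sum>a<k. h (f i) (u a) *\<^sub>R u a)"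
      by (rule orthonormal_expansion[OF h u(1)]) (simp add: u)
    have l: "S (f i) w = (\<Sum>a<k. h (f i) (u a) *\<^sub>R S (u a) w)" for w
      using arg_cong[OF e, of "\<lambda>x. S x w"] by (simp add: bilinear_sum_left[OF S] bilinear_lmul[OF S])
    have r: "S w (f i) = (\<Sum>a<k. h (f i) (u a) *\<^sub>R S w (u a))" for w
      using arg_cong[OF e, of "S w"] by (simp add: bilinear_sum_right[OF S] bilinear_rmul[OF S])
    show ?thesis by (subst l) (simp add: r scaleR_sum_right)
  qed
  then have "(\<Sum>i<l. S (f i) (f i)) =
      (\<Sum>i<l. \<Sum>a<k. \<Sum>b<k. (h (f i) (u a) * h (f i) (u b)) *\<^sub>R S (u a) (u b))" by simp
  also have "\<dots> = (\<Sum>a<k. \<Sum>b<k. (\<Sum>i<l. h (f i) (u a) * h (f i) (u b)) *\<^sub>R S (u a) (u b))"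
    by (subst sum.swap, rule sum.cong[OF refl], subst sum.swap) (simp add: scaleR_left.sum)
  also have "\<dots> = (\<Sum>a<k. \<Sum>b<k. (if a = b then S (u a) (u b) else 0))"
  proof (intro sum.cong refl)
    fix a b assume ab: "a \<in> {..<k}" "b \<in> {..<k}"
    have "u a = (\<Sum>i<l. h (u a) (f i) *\<^sub>R f i)"
      by (rule orthonormal_expansion[OF h f(1)]) (simp add: f)
    then have "h (u a) (u b) = h (\<Sum>i<l. h (u a) (f i) *\<^sub>R f i) (u b)" by simp
    then have "(\<Sum>i<l. h (f i) (u a) * h (f i) (u b)) = h (u a) (u b)"
      by (simp add: bilinear_sum_left[OF h] bilinear_lmul[OF h] sym[of "u a"])
    then show "(\<Sum>i<l. h (f i) (u a) * h (f i) (u b)) *\<^sub>R S (u a) (u b) = (if a = b then S (u a) (u b) else 0)"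
      using orthonormalD[OF u(1), of a b] ab by simp
  qed
  also have "\<dots> = (\<Sum>a<k. S (u a) (u a))" by (simp add: sum.delta)
  finally show ?thesis .
qed

text \<open>A linear right inverse splits the domain into the kernel and a copy of the
  target.\<close>

lemma dim_kernel_surj:
  fixes f :: "'e::euclidean_space \<Rightarrow> 'f::euclidean_space"
  assumes f: "linear f" "surj f"
  shows "dim {v. f v = 0} = DIM('e) - DIM('f)"
proof -
  obtain r where r: "linear r" "\<And>y. f (r y) = y"
    using linear_surj_right_inverse[OF f(1), of UNIV UNIV] f(2) by (auto simp: o_def fun_eq_iff)
  have K: "subspace {v. f v = 0}" using linear_subspace_kernel[OF f(1)] by simp
  have R: "subspace (range r)" using linear_subspace_image[OF r(1) subspace_UNIV] .
  have "inj r" using r(2) by (metis injI)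
  then have "dim (range r) = DIM('f)" using dim_image_eq[OF r(1), of UNIV] by simp
  moreover have "{v. f v = 0} \<inter> range r = {0}" using r linear_0[OF r(1)] by (auto simp: image_iff) metis
  moreover have "{x + y |x y. x \<in> {v. f v = 0} \<and> y \<in> range r} = UNIV"
  proof -
    have "v = (v - r (f v)) + r (f v) \<and> f (v - r (f v)) = 0" for v
      using r f by (simp add: linear_diff)
    then show ?thesis by blast
  qed
  ultimately show ?thesis using dim_sums_Int[OF K R] by simp
qed

section \<open>Gram-Schmidt for smooth fields\<close>

context manifold begin

text \<open>Positivity is asked at \<open>p\<close> only; the neighbourhood shrinks at each stage to
  where the remainder keeps positive square. In this form the lemma covers both the metric and a
  degenerate form that is definite at \<open>p\<close> on the span of the given fields.\<close>

lemma gram_schmidt: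
  fixes h :: "'a \<Rightarrow> 'e \<Rightarrow> 'e \<Rightarrow> real" and X :: "nat \<Rightarrow> 'a \<Rightarrow> 'e"
  assumes U0: "open U0" "p \<in> U0"
    and h: "\<And>q. q \<in> U0 \<Longrightarrow> bilinear (h q)" and sym: "\<And>q v w. h q v w = h q w v"
    and smooth: "\<And>U X Y. U \<subseteq> U0 \<Longrightarrow> vector_field_on A U X \<Longrightarrow> vector_field_on A U Y \<Longrightarrow>
      smooth_fun_on A U (\<lambda>q. h q (X q) (Y q))"
    and X: "\<And>i. i < k \<Longrightarrow> vector_field_on A U0 (X i)"
    and indep: "\<And>i. i < k \<Longrightarrow> X i p \<notin> span ((\<lambda>j. X j p) ` {..<i})"
    and pos: "\<And>v. v \<in> span ((\<lambda>j. X j p) ` {..<k}) \<Longrightarrow> v \<noteq> 0 \<Longrightarrow> h p v v > 0"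
  shows "\<exists>U e. open U \<and> p \<in> U \<and> U \<subseteq> U0 \<and> (\<forall>i<k. vector_field_on A U (e i)) \<and>
    (\<forall>q\<in>U. orthonormal (h q) k (\<lambda>i. e i q) \<and> (\<forall>i<k. e i q \<in> span ((\<lambda>j. X j q) ` {..<k})))"
  using X indep pos
proof (induction k)
  case 0
  show ?case using U0 by (auto simp: orthonormal_def)
next
  case (Suc k)
  have sub: "span ((\<lambda>j. X j q) ` {..<k}) \<subseteq> span ((\<lambda>j. X j q) ` {..<Suc k})" for q
    by (intro span_mono image_mono) auto
  have "\<exists>U e. open U \<and> p \<in> U \<and> U \<subseteq> U0 \<and> (\<forall>i<k. vector_field_on A U (e i)) \<and>
    (\<forall>q\<in>U. orthonormal (h q) k (\<lambda>i. e i q) \<and> (\<forall>i<k. e i q \<in> span ((\<lambda>j. X j q) ` {..<k})))"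
  proof (rule Suc.IH)
    fix i assume "i < k"
    then show "vector_field_on A U0 (X i)" "X i p \<notin> span ((\<lambda>j. X j p) ` {..<i})"
      using Suc.prems(1,2)[of i] by simp_all
  next
    fix v assume "v \<in> span ((\<lambda>j. X j p) ` {..<k})" "v \<noteq> 0"
    then show "h p v v > 0" using Suc.prems(3)[of v] sub[of p] by blast
  qed
  then obtain U e where U: "open U" "p \<in> U" "U \<subseteq> U0" and e: "\<And>i. i < k \<Longrightarrow> vector_field_on A U (e i)"
    and ortho: "\<And>q. q \<in> U \<Longrightarrow> orthonormal (h q) k (\<lambda>i. e i q)"
    and span: "\<And>q i. q \<in> U \<Longrightarrow> i < k \<Longrightarrow> e i q \<in> span ((\<lambda>j. X j q) ` {..<k})"
    by blast
  have XU: "vector_field_on A U (X k)" using triv.field_along_subset[OF Suc.prems(1) U(1,3)] by simp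
  define P where "P q = (\<Sum>i<k. h q (X k q) (e i q) *\<^sub>R e i q)" for q
  \<comment> \<open>The part of \<open>X k\<close> orthogonal to the earlier fields, written as a
    sum with factor -1 so that the closure lemmas for sums and multiples apply.\<close>
  define R where "R q = X k q + (-1) *\<^sub>R P q" for q
  have P: "vector_field_on A U P"
    unfolding P_def
    by (intro triv.field_along_sum[OF U(1)] triv.field_along_scaleR smooth XU U(3) e) auto
  have R: "vector_field_on A U R"
    unfolding R_def
    by (intro triv.field_along_add triv.field_along_scaleR smooth_fun_on_const U XU P)
  have Pspan: "P q \<in> span ((\<lambda>j. X j q) ` {..<k})" if "q \<in> U" for q
    unfolding P_def using span[OF that] by (auto intro!: span_sum span_scale)
  have Rspan: "R q \<in> span ((\<lambda>j. X j q) ` {..<Suc k})" if "q \<in> U" for q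
    unfolding R_def using Pspan[OF that] sub[of q]
    by (intro span_add span_scale) (auto intro: span_base)
  have "R p \<noteq> 0"
    using Suc.prems(2)[of k] Pspan[OF U(2)] by (auto simp: R_def)
  then have Rp: "h p (R p) (R p) > 0" using Suc.prems(3) Rspan U(2) by blast
  have hR: "smooth_fun_on A U (\<lambda>q. h q (R q) (R q))" by (rule smooth[OF U(3) R R])
  define V where "V = U \<inter> (\<lambda>q. h q (R q) (R q)) -` {0<..}"
  have V: "open V" "V \<subseteq> U" "p \<in> V"
    using continuous_open_preimage[OF smooth_fun_on_imp_continuous_on[OF hR] U(1), of "{0<..}"] U Rp
    by (auto simp: V_def)
  \<comment> \<open>The inverse length of \<open>R\<close>; it is smooth because real powers are
    smooth on the positive reals.\<close>
  define c where "c q = h q (R q) (R q) powr (-1/2)" for q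
  have c: "smooth_fun_on A V c"
    unfolding c_def
    by (rule smooth_fun_on_powr[OF smooth_fun_on_subset[OF hR V(1,2)]]) (auto simp: V_def)
  have c2: "c q * c q * h q (R q) (R q) = 1" if "q \<in> V" for q
  proof -
    define x where "x = h q (R q) (R q)"
    have "x > 0" using that by (simp add: x_def V_def)
    moreover have "x powr (-1/2) * x powr (-1/2) = x powr (-1)"
      using powr_add[of x "-1/2" "-1/2"] by simp
    ultimately show ?thesis unfolding c_def x_def[symmetric] by (simp add: powr_neg_one)
  qed
  define e' where "e' i = (if i < k then e i else (\<lambda>q. c q *\<^sub>R R q))" for i
  have RV: "vector_field_on A V R" using triv.field_along_subset[OF R V(1,2)] .
  have "vector_field_on A V (e' i)" for i
    using triv.field_along_subset[OF e V(1,2)] triv.field_along_scaleR[OF c RV] by (auto simp: e'_def)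
  moreover have "orthonormal (h q) (Suc k) (\<lambda>i. e' i q)" if q: "q \<in> V" for q
  proof -
    have qU: "q \<in> U" using V q by auto
    have b: "bilinear (h q)" using h qU U by auto
    have Re: "h q (R q) (e j q) = 0" if j: "j < k" for j
    proof -
      have "h q (P q) (e j q) = (\<Sum>i<k. if i = j then h q (X k q) (e i q) else 0)"
        unfolding P_def bilinear_sum_left[OF b] using j orthonormalD[OF ortho[OF qU]]
        by (intro sum.cong) (auto simp: bilinear_lmul[OF b])
      then show ?thesis
        using j by (simp add: R_def bilinear_ladd[OF b] bilinear_lmul[OF b] bilinear_lneg[OF b] bilinear_lsub[OF b])
    qed
    show ?thesis
      unfolding orthonormal_def
    proof (intro allI impI)
      fix i j assume ij: "i < Suc k" "j < Suc k"
      show "h q (e' i q) (e' j q) = (if i = j then 1 else 0)"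
      proof (cases "i < k"; cases "j < k")
        assume "i < k" "j < k"
        then show ?thesis using orthonormalD[OF ortho[OF qU]] by (simp add: e'_def)
      next
        assume "i < k" "\<not> j < k"
        then show ?thesis using Re[of i] by (simp add: e'_def bilinear_rmul[OF b] sym[of q "e i q"])
      next
        assume "\<not> i < k" "j < k"
        then show ?thesis using Re[of j] by (simp add: e'_def bilinear_lmul[OF b])
      next
        assume "\<not> i < k" "\<not> j < k"
        then show ?thesis
          using c2[OF q] ij by (simp add: e'_def bilinear_lmul[OF b] bilinear_rmul[OF b] mult.assoc)
      qed
    qed
  qed
  moreover have "e' i q \<in> span ((\<lambda>j. X j q) ` {..<Suc k})" if "q \<in> V" for i q
    using that V span[of q i] sub[of q] Rspan[of q] by (auto simp: e'_def intro!: span_scale)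
  ultimately show ?case using V U by (intro exI[of _ V] exI[of _ e']) auto
qed

end

text \<open>Gram-Schmidt wants a basis as a sequence in which no member depends on its
  predecessors.\<close>

lemma independent_enumeration:
  fixes S :: "'e::euclidean_space set"
  assumes "independent S"
  obtains b where "b ` {..<card S} = S" "\<And>i. i < card S \<Longrightarrow> b i \<notin> span (b ` {..<i})"
proof -
  have "finite S" using assms independent_imp_finite by blast
  then obtain b where b: "bij_betw b {..<card S} S"
    using ex_bij_betw_nat_finite[of S] by (auto simp: lessThan_atLeast0)
  show thesis
  proof
    show "b ` {..<card S} = S" using b by (simp add: bij_betw_def)
    fix i assume i: "i < card S"
    have "b ` {..<i} \<subseteq> S - {b i}"
      using b i by (auto simp: bij_betw_def dest!: inj_onD)
    then have "span (b ` {..<i}) \<subseteq> span (S - {b i})" by (rule span_mono)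
    moreover have "b i \<in> S" using b i by (auto simp: bij_betw_def)
    ultimately show "b i \<notin> span (b ` {..<i})" using assms unfolding dependent_def by blast
  qed
qed

section \<open>Local frames of a submersion\<close>

locale submersion = manifold_map A B F + M: riemannian_manifold A gM
  for A :: "('a::{t2_space, second_countable_topology}, 'e::euclidean_space) chart set"
    and gM :: "'a \<Rightarrow> 'e \<Rightarrow> 'e \<Rightarrow> real"
    and B :: "('b::{t2_space, second_countable_topology}, 'f::euclidean_space) chart set"
    and F :: "'a \<Rightarrow> 'b" +
  assumes surj_tangent_map: "\<And>p. surj (tangent_map A B F p)"
begin

lemma subspace_vertical: "subspace (vertical A B F q)"
  unfolding vertical_def using linear_subspace_kernel[OF linear_tangent_map] by simp

lemma dim_vertical: "dim (vertical A B F q) = DIM('e) - DIM('f)"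
  unfolding vertical_def by (rule dim_kernel_surj[OF linear_tangent_map surj_tangent_map])

text \<open>Gram-Schmidt is run for the Euclidean product pulled back by \<open>L q\<close>, which
  degenerates on the kernel but is definite at \<open>p\<close> on a complement. As the images
  \<open>L q (e i q)\<close> are Euclidean orthonormal, sending \<open>y\<close> to the combination
  of the \<open>e i q\<close> with coefficients \<open>y \<bullet> L q (e i q)\<close> is a smooth
  right inverse of \<open>L q\<close>. The fields are lifts in this sense, not in that of the metric
  \<open>gM\<close>.\<close>

lemma local_horizontal_lift_frame:
  assumes d: "d \<in> B" "F p \<in> cdom d"
  defines "L \<equiv> \<lambda>q v. tcoord B d (F q) (tangent_map A B F q v)"
  obtains U e where "open U" "p \<in> U" "U \<subseteq> F -` cdom d" "\<And>i. i < DIM('f) \<Longrightarrow> vector_field_on A U (e i)"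
    "\<And>q y. q \<in> U \<Longrightarrow> y = (\<Sum>i<DIM('f). (y \<bullet> L q (e i q)) *\<^sub>R L q (e i q))"
proof -
  define c where "c = chart_at A p"
  have c: "c \<in> A" "p \<in> cdom c" by (simp_all add: c_def chart_at_A)
  define U0 where "U0 = cdom c \<inter> F -` cdom d"
  have U0: "open U0" "p \<in> U0"
    using open_vimage_F[OF is_chartD(1)[OF chB[OF d(1)]]] is_chartD(1)[OF chA[OF c(1)]] c d
    by (auto simp: U0_def)
  have L: "linear (L q)" if "q \<in> U0" for q
    unfolding L_def using linear_compose[OF linear_tangent_map[of q] cod.linear_tcoord[OF d(1), of "F q"]] that
    by (simp add: o_def U0_def)
  have bil: "bilinear (\<lambda>v w. L q v \<bullet> L q w)" if "q \<in> U0" for q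
    unfolding bilinear_def using L[OF that]
    by (auto intro!: linearI simp: linear_add linear_cmul inner_add_left inner_add_right)
  have "surj (L p)"
  proof (rule surjI)
    fix y
    show "L p (inv (tangent_map A B F p) (cod.coord_field d y (F p))) = y"
      unfolding L_def by (simp add: surj_f_inv_f[OF surj_tangent_map] cod.tcoord_coord_field_self[OF d])
  qed
  then obtain r where r: "linear r" "\<And>y. L p (r y) = y"
    using linear_surj_right_inverse[OF L[OF U0(2)], of UNIV UNIV] by (auto simp: o_def fun_eq_iff)
  obtain b :: "nat \<Rightarrow> 'f" where b: "b ` {..<DIM('f)} = Basis" "\<And>i. i < DIM('f) \<Longrightarrow> b i \<notin> span (b ` {..<i})"
    using independent_enumeration[OF independent_Basis] by blast
  \<comment> \<open>The coordinate field whose value at \<open>p\<close> is the lift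
    \<open>r (b i)\<close>.\<close>
  define X where "X i = dom.coord_field c (tcoord A c p (r (b i)))" for i
  have Xp: "X i p = r (b i)" for i by (simp add: X_def dom.coord_field_tcoord[OF c])
  have Xs: "span ((\<lambda>j. X j p) ` {..<i}) = r ` span (b ` {..<i})" for i
    by (simp add: Xp span_linear_image[OF r(1), symmetric] image_image)
  have X: "vector_field_on A U0 (X i)" for i
    unfolding X_def
    by (rule dom.triv.field_along_subset[OF dom.vector_field_coord_field[OF c(1)] U0(1)]) (simp add: U0_def)
  have "\<exists>U e. open U \<and> p \<in> U \<and> U \<subseteq> U0 \<and> (\<forall>i<DIM('f). vector_field_on A U (e i)) \<and>
    (\<forall>q\<in>U. orthonormal (\<lambda>v w. L q v \<bullet> L q w) DIM('f) (\<lambda>i. e i q) \<and>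
      (\<forall>i<DIM('f). e i q \<in> span ((\<lambda>j. X j q) ` {..<DIM('f)})))"
  proof (rule dom.gram_schmidt[OF U0 bil _ _ X])
    fix U Y Z assume U: "U \<subseteq> U0" and Y: "vector_field_on A U Y" and Z: "vector_field_on A U Z"
    have "U \<inter> F -` cdom d = U" using U by (auto simp: U0_def)
    then show "smooth_fun_on A U (\<lambda>q. L q (Y q) \<bullet> L q (Z q))"
      unfolding L_def
      using smooth_fun_on_inner_tcoord[OF field_along_tangent_map[OF Y] field_along_tangent_map[OF Z] d(1)]
      by simp
  next
    fix i assume "i < DIM('f)"
    then show "X i p \<notin> span ((\<lambda>j. X j p) ` {..<i})"
      unfolding Xs using b(2)[of i] r(2) Xp by (metis imageE)
  next
    fix v assume "v \<in> span ((\<lambda>j. X j p) ` {..<DIM('f)})" "v \<noteq> 0"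
    then show "L p v \<bullet> L p v > 0"
      unfolding Xs using r linear_0[OF r(1)] by auto
  qed (simp_all add: inner_commute)
  then obtain U e where U: "open U" "p \<in> U" "U \<subseteq> U0" and e: "\<And>i. i < DIM('f) \<Longrightarrow> vector_field_on A U (e i)"
    and o: "\<And>q. q \<in> U \<Longrightarrow> orthonormal (\<lambda>v w. L q v \<bullet> L q w) DIM('f) (\<lambda>i. e i q)" by blast
  have inner: "bilinear ((\<bullet>) :: 'f \<Rightarrow> 'f \<Rightarrow> real)"
    by (simp add: bilinear_def linear_iff inner_add_left inner_add_right)
  show thesis
  proof (rule that[OF U(1,2) _ e])
    show "U \<subseteq> F -` cdom d" using U(3) by (auto simp: U0_def)
    fix q and y :: 'f assume q: "q \<in> U"
    have on: "orthonormal (\<bullet>) DIM('f) (\<lambda>i. L q (e i q))"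
      using o[OF q] by (simp add: orthonormal_def)
    show "y = (\<Sum>i<DIM('f). (y \<bullet> L q (e i q)) *\<^sub>R L q (e i q))"
      by (rule orthonormal_expansion[OF inner on])
        (simp add: orthonormal_span_eq[OF inner on subspace_UNIV])
  qed
qed

text \<open>Coordinate fields through a basis of the kernel at \<open>p\<close> become vertical when
  a smooth lift of their image is subtracted. At \<open>p\<close> nothing is subtracted, so
  independence there survives, and after Gram-Schmidt a dimension count shows that the fields span
  each nearby kernel.\<close>

lemma local_vertical_frame:
  obtains U k e where "p \<in> U" "orthonormal_frame_on A gM (vertical A B F) U k e"
proof -
  define k where "k = DIM('e) - DIM('f)"
  define c where "c = chart_at A p"
  define d where "d = chart_at B (F p)"
  have c: "c \<in> A" "p \<in> cdom c" and d: "d \<in> B" "F p \<in> cdom d"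
    by (simp_all add: c_def d_def chart_at_A chart_at_B)
  define L where "L q v = tcoord B d (F q) (tangent_map A B F q v)" for q v
  obtain U0 f where U0: "open U0" "p \<in> U0" "U0 \<subseteq> F -` cdom d"
    and f: "\<And>i. i < DIM('f) \<Longrightarrow> vector_field_on A U0 (f i)"
    and exp: "\<And>q y. q \<in> U0 \<Longrightarrow> y = (\<Sum>i<DIM('f). (y \<bullet> L q (f i q)) *\<^sub>R L q (f i q))"
    by (rule local_horizontal_lift_frame[OF d, folded L_def], rule that)
  define U1 where "U1 = U0 \<inter> cdom c"
  have U1: "open U1" "p \<in> U1" "U1 \<subseteq> U0" "U1 \<subseteq> cdom c"
    using U0 c is_chartD(1)[OF chA[OF c(1)]] by (auto simp: U1_def)
  have f1: "vector_field_on A U1 (f i)" if "i < DIM('f)" for i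
    by (rule dom.triv.field_along_subset[OF f[OF that] U1(1,3)])
  have L: "linear (L q)" if "q \<in> U1" for q
    unfolding L_def using linear_compose[OF linear_tangent_map[of q] cod.linear_tcoord[OF d(1), of "F q"]] that U0 U1
    by (auto simp: o_def)
  obtain S where S: "S \<subseteq> vertical A B F p" "independent S" "vertical A B F p \<subseteq> span S" "card S = k"
    using basis_exists[of "vertical A B F p"] dim_vertical[of p] by (auto simp: k_def)
  obtain b where b: "b ` {..<k} = S" "\<And>i. i < k \<Longrightarrow> b i \<notin> span (b ` {..<i})"
    using independent_enumeration[OF S(2)] S(4) by metis
  define Y where "Y i = dom.coord_field c (tcoord A c p (b i))" for i
  have Y: "vector_field_on A U1 (Y i)" for i
    unfolding Y_def
    by (rule dom.triv.field_along_subset[OF dom.vector_field_coord_field[OF c(1)] U1(1,4)])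
  have Yp: "Y i p = b i" for i by (simp add: Y_def dom.coord_field_tcoord[OF c])
  define V where "V i q = Y i q + (-1) *\<^sub>R (\<Sum>j<DIM('f). (L q (Y i q) \<bullet> L q (f j q)) *\<^sub>R f j q)" for i q
  have "smooth_fun_on A U1 (\<lambda>q. L q (Y i q) \<bullet> L q (f j q))" if "j < DIM('f)" for i j
  proof -
    have "U1 \<inter> F -` cdom d = U1" using U0 U1 by auto
    then show ?thesis
      using smooth_fun_on_inner_tcoord[OF field_along_tangent_map[OF Y] field_along_tangent_map[OF f1[OF that]] d(1)]
      by (simp add: L_def)
  qed
  then have V: "vector_field_on A U1 (V i)" for i
    unfolding V_def
    by (intro dom.triv.field_along_add dom.triv.field_along_scaleR dom.triv.field_along_sum
        dom.smooth_fun_on_const U1 Y f1) auto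
  have Vver: "V i q \<in> vertical A B F q" if q: "q \<in> U1" for i q
  proof -
    note lin = L[OF q]
    have "L q (V i q) = 0"
      by (simp add: V_def linear_diff[OF lin] linear_sum[OF lin] linear_cmul[OF lin])
        (rule exp[OF subsetD[OF U1(3) q]])
    moreover have "tcoord B d (F q) 0 = 0"
      using linear_0[OF cod.linear_tcoord[OF d(1)]] q U0 U1 by auto
    ultimately show ?thesis
      using cod.tcoord_inject[OF d(1), of "F q" "tangent_map A B F q (V i q)" 0] q U0 U1
      by (auto simp: vertical_def L_def)
  qed
  have Vp: "V i p = b i" if "i < k" for i
  proof -
    have "tangent_map A B F p (b i) = 0" using S(1) b(1) that by (auto simp: vertical_def)
    then have "L p (b i) = 0" by (simp add: L_def linear_0[OF cod.linear_tcoord[OF d]])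
    then show ?thesis by (simp add: V_def Yp)
  qed
  have "\<exists>U e. open U \<and> p \<in> U \<and> U \<subseteq> U1 \<and> (\<forall>i<k. vector_field_on A U (e i)) \<and>
    (\<forall>q\<in>U. orthonormal (gM q) k (\<lambda>i. e i q) \<and> (\<forall>i<k. e i q \<in> span ((\<lambda>j. V j q) ` {..<k})))"
  proof (rule dom.gram_schmidt[OF U1(1,2) M.bilinear_g M.g_sym M.smooth_fun_on_g V _ M.g_pos])
    fix i assume i: "i < k"
    have "(\<lambda>j. V j p) ` {..<i} = b ` {..<i}" using i by (intro image_cong) (auto simp: Vp)
    then show "V i p \<notin> span ((\<lambda>j. V j p) ` {..<i})" using b(2)[OF i] by (simp add: Vp[OF i])
  qed
  then obtain U e where U: "open U" "p \<in> U" "U \<subseteq> U1" and e: "\<And>i. i < k \<Longrightarrow> vector_field_on A U (e i)"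
    and o: "\<And>q. q \<in> U \<Longrightarrow> orthonormal (gM q) k (\<lambda>i. e i q)"
    and s: "\<And>q i. q \<in> U \<Longrightarrow> i < k \<Longrightarrow> e i q \<in> span ((\<lambda>j. V j q) ` {..<k})" by blast
  have "span ((\<lambda>i. e i q) ` {..<k}) = vertical A B F q" if q: "q \<in> U" for q
  proof (rule orthonormal_span_eq[OF M.bilinear_g o[OF q] subspace_vertical])
    have "span ((\<lambda>j. V j q) ` {..<k}) \<subseteq> vertical A B F q"
      by (rule span_minimal[OF _ subspace_vertical]) (use Vver q U in auto)
    then show "(\<lambda>i. e i q) ` {..<k} \<subseteq> vertical A B F q" using s[OF q] by auto
  qed (simp add: dim_vertical k_def)
  then have "orthonormal_frame_on A gM (vertical A B F) U k e"
    using U e o by (simp add: orthonormal_frame_on_def orthonormal_def)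
  then show thesis using that U(2) by blast
qed

end

section \<open>Riemannian submersions\<close>

text \<open>Two candidates differ by a vector of \<open>S\<close> that is orthogonal to itself, so
  positivity makes the definite description meaningful.\<close>

lemma orth_proj_eqI:
  fixes h :: "'e::real_vector \<Rightarrow> 'e \<Rightarrow> real"
  assumes h: "bilinear h" and pos: "\<And>v. v \<noteq> 0 \<Longrightarrow> h v v > 0" and S: "subspace S"
    and u: "u \<in> S" "\<And>s. s \<in> S \<Longrightarrow> h (v - u) s = 0"
  shows "orth_proj h S v = u"
  unfolding orth_proj_def
proof (rule the_equality)
  fix w assume w: "w \<in> S \<and> (\<forall>s\<in>S. h (v - w) s = 0)"
  then have "u - w \<in> S" using u(1) S by (simp add: subspace_diff)
  then have "h (v - w) (u - w) = 0" "h (v - u) (u - w) = 0" using w u(2) by auto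
  then have "h (u - w) (u - w) = 0" by (simp add: bilinear_lsub[OF h])
  then show "w = u" using pos[of "u - w"] by (cases "u - w = 0") auto
qed (use u in auto)

lemma sum_lessThan_add:
  fixes f :: "nat \<Rightarrow> 'a::comm_monoid_add"
  shows "(\<Sum>i<k + m. f i) = (\<Sum>i<k. f i) + (\<Sum>i<m. f (k + i))"
  by (induction m) (simp_all add: add.assoc)

context submersion begin

lemma verticalD: "v \<in> vertical A B F p \<Longrightarrow> tangent_map A B F p v = 0"
  by (simp add: vertical_def)

lemma horizontalD: "h \<in> horizontal A gM B F p \<Longrightarrow> v \<in> vertical A B F p \<Longrightarrow> gM p h v = 0"
  by (simp add: horizontal_def)

lemma horizontalD': "h \<in> horizontal A gM B F p \<Longrightarrow> v \<in> vertical A B F p \<Longrightarrow> gM p v h = 0"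
  using horizontalD M.g_sym by metis

lemma subspace_horizontal: "subspace (horizontal A gM B F p)"
  by (simp add: subspace_def horizontal_def M.g_linear_simps)

lemma orthonormal_frameD:
  assumes "orthonormal_frame_on A gM S U k e"
  shows "open U" "\<And>i. i < k \<Longrightarrow> vector_field_on A U (e i)"
    "\<And>q. q \<in> U \<Longrightarrow> orthonormal (gM q) k (\<lambda>i. e i q)"
    "\<And>q. q \<in> U \<Longrightarrow> span ((\<lambda>i. e i q) ` {..<k}) = S q"
    "\<And>q i. q \<in> U \<Longrightarrow> i < k \<Longrightarrow> e i q \<in> S q"
proof -
  show *: "open U" "\<And>i. i < k \<Longrightarrow> vector_field_on A U (e i)"
    "\<And>q. q \<in> U \<Longrightarrow> orthonormal (gM q) k (\<lambda>i. e i q)"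
    "\<And>q. q \<in> U \<Longrightarrow> span ((\<lambda>i. e i q) ` {..<k}) = S q"
    using assms by (auto simp: orthonormal_frame_on_def orthonormal_def)
  show "\<And>q i. q \<in> U \<Longrightarrow> i < k \<Longrightarrow> e i q \<in> S q"
    using *(4) by (metis image_eqI lessThan_iff span_base)
qed

text \<open>A local vertical frame supplies an orthonormal basis of the kernel, and the vertical
  part is read off from it.\<close>

lemma vertical_horizontal_decomposition:
  obtains v h where "v \<in> vertical A B F p" "h \<in> horizontal A gM B F p" "w = v + h"
proof -
  obtain U k e where p: "p \<in> U" and e: "orthonormal_frame_on A gM (vertical A B F) U k e"
    by (rule local_vertical_frame)
  note on = orthonormal_frameD(3)[OF e p] and sp = orthonormal_frameD(4)[OF e p]
  define v where "v = (\<Sum>i<k. gM p w (e i p) *\<^sub>R e i p)"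
  have v: "v \<in> vertical A B F p"
    unfolding v_def sp[symmetric] by (intro span_sum span_scale span_base) auto
  have "gM p (w - v) x = 0" if x: "x \<in> vertical A B F p" for x
  proof -
    have "x = (\<Sum>i<k. gM p x (e i p) *\<^sub>R e i p)"
      by (rule orthonormal_expansion[OF M.bilinear_g on]) (simp add: sp x)
    then have "gM p w x = gM p w (\<Sum>i<k. gM p x (e i p) *\<^sub>R e i p)" by simp
    also have "\<dots> = gM p v x"
      by (simp add: v_def M.g_sum_left M.g_sum_right M.g_linear_simps M.g_sym[of p x] mult.commute)
    finally show ?thesis by (simp add: M.g_linear_simps)
  qed
  then have "w - v \<in> horizontal A gM B F p" by (simp add: horizontal_def)
  with v show thesis using that[of v "w - v"] by simp
qed

lemma ver_proj_vertical: "v \<in> vertical A B F p \<Longrightarrow> ver_proj A gM B F p v = v"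
  by (rule orth_proj_eqI[OF M.bilinear_g M.g_pos subspace_vertical]) (simp_all add: M.g_linear_simps)

lemma hor_proj_add:
  "v \<in> vertical A B F p \<Longrightarrow> h \<in> horizontal A gM B F p \<Longrightarrow> hor_proj A gM B F p (v + h) = h"
  by (rule orth_proj_eqI[OF M.bilinear_g M.g_pos subspace_horizontal]) (simp_all add: horizontalD')

lemma hor_proj_vertical: "v \<in> vertical A B F p \<Longrightarrow> hor_proj A gM B F p v = 0"
  using hor_proj_add[of v p 0] subspace_horizontal subspace_0 by fastforce

end

section \<open>The trace of the second fundamental form of a Riemannian submersion\<close>

locale riemannian_submersion_map = riemannian_map A gM B gN F DM DN DF
  for A :: "('a::{t2_space, second_countable_topology}, 'e::euclidean_space) chart set"
    and gM :: "'a \<Rightarrow> 'e \<Rightarrow> 'e \<Rightarrow> real"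
    and B :: "('b::{t2_space, second_countable_topology}, 'f::euclidean_space) chart set"
    and gN :: "'b \<Rightarrow> 'f \<Rightarrow> 'f \<Rightarrow> real"
    and F :: "'a \<Rightarrow> 'b" and DM and DN and DF +
  assumes rs: "riemannian_submersion A gM B gN F"

sublocale riemannian_submersion_map \<subseteq> submersion A gM B F
  by unfold_locales (use rs in \<open>simp add: riemannian_submersion_def\<close>)

context riemannian_submersion_map begin

abbreviation T :: "'a \<Rightarrow> 'e \<Rightarrow> 'f" where "T \<equiv> tangent_map A B F"

lemmas T_add = linear_add[OF linear_tangent_map]
lemmas T_diff = linear_diff[OF linear_tangent_map]
lemmas T_sum = linear_sum[OF linear_tangent_map]

lemma gN_T_self: "h \<in> horizontal A gM B F p \<Longrightarrow> gN (F p) (T p h) (T p h) = gM p h h"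
  using rs unfolding riemannian_submersion_def by auto

text \<open>Polarisation of the isometry on horizontal vectors; the vertical part of
  \<open>w\<close> contributes nothing to either side.\<close>

lemma gN_T:
  assumes h: "h \<in> horizontal A gM B F p"
  shows "gN (F p) (T p w) (T p h) = gM p w h"
proof -
  obtain v h' where vh: "v \<in> vertical A B F p" "h' \<in> horizontal A gM B F p" "w = v + h'"
    by (rule vertical_horizontal_decomposition)
  have "h' + h \<in> horizontal A gM B F p" using h vh(2) subspace_horizontal by (simp add: subspace_add)
  from gN_T_self[OF this] have "gN (F p) (T p h') (T p h) = gM p h' h"
    using gN_T_self[OF h] gN_T_self[OF vh(2)] N.g_sym[of "F p" "T p h" "T p h'"] M.g_sym[of p h h']
    by (simp add: T_add N.g_linear_simps M.g_linear_simps)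
  then show ?thesis
    using vh h by (simp add: T_add verticalD M.g_linear_simps horizontalD')
qed

text \<open>The image of \<open>X\<close> is zero on \<open>U\<close>, so its pullback derivative
  vanishes and the other term remains.\<close>

lemma sff_vertical:
  assumes "vector_field_on A U X" "\<And>q. q \<in> U \<Longrightarrow> X q \<in> vertical A B F q" "p \<in> U"
  shows "sff X p v = - T p (DM X p v)"
  using DF.D_zero[OF field_along_onD_open[OF assms(1)] assms(3), of "\<lambda>q. T q (X q)"] assms(2)
  by (simp add: sff_def verticalD)

text \<open>
  The trilinear form \<open>gN (sff H\<^sub>j H\<^sub>i) (T H\<^sub>l)\<close> is symmetric in \<open>i, j\<close> and skew in \<open>j, l\<close>, hence zero.
\<close>

lemma sff_horizontal:
  assumes H: "\<And>i. i < m \<Longrightarrow> vector_field_on A U (H i)"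
    and on: "\<And>q. q \<in> U \<Longrightarrow> orthonormal (gM q) m (\<lambda>i. H i q)"
    and hor: "\<And>q i. q \<in> U \<Longrightarrow> i < m \<Longrightarrow> H i q \<in> horizontal A gM B F q"
    and span: "horizontal A gM B F p \<subseteq> span ((\<lambda>i. H i p) ` {..<m})"
    and p: "p \<in> U" and ij: "i < m" "j < m"
  shows "sff (H j) p (H i p) = 0"
proof -
  define C where "C i j l = gN (F p) (sff (H j) p (H i p)) (T p (H l p))" for i j l
  have sym: "C i j l = C j i l" if "i < m" "j < m" for i j l
    using sff_symmetric[OF H H p] that by (simp add: C_def)
  have skew: "C i j l = - C i l j" if ijl: "i < m" "j < m" "l < m" for i j l
  proof -
    let ?v = "H i p"
    have U: "open U" using field_along_onD_open[OF H[OF ij(1)]] .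
    have TH: "field_along U (\<lambda>q. T q (H j q))" if "j < m" for j
      by (rule field_along_tangent_map[OF H[OF that]])
    \<comment> \<open>Both inner products are constant on \<open>U\<close>, so both product rules
      give zero; their difference is the skewness.\<close>
    have cM: "gM q (H j q) (H l q) = (if j = l then 1 else 0)" if "q \<in> U" for q
      using orthonormalD[OF on[OF that] ijl(2,3)] by simp
    have cN: "gN (F q) (T q (H j q)) (T q (H l q)) = (if j = l then 1 else 0)" if "q \<in> U" for q
      using gN_T[OF hor[OF that ijl(3)]] cM[OF that] by simp
    have "gM p (DM (H j) p ?v) (H l p) + gM p (H j p) (DM (H l) p ?v) = 0"
      unfolding metric_M[OF H[OF ijl(2)] H[OF ijl(3)] p, symmetric]
      by (subst dom.dfun_cong[OF U p cM]) (simp_all add: dom.dfun_const)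
    moreover have "gN (F p) (DF (\<lambda>q. T q (H j q)) p ?v) (T p (H l p)) +
        gN (F p) (T p (H j p)) (DF (\<lambda>q. T q (H l q)) p ?v) = 0"
      unfolding metric_F[OF TH[OF ijl(2)] TH[OF ijl(3)] p, symmetric]
      by (subst dom.dfun_cong[OF U p cN]) (simp_all add: dom.dfun_const)
    ultimately show ?thesis
      using gN_T[OF hor[OF p ijl(2)]] gN_T[OF hor[OF p ijl(3)]]
      by (simp add: C_def sff_def N.g_linear_simps N.g_sym[of "F p" "T p (H j p)" "DF (\<lambda>q. T q (H l q)) p ?v"]
          N.g_sym[of "F p" "T p (H j p)" "T p (DM (H l) p ?v)"] M.g_sym[of p "H j p" "DM (H l) p ?v"])
  qed
  \<comment> \<open>Alternating three swaps of each kind leads from \<open>C i j l\<close> back to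
    itself with sign -1.\<close>
  have C: "C i j l = 0" if l: "l < m" for l
    using sym[OF ij, of l] skew[OF ij l] sym[OF ij(1) l, of j] skew[OF l ij] sym[OF l ij(2), of i]
      skew[OF ij(2) l ij(1)] by linarith
  have "gN (F p) (sff (H j) p (H i p)) (T p h) = 0" if "h \<in> horizontal A gM B F p" for h
  proof -
    have h: "h = (\<Sum>l<m. gM p h (H l p) *\<^sub>R H l p)"
      by (rule orthonormal_expansion[OF M.bilinear_g on[OF p]]) (use span that in auto)
    show ?thesis
      by (subst h) (simp add: T_sum linear_cmul[OF linear_tangent_map] N.g_sum_right N.g_linear_simps
          C[unfolded C_def])
  qed
  \<comment> \<open>By surjectivity the value is itself the image of a horizontal vector, hence
    orthogonal to itself.\<close>
  moreover obtain w where w: "T p w = sff (H j) p (H i p)"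
    using surj_tangent_map[of p] by (metis surjD)
  moreover obtain v h where "v \<in> vertical A B F p" "h \<in> horizontal A gM B F p" "w = v + h"
    by (rule vertical_horizontal_decomposition)
  ultimately have "gN (F p) (sff (H j) p (H i p)) (sff (H j) p (H i p)) = 0"
    by (metis T_add verticalD add_0)
  then show ?thesis by (simp add: N.g_eq_0_iff)
qed

text \<open>\<open>sff\<close> takes a field in its first slot. The auxiliary \<open>S\<close>,
  built from the frame \<open>u\<close>, is the bilinear map it induces on vectors at
  \<open>p\<close>, to which the algebraic trace lemma applies.\<close>

lemma trace_sff_frame_independent:
  assumes u: "orthonormal_frame_on A gM (\<lambda>_. UNIV) U k u" "p \<in> U"
    and f: "orthonormal_frame_on A gM (\<lambda>_. UNIV) V l f" "p \<in> V"
  shows "(\<Sum>i<l. sff (f i) p (f i p)) = (\<Sum>a<k. sff (u a) p (u a p))"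
proof -
  note u' = orthonormal_frameD[OF u(1)] and f' = orthonormal_frameD[OF f(1)]
  define W where "W = U \<inter> V"
  have W: "open W" "p \<in> W" using u f u'(1) f'(1) by (auto simp: W_def)
  have uW: "vector_field_on A W (u a)" if "a < k" for a
    by (rule dom.triv.field_along_subset[OF u'(2)[OF that] W(1)]) (simp add: W_def)
  have fW: "vector_field_on A W (f i)" if "i < l" for i
    by (rule dom.triv.field_along_subset[OF f'(2)[OF that] W(1)]) (simp add: W_def)
  define S where "S v w = (\<Sum>a<k. gM p v (u a p) *\<^sub>R sff (u a) p w)" for v w
  have lin: "linear (sff (u a) p)" if "a < k" for a by (rule linear_sff[OF uW[OF that] W(2)])
  have S: "bilinear S"
    unfolding bilinear_def S_def
    by (auto intro!: linearI simp: M.g_linear_simps linear_add[OF lin] linear_cmul[OF lin]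
        scaleR_add_left scaleR_add_right sum.distrib scaleR_sum_right mult.commute)
  have Sf: "sff (f i) p v = S (f i p) v" if i: "i < l" for i v
    unfolding S_def
  proof (rule sff_expand[OF fW[OF i] uW _ _ W(2)])
    fix a assume "a \<in> {..<k}"
    then show "smooth_fun_on A W (\<lambda>q. gM q (f i q) (u a q))"
      by (intro M.smooth_fun_on_g fW uW i) auto
  next
    fix q assume q: "q \<in> W"
    show "f i q = (\<Sum>a<k. gM q (f i q) (u a q) *\<^sub>R u a q)"
      by (rule orthonormal_expansion[OF M.bilinear_g u'(3)]) (use q u'(4) in \<open>auto simp: W_def\<close>)
  qed simp
  have Su: "sff (u a) p v = S (u a p) v" if a: "a < k" for a v
  proof -
    have "S (u a p) v = (\<Sum>b<k. if b = a then sff (u b) p v else 0)"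
      unfolding S_def using a orthonormalD[OF u'(3)[OF u(2)]] by (intro sum.cong) auto
    then show ?thesis using a by simp
  qed
  have "(\<Sum>i<l. S (f i p) (f i p)) = (\<Sum>a<k. S (u a p) (u a p))"
    by (rule trace_orthonormal[OF M.bilinear_g M.g_sym S u'(3)[OF u(2)] u'(4)[OF u(2)] f'(3)[OF f(2)] f'(4)[OF f(2)]])
  then show ?thesis by (simp add: Sf Su)
qed

lemma adapted_frame:
  assumes e: "orthonormal_frame_on A gM (vertical A B F) U k e"
    and H: "orthonormal_frame_on A gM (horizontal A gM B F) U m H"
  shows "orthonormal_frame_on A gM (\<lambda>_. UNIV) U (k + m) (\<lambda>i. if i < k then e i else H (i - k))"
proof -
  note e' = orthonormal_frameD[OF e] and H' = orthonormal_frameD[OF H]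
  define u where "u i = (if i < k then e i else H (i - k))" for i
  have "orthonormal_frame_on A gM (\<lambda>_. UNIV) U (k + m) u"
    unfolding orthonormal_frame_on_def
  proof (intro conjI ballI allI impI)
    show "open U" by (rule e'(1))
    show "vector_field_on A U (u i)" if "i < k + m" for i
      using that e'(2) H'(2) by (auto simp: u_def)
    fix q assume q: "q \<in> U"
    show "gM q (u i q) (u j q) = (if i = j then 1 else 0)" if "i < k + m" "j < k + m" for i j
      using that orthonormalD[OF e'(3)[OF q], of i j] orthonormalD[OF H'(3)[OF q], of "i - k" "j - k"]
        horizontalD[OF H'(5)[OF q, of "i - k"] e'(5)[OF q, of j]]
        horizontalD'[OF H'(5)[OF q, of "j - k"] e'(5)[OF q, of i]]
      by (auto simp: u_def)
    have "e i q \<in> span ((\<lambda>i. u i q) ` {..<k + m})" if "i < k" for i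
      by (rule span_base, rule image_eqI[of _ _ i]) (use that in \<open>auto simp: u_def\<close>)
    then have eu: "vertical A B F q \<subseteq> span ((\<lambda>i. u i q) ` {..<k + m})"
      unfolding e'(4)[OF q, symmetric] by (intro span_minimal) auto
    have "H i q \<in> span ((\<lambda>i. u i q) ` {..<k + m})" if "i < m" for i
      by (rule span_base, rule image_eqI[of _ _ "k + i"]) (use that in \<open>auto simp: u_def\<close>)
    then have Hu: "horizontal A gM B F q \<subseteq> span ((\<lambda>i. u i q) ` {..<k + m})"
      unfolding H'(4)[OF q, symmetric] by (intro span_minimal) auto
    have "w \<in> span ((\<lambda>i. u i q) ` {..<k + m})" for w
    proof -
      obtain v h where "v \<in> vertical A B F q" "h \<in> horizontal A gM B F q" "w = v + h"
        by (rule vertical_horizontal_decomposition)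
      then show ?thesis using eu Hu by (auto intro: span_add)
    qed
    then show "span ((\<lambda>i. u i q) ` {..<k + m}) = UNIV" by blast
  qed
  then show ?thesis unfolding u_def .
qed

lemma trace_sff_eq:
  assumes e: "orthonormal_frame_on A gM (vertical A B F) U k e"
    and H: "orthonormal_frame_on A gM (horizontal A gM B F) U m H"
    and f: "orthonormal_frame_on A gM (\<lambda>_. UNIV) V l f" and p: "p \<in> U" "p \<in> V"
  shows "(\<Sum>i<l. sff (f i) p (f i p)) = - T p (\<Sum>i<k. DM (e i) p (e i p))"
proof -
  note e' = orthonormal_frameD[OF e] and H' = orthonormal_frameD[OF H]
  from trace_sff_frame_independent[OF adapted_frame[OF e H] p(1) f p(2)]
  have "(\<Sum>i<l. sff (f i) p (f i p)) = (\<Sum>i<k. sff (e i) p (e i p)) + (\<Sum>i<m. sff (H i) p (H i p))"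
    by (simp add: sum_lessThan_add)
  also have "(\<Sum>i<m. sff (H i) p (H i p)) = 0"
  proof (rule sum.neutral, rule ballI)
    fix i assume "i \<in> {..<m}"
    then show "sff (H i) p (H i p) = 0"
      using H' p(1) by (intro sff_horizontal[of m U H p i i]) auto
  qed
  also have "(\<Sum>i<k. sff (e i) p (e i p)) = (\<Sum>i<k. - T p (DM (e i) p (e i p)))"
  proof (rule sum.cong[OF refl])
    fix i assume "i \<in> {..<k}"
    then show "sff (e i) p (e i p) = - T p (DM (e i) p (e i p))"
      using e' p(1) by (intro sff_vertical[of U]) auto
  qed
  finally show ?thesis by (simp add: T_sum sum_negf)
qed

text \<open>The hypothesis asks for a horizontal frame over the very set \<open>U\<close> of a given
  vertical frame, which \<open>\<phi>\<close> and \<open>\<xi>\<close> will provide. Conversely, an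
  arbitrary frame of the whole tangent bundle is compared near each point with an adapted
  one.\<close>

lemma harmonic_iff:
  assumes H: "\<And>U k e. orthonormal_frame_on A gM (vertical A B F) U k e \<Longrightarrow>
      \<exists>m H. orthonormal_frame_on A gM (horizontal A gM B F) U m H"
  shows "harmonic A gM DM B F DF \<longleftrightarrow>
    (\<forall>U k e. orthonormal_frame_on A gM (vertical A B F) U k e \<longrightarrow>
      (\<forall>p\<in>U. T p (\<Sum>i<k. DM (e i) p (e i p)) = 0))"
proof
  assume har: "harmonic A gM DM B F DF"
  show "\<forall>U k e. orthonormal_frame_on A gM (vertical A B F) U k e \<longrightarrow>
      (\<forall>p\<in>U. T p (\<Sum>i<k. DM (e i) p (e i p)) = 0)"
  proof (intro allI impI ballI)
    fix U k e p assume e: "orthonormal_frame_on A gM (vertical A B F) U k e" and p: "p \<in> U"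
    obtain m H where H: "orthonormal_frame_on A gM (horizontal A gM B F) U m H" using H[OF e] by blast
    note f = adapted_frame[OF e H]
    from har f p have "(\<Sum>i<k + m. sff ((if i < k then e i else H (i - k))) p ((if i < k then e i else H (i - k)) p)) = 0"
      unfolding harmonic_def second_fund_form_eq by blast
    then show "T p (\<Sum>i<k. DM (e i) p (e i p)) = 0"
      unfolding trace_sff_eq[OF e H f p p] by simp
  qed
next
  assume *: "\<forall>U k e. orthonormal_frame_on A gM (vertical A B F) U k e \<longrightarrow>
      (\<forall>p\<in>U. T p (\<Sum>i<k. DM (e i) p (e i p)) = 0)"
  show "harmonic A gM DM B F DF"
    unfolding harmonic_def second_fund_form_eq
  proof (intro allI impI ballI)
    fix V l f p assume f: "orthonormal_frame_on A gM (\<lambda>_. UNIV) V l f" and p: "p \<in> V"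
    obtain U k e where pU: "p \<in> U" and e: "orthonormal_frame_on A gM (vertical A B F) U k e"
      by (rule local_vertical_frame)
    obtain m H where "orthonormal_frame_on A gM (horizontal A gM B F) U m H" using H[OF e] by blast
    from trace_sff_eq[OF e this f pU p] show "(\<Sum>i<l. sff (f i) p (f i p)) = 0" using * e pU by simp
  qed
qed

end

section \<open>Anti-invariant submersions from Sasakian manifolds\<close>

locale anti_invariant_submersion = riemannian_submersion_map A gM B gN F DM DN DF
  for A :: "('a::{t2_space, second_countable_topology}, 'e::euclidean_space) chart set"
    and gM :: "'a \<Rightarrow> 'e \<Rightarrow> 'e \<Rightarrow> real"
    and B :: "('b::{t2_space, second_countable_topology}, 'f::euclidean_space) chart set"
    and gN :: "'b \<Rightarrow> 'f \<Rightarrow> 'f \<Rightarrow> real"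
    and F :: "'a \<Rightarrow> 'b" and DM and DN and DF +
  fixes \<phi> :: "'a \<Rightarrow> 'e \<Rightarrow> 'e" and \<xi> :: "'a \<Rightarrow> 'e" and \<eta> :: "'a \<Rightarrow> 'e \<Rightarrow> real"
  assumes sas: "sasakian_manifold A \<phi> \<xi> \<eta> gM DM"
    and anti: "anti_invariant A gM B F \<phi>"
    and hor_sum: "\<And>p. orthogonal_direct_sum (gM p)
      (horizontal A gM B F p) (\<phi> p ` vertical A B F p) (span {\<xi> p})"
begin

lemma linear_\<phi>: "linear (\<phi> p)"
  and field_\<phi>: "vector_field_on A U X \<Longrightarrow> vector_field_on A U (\<lambda>q. \<phi> q (X q))"
proof -
  have "endo_field A \<phi>" using sas unfolding sasakian_manifold_def by (elim conjE)
  then show "linear (\<phi> p)"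
    and "vector_field_on A U X \<Longrightarrow> vector_field_on A U (\<lambda>q. \<phi> q (X q))"
    by (simp_all add: endo_field_def)
qed

lemma field_\<xi>: "open U \<Longrightarrow> vector_field_on A U \<xi>"
  using dom.triv.field_along_subset[of UNIV \<xi> U] sas[unfolded sasakian_manifold_def] by simp

lemma \<phi>_\<phi>: "\<phi> p (\<phi> p v) = - v + \<eta> p v *\<^sub>R \<xi> p"
  and \<phi>_\<xi>: "\<phi> p (\<xi> p) = 0"
  and \<eta>_\<phi>: "\<eta> p (\<phi> p v) = 0"
  and \<eta>_\<xi>: "\<eta> p (\<xi> p) = 1"
  and g_\<phi>_\<phi>: "gM p (\<phi> p v) (\<phi> p w) = gM p v w - \<eta> p v * \<eta> p w"
  and \<eta>_eq: "\<eta> p v = gM p v (\<xi> p)"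
proof -
  have "\<forall>p v. \<phi> p (\<phi> p v) = - v + \<eta> p v *\<^sub>R \<xi> p" "\<forall>p. \<phi> p (\<xi> p) = 0"
    "\<forall>p v. \<eta> p (\<phi> p v) = 0" "\<forall>p. \<eta> p (\<xi> p) = 1"
    "\<forall>p v w. gM p (\<phi> p v) (\<phi> p w) = gM p v w - \<eta> p v * \<eta> p w" "\<forall>p v. \<eta> p v = gM p v (\<xi> p)"
    using sas unfolding sasakian_manifold_def by - (elim conjE, assumption)+
  then show "\<phi> p (\<phi> p v) = - v + \<eta> p v *\<^sub>R \<xi> p" "\<phi> p (\<xi> p) = 0"
    "\<eta> p (\<phi> p v) = 0" "\<eta> p (\<xi> p) = 1"
    "gM p (\<phi> p v) (\<phi> p w) = gM p v w - \<eta> p v * \<eta> p w" "\<eta> p v = gM p v (\<xi> p)"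
    by blast+
qed

lemma DM_\<phi>:
  assumes "vector_field_on A U Y" "p \<in> U"
  shows "DM (\<lambda>q. \<phi> q (Y q)) p v = \<phi> p (DM Y p v) + (gM p v (Y p) *\<^sub>R \<xi> p - \<eta> p (Y p) *\<^sub>R v)"
proof -
  have "\<forall>U Y. vector_field_on A U Y \<longrightarrow>
      (\<forall>p\<in>U. \<forall>v. DM (\<lambda>q. \<phi> q (Y q)) p v - \<phi> p (DM Y p v) = gM p v (Y p) *\<^sub>R \<xi> p - \<eta> p (Y p) *\<^sub>R v)"
    using sas unfolding sasakian_manifold_def by (elim conjE)
  then have "DM (\<lambda>q. \<phi> q (Y q)) p v - \<phi> p (DM Y p v) = gM p v (Y p) *\<^sub>R \<xi> p - \<eta> p (Y p) *\<^sub>R v"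
    using assms by blast
  then show ?thesis by (simp add: algebra_simps)
qed

text \<open>The metric condition is applied with \<open>\<phi> p w\<close> as second vector:
  applying \<open>\<phi>\<close> to it once more gives \<open>- w\<close> up to a multiple of
  \<open>\<xi> p\<close>, which is orthogonal to the image of \<open>\<phi>\<close>.\<close>

lemma \<phi>_skew: "gM p (\<phi> p v) w = - gM p v (\<phi> p w)"
  using g_\<phi>_\<phi>[of p v "\<phi> p w"]
  by (simp add: \<phi>_\<phi> \<eta>_\<phi> M.g_linear_simps flip: \<eta>_eq)

lemma \<phi>_vertical: "v \<in> vertical A B F p \<Longrightarrow> \<phi> p v \<in> horizontal A gM B F p"
  using anti by (auto simp: anti_invariant_def)

lemma horizontalE:
  assumes "h \<in> horizontal A gM B F p"
  obtains v a where "v \<in> vertical A B F p" "h = \<phi> p v + a *\<^sub>R \<xi> p"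
  using assms hor_sum[of p] unfolding orthogonal_direct_sum_def by (auto simp: span_singleton)

text \<open>The zero vector is vertical, so \<open>\<phi> p 0 + \<xi> p\<close> lies in the assumed
  sum.\<close>

lemma \<xi>_horizontal: "\<xi> p \<in> horizontal A gM B F p"
proof -
  have "\<phi> p 0 + \<xi> p \<in> {s + t |s t. s \<in> \<phi> p ` vertical A B F p \<and> t \<in> span {\<xi> p}}"
    using subspace_0[OF subspace_vertical] by (blast intro: span_base)
  then show ?thesis
    using hor_sum[of p] by (simp add: orthogonal_direct_sum_def linear_0[OF linear_\<phi>])
qed

lemma \<eta>_vertical: "v \<in> vertical A B F p \<Longrightarrow> \<eta> p v = 0"
  by (simp add: \<eta>_eq horizontalD'[OF \<xi>_horizontal])

text \<open>Since \<open>\<eta>\<close> vanishes on vertical vectors, \<open>\<phi>\<close> is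
  isometric there, and \<open>\<xi>\<close> is a unit vector orthogonal to its image; the assumed
  splitting gives the span.\<close>

lemma horizontal_frame:
  assumes e: "orthonormal_frame_on A gM (vertical A B F) U k e"
  shows "orthonormal_frame_on A gM (horizontal A gM B F) U (Suc k)
    (\<lambda>i q. if i < k then \<phi> q (e i q) else \<xi> q)"
proof -
  note e' = orthonormal_frameD[OF e]
  define H where "H i q = (if i < k then \<phi> q (e i q) else \<xi> q)" for i q
  have "orthonormal_frame_on A gM (horizontal A gM B F) U (Suc k) H"
    unfolding orthonormal_frame_on_def
  proof (intro conjI ballI allI impI)
    show "open U" by (rule e'(1))
    show "vector_field_on A U (H i)" for i
      using field_\<phi>[OF e'(2)] field_\<xi>[OF e'(1)] by (cases "i < k") (auto simp: H_def[abs_def])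
    fix q assume q: "q \<in> U"
    have \<phi>\<xi>: "gM q (\<phi> q v) (\<xi> q) = 0" "gM q (\<xi> q) (\<phi> q v) = 0" for v
      using \<eta>_\<phi>[of q v] by (simp_all add: \<eta>_eq M.g_sym[of q "\<xi> q"])
    show "gM q (H i q) (H j q) = (if i = j then 1 else 0)" if "i < Suc k" "j < Suc k" for i j
      using that orthonormalD[OF e'(3)[OF q], of i j] \<eta>_vertical[OF e'(5)[OF q]] \<eta>_\<xi>[of q]
      by (auto simp: H_def g_\<phi>_\<phi> \<phi>\<xi> \<eta>_eq)
    have "H i q \<in> horizontal A gM B F q" if "i < Suc k" for i
      using that \<phi>_vertical[OF e'(5)[OF q]] \<xi>_horizontal by (simp add: H_def)
    then have "span ((\<lambda>i. H i q) ` {..<Suc k}) \<subseteq> horizontal A gM B F q"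
      by (intro span_minimal subspace_horizontal) auto
    moreover have "h \<in> span ((\<lambda>i. H i q) ` {..<Suc k})" if "h \<in> horizontal A gM B F q" for h
    proof -
      obtain v a where v: "v \<in> vertical A B F q" and h: "h = \<phi> q v + a *\<^sub>R \<xi> q"
        using horizontalE[OF \<open>h \<in> _\<close>] .
      have "\<phi> q v \<in> \<phi> q ` span ((\<lambda>i. e i q) ` {..<k})" using v e'(4)[OF q] by blast
      also have "\<dots> = span ((\<lambda>i. H i q) ` {..<k})"
        unfolding span_linear_image[OF linear_\<phi>, symmetric] image_image
        by (intro arg_cong[of _ _ span] image_cong) (auto simp: H_def)
      also have "\<dots> \<subseteq> span ((\<lambda>i. H i q) ` {..<Suc k})" by (intro span_mono image_mono) auto
      finally have "\<phi> q v \<in> span ((\<lambda>i. H i q) ` {..<Suc k})" .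
      moreover have "\<xi> q \<in> span ((\<lambda>i. H i q) ` {..<Suc k})"
        by (rule span_base, rule image_eqI[of _ _ k]) (auto simp: H_def)
      ultimately show ?thesis unfolding h by (intro span_add span_scale)
    qed
    ultimately show "span ((\<lambda>i. H i q) ` {..<Suc k}) = horizontal A gM B F q" by blast
  qed
  then show ?thesis by (simp add: H_def[abs_def])
qed

section \<open>Covariant derivatives of vertical fields\<close>

text \<open>The Sasakian identity for \<open>\<xi>\<close> itself, where
  \<open>\<phi> p (\<xi> p) = 0\<close>, gives \<open>\<phi> p (DM \<xi> p v) = v\<close>. The
  product thus equals that of the horizontal \<open>\<phi> p w\<close> with the vertical
  \<open>v\<close>.\<close>

lemma DM_\<xi>_vertical:
  assumes v: "v \<in> vertical A B F p" and w: "w \<in> vertical A B F p"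
  shows "gM p w (DM \<xi> p v) = 0"
proof -
  have "\<phi> p (DM \<xi> p v) = v"
    using DM_\<phi>[OF field_\<xi>[OF open_UNIV], of p v] DM.D_zero[OF open_UNIV UNIV_I, of "\<lambda>q. \<phi> q (\<xi> q)" p v]
      \<eta>_vertical[OF v]
    by (simp add: \<phi>_\<xi> \<eta>_\<xi> flip: \<eta>_eq)
  then have "gM p w (DM \<xi> p v) = gM p (\<phi> p w) v"
    using g_\<phi>_\<phi>[of p w "DM \<xi> p v"] \<eta>_vertical[OF w] by simp
  then show ?thesis using horizontalD[OF \<phi>_vertical[OF w] v] by simp
qed

text \<open>Obtained by differentiating \<open>gM q (X q) (\<xi> q) = 0\<close>. It is the reason
  why the direction \<open>\<xi>\<close> imposes no condition on the mean curvature.\<close>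

lemma mean_curvature_\<xi>:
  assumes X: "vector_field_on A U X" "\<And>q. q \<in> U \<Longrightarrow> X q \<in> vertical A B F q"
    and p: "p \<in> U" and v: "v \<in> vertical A B F p"
  shows "gM p (DM X p v) (\<xi> p) = 0"
proof -
  have U: "open U" using field_along_onD_open[OF X(1)] .
  have "gM p (DM X p v) (\<xi> p) + gM p (X p) (DM \<xi> p v) = 0"
    unfolding metric_M[OF X(1) field_\<xi>[OF U] p, symmetric]
    using dom.dfun_cong[OF U p, of "\<lambda>q. gM q (X q) (\<xi> q)" "\<lambda>q. 0"]
      horizontalD'[OF \<xi>_horizontal X(2)] by (simp add: dom.dfun_const)
  then show ?thesis using DM_\<xi>_vertical[OF v X(2)[OF p]] by simp
qed

text \<open>Anti-invariance makes \<open>gM q (X q) (\<phi> q (Y q))\<close> vanish on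
  \<open>U\<close>. In its derivative the correction terms of the Sasakian identity carry
  \<open>\<xi> p\<close>, orthogonal to \<open>X p\<close>, or the factor
  \<open>\<eta> p (Y p) = 0\<close>; skewness of \<open>\<phi>\<close> does the rest.\<close>

lemma vertical_form_symmetric:
  assumes X: "vector_field_on A U X" "\<And>q. q \<in> U \<Longrightarrow> X q \<in> vertical A B F q"
    and Y: "vector_field_on A U Y" "\<And>q. q \<in> U \<Longrightarrow> Y q \<in> vertical A B F q" and p: "p \<in> U"
  shows "gM p (DM X p v) (\<phi> p (Y p)) = gM p (DM Y p v) (\<phi> p (X p))"
proof -
  have U: "open U" using field_along_onD_open[OF X(1)] .
  have "gM p (DM X p v) (\<phi> p (Y p)) + gM p (X p) (DM (\<lambda>q. \<phi> q (Y q)) p v) = 0"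
    unfolding metric_M[OF X(1) field_\<phi>[OF Y(1)] p, symmetric]
    using dom.dfun_cong[OF U p, of "\<lambda>q. gM q (X q) (\<phi> q (Y q))" "\<lambda>q. 0"]
      horizontalD'[OF \<phi>_vertical[OF Y(2)] X(2)] by (simp add: dom.dfun_const)
  moreover have "gM p (X p) (DM (\<lambda>q. \<phi> q (Y q)) p v) = gM p (X p) (\<phi> p (DM Y p v))"
    using \<eta>_vertical[OF X(2)[OF p]] \<eta>_vertical[OF Y(2)[OF p]]
    by (simp add: DM_\<phi>[OF Y(1) p] M.g_linear_simps flip: \<eta>_eq)
  ultimately show ?thesis
    using \<phi>_skew[of p "X p" "DM Y p v"] M.g_sym[of p "\<phi> p (X p)" "DM Y p v"] by linarith
qed

text \<open>The integrability of the vertical distribution, without mentioning brackets.\<close>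

lemma vertical_form_integrable:
  assumes X: "vector_field_on A U X" "\<And>q. q \<in> U \<Longrightarrow> X q \<in> vertical A B F q"
    and Y: "vector_field_on A U Y" "\<And>q. q \<in> U \<Longrightarrow> Y q \<in> vertical A B F q" and p: "p \<in> U"
    and h: "h \<in> horizontal A gM B F p"
  shows "gM p (DM X p (Y p)) h = gM p (DM Y p (X p)) h"
proof -
  \<comment> \<open>For vertical fields, symmetry of \<open>sff\<close> says that the differential
    of \<open>F\<close> kills this difference.\<close>
  have "DM X p (Y p) - DM Y p (X p) \<in> vertical A B F p"
    using sff_symmetric[OF Y(1) X(1) p] sff_vertical[OF X p] sff_vertical[OF Y p]
    by (simp add: vertical_def T_diff)
  from horizontalD'[OF h this] show ?thesis by (simp add: M.g_linear_simps)
qed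

lemma oneill_T_vertical:
  assumes X: "vector_field_on A U X" "\<And>q. q \<in> U \<Longrightarrow> X q \<in> vertical A B F q"
    and p: "p \<in> U" and V: "V p \<in> vertical A B F p" and w: "w \<in> vertical A B F p"
  shows "gM p (\<phi> p (oneill_T A gM DM B F V X p)) w = - gM p (DM X p (V p)) (\<phi> p w)"
proof -
  have U: "open U" using field_along_onD_open[OF X(1)] .
  \<comment> \<open>The projected field is known to equal \<open>X\<close> only on \<open>U\<close>,
    so the replacement inside \<open>DM\<close> rests on locality.\<close>
  have "DM (\<lambda>q. ver_proj A gM B F q (X q)) p (V p) = DM X p (V p)"
    by (rule DM.D_local[OF dom.triv.field_along_cong[OF X(1)] X(1) p])
      (simp_all add: ver_proj_vertical[OF X(2)])
  moreover have "DM (\<lambda>q. hor_proj A gM B F q (X q)) p (V p) = 0"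
    by (rule DM.D_zero[OF U p]) (simp add: hor_proj_vertical[OF X(2)])
  moreover have "ver_proj A gM B F p 0 = 0"
    by (rule ver_proj_vertical[OF subspace_0[OF subspace_vertical]])
  ultimately have T: "oneill_T A gM DM B F V X p = hor_proj A gM B F p (DM X p (V p))"
    by (simp add: oneill_T_def ver_proj_vertical[OF V])
  obtain v h where vh: "v \<in> vertical A B F p" "h \<in> horizontal A gM B F p" "DM X p (V p) = v + h"
    by (rule vertical_horizontal_decomposition)
  then show ?thesis
    by (simp add: T hor_proj_add \<phi>_skew M.g_linear_simps horizontalD'[OF \<phi>_vertical[OF w]])
qed

text \<open>Each term is linear in \<open>V p\<close>, which is expanded in the frame with
  coefficients frozen at \<open>p\<close>; this reduces the formula to frame vectors.\<close>

lemma trace_phi_T: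
  assumes e: "orthonormal_frame_on A gM (vertical A B F) U k e" and p: "p \<in> U"
    and V: "V p \<in> vertical A B F p"
  shows "(\<Sum>i<k. gM p (\<phi> p (oneill_T A gM DM B F V (e i) p)) (e i p)) =
    - gM p (\<Sum>i<k. DM (e i) p (e i p)) (\<phi> p (V p))"
proof -
  note e' = orthonormal_frameD[OF e]
  have ver: "e i q \<in> vertical A B F q" if "i < k" "q \<in> U" for i q using e'(5) that by blast
  define c where "c j = gM p (V p) (e j p)" for j
  have Vp: "V p = (\<Sum>j<k. c j *\<^sub>R e j p)"
    unfolding c_def by (rule orthonormal_expansion[OF M.bilinear_g e'(3)[OF p]]) (simp add: e'(4)[OF p] V)
  \<comment> \<open>Integrability exchanges the direction \<open>e j\<close> with the differentiated
    \<open>e i\<close>; the symmetry of the form then exchanges the differentiated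
    \<open>e j\<close> with the \<open>e i\<close> under \<open>\<phi>\<close>.\<close>
  have C: "gM p (DM (e i) p (e j p)) (\<phi> p (e i p)) = gM p (DM (e i) p (e i p)) (\<phi> p (e j p))"
    if ij: "i < k" "j < k" for i j
  proof -
    have "gM p (DM (e i) p (e j p)) (\<phi> p (e i p)) = gM p (DM (e j) p (e i p)) (\<phi> p (e i p))"
      by (rule vertical_form_integrable[OF e'(2) ver e'(2) ver p \<phi>_vertical]) (use ij ver p in auto)
    also have "\<dots> = gM p (DM (e i) p (e i p)) (\<phi> p (e j p))"
      by (rule vertical_form_symmetric[OF e'(2) ver e'(2) ver p]) (use ij in auto)
    finally show ?thesis .
  qed
  have D: "gM p (DM (e i) p (V p)) (\<phi> p (e i p)) = gM p (DM (e i) p (e i p)) (\<phi> p (V p))" if i: "i < k" for i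
  proof -
    have lin: "linear (DM (e i) p)" by (rule DM.D_linear[OF e'(2)[OF i] p])
    show ?thesis
      unfolding Vp using C[OF i]
      by (simp add: linear_sum[OF lin] linear_cmul[OF lin] linear_sum[OF linear_\<phi>] linear_cmul[OF linear_\<phi>]
          M.g_sum_left M.g_sum_right M.g_linear_simps)
  qed
  have "(\<Sum>i<k. gM p (\<phi> p (oneill_T A gM DM B F V (e i) p)) (e i p)) =
      (\<Sum>i<k. - gM p (DM (e i) p (e i p)) (\<phi> p (V p)))"
  proof (rule sum.cong[OF refl])
    fix i assume "i \<in> {..<k}"
    then have i: "i < k" by simp
    show "gM p (\<phi> p (oneill_T A gM DM B F V (e i) p)) (e i p) = - gM p (DM (e i) p (e i p)) (\<phi> p (V p))"
      using oneill_T_vertical[where V = V, OF e'(2)[OF i] ver[OF i] p V ver[OF i p]] D[OF i] by simp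
  qed
  then show ?thesis by (simp add: M.g_sum_left sum_negf)
qed

text \<open>If all the products vanish, the horizontal part of the mean curvature, being of the form
  \<open>\<phi> p w + a *\<^sub>R \<xi> p\<close>, is orthogonal to itself.\<close>

lemma T_mean_curvature_eq_0_iff:
  assumes e: "orthonormal_frame_on A gM (vertical A B F) U k e" and p: "p \<in> U"
  shows "T p (\<Sum>i<k. DM (e i) p (e i p)) = 0 \<longleftrightarrow>
    (\<forall>v\<in>vertical A B F p. gM p (\<Sum>i<k. DM (e i) p (e i p)) (\<phi> p v) = 0)" (is "T p ?H = 0 \<longleftrightarrow> ?R")
proof
  assume "T p ?H = 0"
  then have "?H \<in> vertical A B F p" by (simp add: vertical_def)
  then show ?R using horizontalD'[OF \<phi>_vertical] by blast
next
  assume R: ?R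
  note e' = orthonormal_frameD[OF e]
  have \<xi>: "gM p ?H (\<xi> p) = 0"
    unfolding M.g_sum_left
  proof (rule sum.neutral, rule ballI)
    fix i assume "i \<in> {..<k}"
    then show "gM p (DM (e i) p (e i p)) (\<xi> p) = 0"
      using e' p by (intro mean_curvature_\<xi>[of U]) auto
  qed
  obtain v h where vh: "v \<in> vertical A B F p" "h \<in> horizontal A gM B F p" "?H = v + h"
    by (rule vertical_horizontal_decomposition)
  obtain w a where w: "w \<in> vertical A B F p" "h = \<phi> p w + a *\<^sub>R \<xi> p"
    using horizontalE[OF vh(2)] .
  have "gM p h h = gM p ?H h"
    using vh horizontalD'[OF vh(2) vh(1)] by (simp add: M.g_linear_simps)
  also have "\<dots> = 0" unfolding w(2) using R w(1) \<xi> by (simp add: M.g_linear_simps)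
  finally have "h = 0" by (simp add: M.g_eq_0_iff)
  then show "T p ?H = 0" using vh by (simp add: verticalD)
qed

text \<open>The trace condition speaks of global vertical fields, while the mean curvature is tested
  on vectors at a point. Constant coefficients in a local frame, followed by a cut-off, connect the
  two.\<close>

lemma vertical_field_extension:
  assumes "v \<in> vertical A B F p"
  obtains V where "vertical_field A B F V" "V p = v"
proof -
  obtain U k e where p: "p \<in> U" and e: "orthonormal_frame_on A gM (vertical A B F) U k e"
    by (rule local_vertical_frame)
  note e' = orthonormal_frameD[OF e]
  define W where "W q = (\<Sum>j<k. gM p v (e j p) *\<^sub>R e j q)" for q
  have W: "vector_field_on A U W"
    unfolding W_def
    by (intro dom.triv.field_along_sum dom.triv.field_along_scaleR dom.smooth_fun_on_const e') auto
  have Wp: "W p = v"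
    unfolding W_def
    by (rule orthonormal_expansion[OF M.bilinear_g e'(3)[OF p], symmetric]) (simp add: e'(4)[OF p] assms)
  have Wver: "W q \<in> vertical A B F q" if "q \<in> U" for q
    unfolding W_def using e'(5)[OF that] by (intro subspace_sum subspace_scale subspace_vertical) auto
  obtain Z where Z: "vector_field_on A UNIV Z" "Z p = W p" "\<And>q. \<exists>k. Z q = k *\<^sub>R W q" "\<And>q. q \<notin> U \<Longrightarrow> Z q = 0"
    using dom.triv.field_along_extend[OF W p] by blast
  have "Z q \<in> vertical A B F q" for q
  proof (cases "q \<in> U")
    case True
    then show ?thesis using Z(3)[of q] Wver subspace_scale[OF subspace_vertical] by auto
  next
    case False
    then show ?thesis using Z(4) subspace_0[OF subspace_vertical] by simp
  qed
  then show thesis using that[of Z] Z(1,2) Wp by (simp add: vertical_field_def)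
qed

theorem harmonic_iff_trace_phi_T_zero:
  "harmonic A gM DM B F DF \<longleftrightarrow>
    (\<forall>V. vertical_field A B F V \<longrightarrow> trace_phi_T_zero A gM DM B F \<phi> V)"
proof -
  have "harmonic A gM DM B F DF \<longleftrightarrow>
    (\<forall>U k e. orthonormal_frame_on A gM (vertical A B F) U k e \<longrightarrow>
      (\<forall>p\<in>U. \<forall>v\<in>vertical A B F p. gM p (\<Sum>i<k. DM (e i) p (e i p)) (\<phi> p v) = 0))"
    using harmonic_iff horizontal_frame T_mean_curvature_eq_0_iff by (smt (verit))
  also have "\<dots> \<longleftrightarrow> (\<forall>V. vertical_field A B F V \<longrightarrow> trace_phi_T_zero A gM DM B F \<phi> V)"
  proof (intro iffI allI impI ballI)
    fix V
    assume *: "\<forall>U k e. orthonormal_frame_on A gM (vertical A B F) U k e \<longrightarrow>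
      (\<forall>p\<in>U. \<forall>v\<in>vertical A B F p. gM p (\<Sum>i<k. DM (e i) p (e i p)) (\<phi> p v) = 0)"
      and V: "vertical_field A B F V"
    have ver: "V p \<in> vertical A B F p" for p using V by (simp add: vertical_field_def)
    show "trace_phi_T_zero A gM DM B F \<phi> V"
      unfolding trace_phi_T_zero_def
    proof (intro allI impI ballI)
      fix U k e p assume e: "orthonormal_frame_on A gM (vertical A B F) U k e" and p: "p \<in> U"
      then show "(\<Sum>i<k. gM p (\<phi> p (oneill_T A gM DM B F V (e i) p)) (e i p)) = 0"
        unfolding trace_phi_T[where V = V, OF e p ver] using * ver by simp
    qed
  next
    fix U k e p v
    assume *: "\<forall>V. vertical_field A B F V \<longrightarrow> trace_phi_T_zero A gM DM B F \<phi> V"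
      and e: "orthonormal_frame_on A gM (vertical A B F) U k e" and p: "p \<in> U"
      and v: "v \<in> vertical A B F p"
    obtain V where V: "vertical_field A B F V" "V p = v" using vertical_field_extension[OF v] .
    then have "(\<Sum>i<k. gM p (\<phi> p (oneill_T A gM DM B F V (e i) p)) (e i p)) = 0"
      using * e p unfolding trace_phi_T_zero_def by blast
    then show "gM p (\<Sum>i<k. DM (e i) p (e i p)) (\<phi> p v) = 0"
      using trace_phi_T[OF e p, of V] V v by simp
  qed
  finally show ?thesis .
qed

end

theorem theorem13:
  fixes A :: "('a::{t2_space, second_countable_topology}, 'e::euclidean_space) chart set"
    and B :: "('b::{t2_space, second_countable_topology}, 'f::euclidean_space) chart set"
    and \<phi> :: "'a \<Rightarrow> 'e \<Rightarrow> 'e" and \<xi> :: "'a \<Rightarrow> 'e" and \<eta> :: "'a \<Rightarrow> 'e \<Rightarrow> real"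
    and g\<^sub>M :: "'a \<Rightarrow> 'e \<Rightarrow> 'e \<Rightarrow> real" and g\<^sub>N :: "'b \<Rightarrow> 'f \<Rightarrow> 'f \<Rightarrow> real"
    and D\<^sub>M :: "('a \<Rightarrow> 'e) \<Rightarrow> 'a \<Rightarrow> 'e \<Rightarrow> 'e" and D\<^sub>N :: "('b \<Rightarrow> 'f) \<Rightarrow> 'b \<Rightarrow> 'f \<Rightarrow> 'f"
    and D\<^sub>F :: "('a \<Rightarrow> 'f) \<Rightarrow> 'a \<Rightarrow> 'e \<Rightarrow> 'f"
    and F :: "'a \<Rightarrow> 'b"
  assumes "sasakian_manifold A \<phi> \<xi> \<eta> g\<^sub>M D\<^sub>M"
    and "smooth_manifold B" and "riemannian_metric B g\<^sub>N" and "levi_civita B g\<^sub>N D\<^sub>N"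
    and "riemannian_submersion A g\<^sub>M B g\<^sub>N F"
    and "anti_invariant A g\<^sub>M B F \<phi>"
    and "\<And>p. orthogonal_direct_sum (g\<^sub>M p)
              (horizontal A g\<^sub>M B F p) (\<phi> p ` vertical A B F p) (span {\<xi> p})"
    and "pullback_connection A B F D\<^sub>N D\<^sub>F"
  shows "harmonic A g\<^sub>M D\<^sub>M B F D\<^sub>F \<longleftrightarrow>
         (\<forall>V. vertical_field A B F V \<longrightarrow> trace_phi_T_zero A g\<^sub>M D\<^sub>M B F \<phi> V)"
proof -
  have "smooth_manifold A" "riemannian_metric A g\<^sub>M" "levi_civita A g\<^sub>M D\<^sub>M"
    using assms(1) unfolding sasakian_manifold_def by - (elim conjE, assumption)+
  moreover have "smooth_map A B F" using assms(5) by (simp add: riemannian_submersion_def)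
  ultimately have "anti_invariant_submersion A g\<^sub>M B g\<^sub>N F D\<^sub>M D\<^sub>N D\<^sub>F \<phi> \<xi> \<eta>"
    using assms by unfold_locales
  then show ?thesis by (rule anti_invariant_submersion.harmonic_iff_trace_phi_T_zero)
qed

end
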